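(* Let $R$ be an integral domain such that its fraction field $K$ is imperfect (i.e. $K^p\neq K$) if of characteristic $p>0$. The following are equivalent. (i) $R$ is a Hilbertian ring. (ii) Every separable Hilbert subset of $K$ contains elements $\lambda^\ast\in R$. (iii) For every integer $r\geq 1$, every nonzero $\lambda_0^\ast\in R$ and every $\underline a=(a_1,\ldots,a_r)\in R^r$, every Hilbert subset of $K^r$ contains $r$-tuples $\underline\lambda^\ast=(\lambda_1^\ast,\ldots,\lambda_r^\ast)$ with nonzero coordinates in $R$ and such that $\lambda_i^\ast\equiv a_i \pmod{\lambda_0^\ast\cdots\lambda_{i-1}^\ast}$ for $i=1,\ldots,r$.
   Context: Hilbert subsets: let $K$ be a field, $\underline\lambda=(\lambda_1,\ldots,\lambda_r)$ and $\underline x=(x_1,\ldots,x_n)$ tuples of indeterminates ($r,n\geq1$). Given $f_1,\ldots,f_m$ ($m\geq 1$) irreducible in $K(\underline\lambda)[\underline x]$ and a nonzero $g\in K[\underline\lambda]$, the set $H_K(f_1,\ldots,f_m;g)$ of all $\underline\lambda^\ast\in K^r$ such that $f_i(\underline\lambda^\ast,\underline x)$ is (defined and) irreducible in $K[\underline x]$ for each $i$ and $g(\underline\lambda^\ast)\neq0$ is called a Hilbert subset of $K^r$. If in addition $n=1$ and each $f_i$ is separable in $x$ (no multiple root in $\overline{K(\underline\lambda)}$), it is called a separable Hilbert subset of $K^r$. An integral domain $R$ with fraction field $K$ is a Hilbertian ring if for every $r\geq1$, every separable Hilbert subset of $K^r$ contains $r$-tuples with all coordinates in $R$. *)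

theory Defs
  imports
    "HOL-Library.Poly_Mapping"
    "HOL-Library.FuncSet"
    "HOL-Computational_Algebra.Computational_Algebra"
    "HOL-Algebra.Algebraic_Closure_Type"
begin

text \<open>
  Polynomials in the indeterminates with indices \<open>1, 2, \<dots>\<close> are finitely supported families of
  coefficients, indexed by finitely supported exponent vectors. The number of indeterminates
  is bounded by means of explicit carriers, since it has to be quantified over.
\<close>

type_synonym 'k mpoly = "(nat \<Rightarrow>\<^sub>0 nat) \<Rightarrow>\<^sub>0 'k"

text \<open>
  The ring \<open>S[X\<^sub>1, \<dots>, X\<^sub>n]\<close>, for \<open>S\<close> a subring of the type \<^typ>\<open>'k\<close>.
\<close>

definition mpoly_ring :: "'k::idom set \<Rightarrow> nat \<Rightarrow> 'k mpoly ring" where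
  "mpoly_ring S n = ring_of_type_algebra
     \<lparr>carrier := {p. (\<forall>m\<in>Poly_Mapping.keys p. Poly_Mapping.keys m \<subseteq> {1..n}) \<and>
                     (\<forall>m. Poly_Mapping.lookup p m \<in> S)}\<rparr>"

definition mpoly_eval :: "(nat \<Rightarrow> 'k::comm_ring_1) \<Rightarrow> 'k mpoly \<Rightarrow> 'k" where
  "mpoly_eval lam p =
     (\<Sum>m\<in>Poly_Mapping.keys p. Poly_Mapping.lookup p m *
        (\<Prod>i\<in>Poly_Mapping.keys m. lam i ^ Poly_Mapping.lookup m i))"

text \<open>
  The field \<open>K(\<lambda>\<^sub>1, \<dots>, \<lambda>\<^sub>r)\<close>, as a subfield of the field of rational functions in all
  indeterminates \<open>\<lambda>\<^sub>1, \<lambda>\<^sub>2, \<dots>\<close>.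
\<close>

definition ratfuns :: "nat \<Rightarrow> 'k::field mpoly fract set" where
  "ratfuns r = {Fraction_Field.Fract p q | p q.
     p \<in> carrier (mpoly_ring UNIV r) \<and> q \<in> carrier (mpoly_ring UNIV r) \<and> q \<noteq> 0}"

text \<open>
  The rational function \<open>c\<close> in \<open>r\<close> indeterminates is defined at the point \<open>lam\<close>,
  and its value there is \<open>v\<close>.
\<close>

definition ratfun_value :: "nat \<Rightarrow> (nat \<Rightarrow> 'k::field) \<Rightarrow> 'k mpoly fract \<Rightarrow> 'k \<Rightarrow> bool" where
  "ratfun_value r lam c v \<longleftrightarrow>
     (\<exists>p\<in>carrier (mpoly_ring UNIV r). \<exists>q\<in>carrier (mpoly_ring UNIV r).
        c = Fraction_Field.Fract p q \<and> mpoly_eval lam q \<noteq> 0 \<and>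
        v = mpoly_eval lam p / mpoly_eval lam q)"

text \<open>
  For \<open>f\<close> in \<open>K(\<lambda>\<^sub>1, \<dots>, \<lambda>\<^sub>r)[x\<^sub>1, \<dots>, x\<^sub>n]\<close>: the specialized polynomial
  \<open>f(lam, x\<^sub>1, \<dots>, x\<^sub>n)\<close> is defined and equal to \<open>h\<close>.
\<close>

definition specializes_to ::
    "nat \<Rightarrow> (nat \<Rightarrow> 'k::field) \<Rightarrow> 'k mpoly fract mpoly \<Rightarrow> 'k mpoly \<Rightarrow> bool" where
  "specializes_to r lam f h \<longleftrightarrow>
     (\<forall>m. ratfun_value r lam (Poly_Mapping.lookup f m) (Poly_Mapping.lookup h m))"

text \<open>
  Elements of \<open>K\<^sup>r\<close> are functions on \<open>{1..r}\<close>, extended by \<^const>\<open>undefined\<close>.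
\<close>

definition hilbert_set ::
    "nat \<Rightarrow> nat \<Rightarrow> 'k::field mpoly fract mpoly set \<Rightarrow> 'k mpoly \<Rightarrow> (nat \<Rightarrow> 'k) set" where
  "hilbert_set r n F g =
     {lam \<in> {1..r} \<rightarrow>\<^sub>E UNIV.
        (\<forall>f\<in>F. \<exists>h. specializes_to r lam f h \<and>
           h \<in> carrier (mpoly_ring UNIV n) \<and> ring_irreducible\<^bsub>mpoly_ring UNIV n\<^esub> h) \<and>
        mpoly_eval lam g \<noteq> 0}"

definition hilbert_data ::
    "nat \<Rightarrow> nat \<Rightarrow> 'k::field mpoly fract mpoly set \<Rightarrow> 'k mpoly \<Rightarrow> bool" where
  "hilbert_data r n F g \<longleftrightarrow>
     finite F \<and> F \<noteq> {} \<and>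
     (\<forall>f\<in>F. f \<in> carrier (mpoly_ring (ratfuns r) n) \<and>
            ring_irreducible\<^bsub>mpoly_ring (ratfuns r) n\<^esub> f) \<and>
     g \<in> carrier (mpoly_ring UNIV r) \<and> g \<noteq> 0"

definition hilbert_subset :: "nat \<Rightarrow> (nat \<Rightarrow> 'k::field) set \<Rightarrow> bool" where
  "hilbert_subset r H \<longleftrightarrow>
     (\<exists>n F g. n \<ge> 1 \<and> hilbert_data r n F g \<and> H = hilbert_set r n F g)"

text \<open>
  Reads a polynomial in the single indeterminate \<open>X\<^sub>1\<close> as a univariate polynomial.
\<close>

definition univariate :: "'k::comm_ring_1 mpoly \<Rightarrow> 'k poly" where
  "univariate f =
     (\<Sum>m\<in>Poly_Mapping.keys f.
        Polynomial.monom (Poly_Mapping.lookup f m) (Poly_Mapping.lookup m 1))"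

text \<open>
  Separability: no multiple root in an algebraic closure. The closure taken here is that of the
  field of rational functions in all indeterminates. It contains an algebraic closure of
  \<open>K(\<lambda>\<^sub>1, \<dots>, \<lambda>\<^sub>r)\<close>, in which all roots of a nonzero polynomial over
  \<open>K(\<lambda>\<^sub>1, \<dots>, \<lambda>\<^sub>r)\<close> lie.
\<close>

definition separable_in_x :: "'k::field mpoly fract mpoly \<Rightarrow> bool" where
  "separable_in_x f \<longleftrightarrow> rsquarefree (map_poly to_ac (univariate f))"

definition separable_hilbert_subset :: "nat \<Rightarrow> (nat \<Rightarrow> 'k::field) set \<Rightarrow> bool" where
  "separable_hilbert_subset r H \<longleftrightarrow>
     (\<exists>F g. hilbert_data r 1 F g \<and> (\<forall>f\<in>F. separable_in_x f) \<and> H = hilbert_set r 1 F g)"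

text \<open>
  The domain is the type \<^typ>\<open>'a\<close>, its fraction field is \<^typ>\<open>'a fract\<close>.
\<close>

abbreviation to_frac :: "'a::idom \<Rightarrow> 'a fract" where
  "to_frac x \<equiv> Fraction_Field.Fract x 1"

definition hilbertian_ring :: "'a::idom itself \<Rightarrow> bool" where
  "hilbertian_ring _ \<longleftrightarrow>
     (\<forall>r\<ge>1. \<forall>H :: (nat \<Rightarrow> 'a fract) set. separable_hilbert_subset r H \<longrightarrow>
        (\<exists>lam\<in>H. \<forall>i\<in>{1..r}. lam i \<in> range to_frac))"

end

theory Submission
  imports Defs
begin

text \<open>
  Only the implication from (ii) to (iii) has content. The indeterminates \<open>\<lambda>\<^sub>1, \<dots>, \<lambda>\<^sub>r\<close> are specialized
  one after the other. Up to a factor in \<open>K(\<lambda>)\<close> each polynomial of a Hilbert subset is an irreducible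
  polynomial over \<open>K\<close> in all indeterminates. The substitution of Kronecker replaces the indeterminates
  other than \<open>\<lambda>\<^sub>i\<close> by powers of a single one, \<open>y\<close>, and reduces the specialization of \<open>\<lambda>\<^sub>i\<close> to finitely many
  irreducible \<open>g \<in> K[\<lambda>\<^sub>i][y]\<close>, on which \<open>\<lambda>\<^sub>i \<mapsto> a + b \<lambda>\<^sub>i\<close> acts; this yields the congruence.

  In characteristic \<open>p\<close> write \<open>g = G(\<lambda>, y\<^sup>q)\<close> with \<open>G\<close> separable and \<open>q\<close> a power of \<open>p\<close>. If \<open>q > 1\<close>, some
  quotient \<open>c(\<lambda>)\<close> of coefficients of \<open>G\<close> is not a \<open>p\<close>-th power. As \<open>K\<close> is imperfect, there is \<open>t \<in> R\<close>
  such that \<open>c(t X\<^sup>p)\<close> is not a \<open>p\<close>-th power either, and then \<open>c(t \<mu>\<^sup>p)\<close> is a \<open>p\<close>-th power for only finitely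
  many \<open>\<mu>\<close>. The polynomial \<open>G(t X\<^sup>p, y)\<close> is still irreducible and separable, so (ii) provides \<open>\<mu> \<in> R\<close> for
  which \<open>G(t \<mu>\<^sup>p, y)\<close> is irreducible and has coefficients that are not all \<open>p\<close>-th powers up to a
  constant. This makes \<open>g(t \<mu>\<^sup>p, y)\<close> irreducible.
\<close>

text \<open>The obstacle is inseparability. That \<open>c(\<lambda>)\<close> avoids p-th powers
  means that \<open>y^p - c\<close> stays irreducible, and this polynomial is inseparable, hence out
  of reach of (ii). Along \<open>\<lambda> = t \<mu>^p\<close> the condition excludes only finitely
  many \<open>\<mu>\<close>: the p-th powers form a subfield, and a polynomial \<open>c(t X)\<close>
  with values in it at infinitely many of its points \<open>\<mu>^p\<close> has all its coefficients
  in it. The price is that \<open>K(X)\<close> is inseparable over \<open>K(t X^p)\<close>, so the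
  irreducibility of \<open>G\<close> has to be saved. Moreover one \<open>t\<close> must serve all
  polynomials at once; this is achieved by shifts \<open>t + s^p\<close>. Kronecker's substitution
  has its own obstacle: because of carries in base \<open>D\<close>, an irreducible polynomial may
  become reducible. Each of the finitely many spurious splittings is ruled out by a polynomial that
  must not vanish at the chosen point. Survival of an indeterminate, definedness and nonzero
  coordinates are nonvanishing conditions too, and these cost only finitely many values per
  step.\<close>

hide_const (open) Divisibility.irreducible Divisibility.prime

text \<open>
  The library proves unique factorization in \<open>K[\<lambda>][y]\<close> only for fields of class \<^class>\<open>field_gcd\<close>.
\<close>

instantiation fract :: (idom)
  "{unique_euclidean_ring, normalization_euclidean_semiring, normalization_semidom_multiplicative}"
begin

definition [simp]: "normalize_fract = (normalize_field :: 'a fract \<Rightarrow> _)"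
definition [simp]: "unit_factor_fract = (unit_factor_field :: 'a fract \<Rightarrow> _)"
definition [simp]: "modulo_fract = (mod_field :: 'a fract \<Rightarrow> _)"
definition [simp]: "euclidean_size_fract = (euclidean_size_field :: 'a fract \<Rightarrow> _)"
definition [simp]: "division_segment (x :: 'a fract) = 1"

instance
  by standard
    (simp_all add: dvd_field_iff field_split_simps split: if_splits)

end

instantiation fract :: (idom) euclidean_ring_gcd
begin

definition gcd_fract :: "'a fract \<Rightarrow> 'a fract \<Rightarrow> 'a fract" where
  "gcd_fract = Euclidean_Algorithm.gcd"
definition lcm_fract :: "'a fract \<Rightarrow> 'a fract \<Rightarrow> 'a fract" where
  "lcm_fract = Euclidean_Algorithm.lcm"
definition Gcd_fract :: "'a fract set \<Rightarrow> 'a fract" where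
  "Gcd_fract = Euclidean_Algorithm.Gcd"
definition Lcm_fract :: "'a fract set \<Rightarrow> 'a fract" where
  "Lcm_fract = Euclidean_Algorithm.Lcm"

instance by standard (simp_all add: gcd_fract_def lcm_fract_def Gcd_fract_def Lcm_fract_def)

end

instance fract :: (idom) field_gcd ..

section \<open>Ring morphisms\<close>

definition rhom :: "('a::comm_ring_1 \<Rightarrow> 'b::comm_ring_1) \<Rightarrow> bool" where
  "rhom f \<longleftrightarrow> f 1 = 1 \<and> (\<forall>x y. f (x + y) = f x + f y) \<and> (\<forall>x y. f (x * y) = f x * f y)"

lemma rhomI:
  assumes "f 1 = 1" "\<And>x y. f (x + y) = f x + f y" "\<And>x y. f (x * y) = f x * f y"
  shows "rhom f"
  using assms by (simp add: rhom_def)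

lemma rhom_1: "rhom f \<Longrightarrow> f 1 = 1"
  and rhom_add: "rhom f \<Longrightarrow> f (x + y) = f x + f y"
  and rhom_mult: "rhom f \<Longrightarrow> f (x * y) = f x * f y"
  by (simp_all add: rhom_def)

lemma rhom_0: "rhom f \<Longrightarrow> f 0 = 0"
  using rhom_add[of f 0 0] by simp

lemma rhom_uminus: "rhom f \<Longrightarrow> f (- x) = - f x"
  using rhom_add[of f x "- x"] rhom_0[of f] by (simp add: eq_neg_iff_add_eq_0 add.commute)

lemma rhom_diff: "rhom f \<Longrightarrow> f (x - y) = f x - f y"
  using rhom_add[of f x "- y"] rhom_uminus[of f y] by simp

lemma rhom_power: "rhom f \<Longrightarrow> f (x ^ n) = f x ^ n"
  by (induction n) (simp_all add: rhom_1 rhom_mult)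

lemma rhom_sum: "rhom f \<Longrightarrow> f (sum g A) = (\<Sum>a\<in>A. f (g a))"
  by (induction A rule: infinite_finite_induct) (simp_all add: rhom_0 rhom_add)

lemma rhom_prod: "rhom f \<Longrightarrow> f (prod g A) = (\<Prod>a\<in>A. f (g a))"
  by (induction A rule: infinite_finite_induct) (simp_all add: rhom_1 rhom_mult)

lemma rhom_prod_list: "rhom f \<Longrightarrow> f (prod_list xs) = prod_list (map f xs)"
  by (induction xs) (simp_all add: rhom_1 rhom_mult)

lemma rhom_dvd: "rhom f \<Longrightarrow> x dvd y \<Longrightarrow> f x dvd f y"
  by (auto simp: rhom_mult elim!: dvdE)

lemma rhom_unit: "rhom f \<Longrightarrow> x dvd 1 \<Longrightarrow> f x dvd 1"
  using rhom_dvd[of f x 1] by (simp add: rhom_1)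

lemmas rhom_simps = rhom_0 rhom_1 rhom_add rhom_mult rhom_diff rhom_uminus rhom_power

lemma rhom_id: "rhom (\<lambda>x. x)"
  by (simp add: rhom_def)

lemma rhom_comp: "rhom f \<Longrightarrow> rhom g \<Longrightarrow> rhom (\<lambda>x. f (g x))"
  by (simp add: rhom_def)

lemma rhom_pCons: "rhom (\<lambda>c. [:c:])"
  by (simp add: rhom_def one_pCons)

lemma rhom_poly: "rhom (\<lambda>p. poly p x)"
  by (simp add: rhom_def)

lemma rhom_map_poly: "rhom f \<Longrightarrow> rhom (map_poly f)"
proof (rule rhomI)
  assume f: "rhom f"
  show "map_poly f 1 = 1" by (simp add: one_pCons map_poly_pCons rhom_simps[OF f])
  show "map_poly f (p + q) = map_poly f p + map_poly f q" for p q
    by (rule poly_eqI) (simp add: coeff_map_poly rhom_simps[OF f])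
  show "map_poly f (p * q) = map_poly f p * map_poly f q" for p q
    by (rule poly_eqI) (simp add: coeff_map_poly coeff_mult rhom_simps[OF f] rhom_sum[OF f])
qed

lemma map_poly_smult_rhom: "rhom f \<Longrightarrow> map_poly f (smult c p) = smult (f c) (map_poly f p)"
  by (rule poly_eqI) (simp add: coeff_map_poly rhom_simps)

lemma map_poly_monom_rhom: "rhom f \<Longrightarrow> map_poly f (Polynomial.monom c n) = Polynomial.monom (f c) n"
  by (rule poly_eqI) (simp add: coeff_map_poly rhom_simps)

lemma map_poly_const_rhom: "rhom f \<Longrightarrow> map_poly f [:c:] = [:f c:]"
  by (simp add: map_poly_pCons rhom_0)

lemma map_poly_inj:
  assumes "f 0 = 0" "\<And>x y. f x = f y \<Longrightarrow> x = y" "map_poly f p = map_poly f q"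
  shows "p = q"
proof (rule poly_eqI)
  fix n
  have "coeff (map_poly f p) n = coeff (map_poly f q) n" using assms(3) by simp
  then show "coeff p n = coeff q n" using assms(1,2) by (auto simp: coeff_map_poly)
qed

text \<open>Factorizations are pushed forward along \<open>s\<close>, and units are pulled back
  along its left inverse \<open>t\<close>. It serves affine changes of variable as well as injective
  renumberings of indeterminates.\<close>

lemma irreducible_retract:
  assumes s: "rhom s" and t: "rhom t" and ts: "\<And>x. t (s x) = x" and irr: "irreducible (s x)"
  shows "irreducible x"
proof (rule irreducibleI)
  show "x \<noteq> 0" using irr rhom_0[OF s] by auto
  show "\<not> x dvd 1" using irr rhom_unit[OF s] by (auto simp: irreducible_def)
  fix a b assume "x = a * b"
  then have "s x = s a * s b" by (simp add: rhom_mult[OF s])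
  then have "s a dvd 1 \<or> s b dvd 1" using irr by (rule irreducibleD[rotated])
  then show "a dvd 1 \<or> b dvd 1" using rhom_unit[OF t] ts by metis
qed

section \<open>Evaluation of multivariate polynomials\<close>

abbreviation Cst :: "'a::zero \<Rightarrow> 'a mpoly" where
  "Cst c \<equiv> Poly_Mapping.single 0 c"

abbreviation Var :: "nat \<Rightarrow> 'a::zero_neq_one mpoly" where
  "Var i \<equiv> Poly_Mapping.single (Poly_Mapping.single i (Suc 0)) 1"

text \<open>Substitution with \<open>f\<close> acting on the coefficients. Evaluation,
  specialization, Kronecker's substitution and the regrouping of indeterminates are all instances,
  so the morphism laws are proved once.\<close>

definition meval :: "('a::comm_ring_1 \<Rightarrow> 'b::comm_ring_1) \<Rightarrow> (nat \<Rightarrow> 'b) \<Rightarrow> 'a mpoly \<Rightarrow> 'b" where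
  "meval f v p = (\<Sum>m\<in>Poly_Mapping.keys p. f (Poly_Mapping.lookup p m) *
     (\<Prod>i\<in>Poly_Mapping.keys m. v i ^ Poly_Mapping.lookup m i))"

definition mvars :: "'a::zero mpoly \<Rightarrow> nat set" where
  "mvars p = (\<Union>m\<in>Poly_Mapping.keys p. Poly_Mapping.keys m)"

lemma poly_mapping_sum_singles:
  "(\<Sum>m\<in>Poly_Mapping.keys p. Poly_Mapping.single m (Poly_Mapping.lookup p m)) = p"
  by (rule poly_mapping_eqI)
     (auto simp: lookup_sum lookup_single when_def in_keys_iff)

lemma prod_single: "(\<Prod>i\<in>S. Poly_Mapping.single (g i) (1::'a::comm_ring_1))
     = Poly_Mapping.single (\<Sum>i\<in>S. g i) 1"
  by (induction S rule: infinite_finite_induct) (simp_all add: mult_single)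

lemma Var_power: "Var i ^ k = Poly_Mapping.single (Poly_Mapping.single i k) (1::'a::comm_ring_1)"
  by (induction k) (simp_all add: mult_single flip: single_add)

lemma single_expand:
  "Poly_Mapping.single m (c::'a::comm_ring_1) =
     Cst c * (\<Prod>i\<in>Poly_Mapping.keys m. Var i ^ Poly_Mapping.lookup m i)"
  by (simp add: Var_power prod_single mult_single poly_mapping_sum_singles)

lemma meval_superset:
  assumes "finite A" "Poly_Mapping.keys p \<subseteq> A" "f 0 = 0"
  shows "meval f v p = (\<Sum>m\<in>A. f (Poly_Mapping.lookup p m) *
     (\<Prod>i\<in>Poly_Mapping.keys m. v i ^ Poly_Mapping.lookup m i))"
  unfolding meval_def by (rule sum.mono_neutral_left) (use assms in \<open>auto simp: in_keys_iff\<close>)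

lemma prod_power_superset:
  assumes "finite A" "Poly_Mapping.keys m \<subseteq> A"
  shows "(\<Prod>i\<in>Poly_Mapping.keys m. (v i :: 'b::comm_ring_1) ^ Poly_Mapping.lookup m i) =
         (\<Prod>i\<in>A. v i ^ Poly_Mapping.lookup m i)"
  by (rule prod.mono_neutral_left) (use assms in \<open>auto simp: in_keys_iff\<close>)

lemma meval_single:
  assumes "f 0 = 0"
  shows "meval f v (Poly_Mapping.single m c) = f c * (\<Prod>i\<in>Poly_Mapping.keys m. v i ^ Poly_Mapping.lookup m i)"
  by (cases "c = 0") (simp_all add: meval_def assms)

lemma meval_Cst: "f 0 = 0 \<Longrightarrow> meval f v (Cst c) = f c"
  by (simp add: meval_single)

lemma meval_Var: "rhom f \<Longrightarrow> meval f v (Var i) = v i"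
  by (simp add: meval_single rhom_simps)

lemma meval_add:
  assumes f: "rhom f"
  shows "meval f v (p + q) = meval f v p + meval f v q"
proof -
  let ?A = "Poly_Mapping.keys p \<union> Poly_Mapping.keys q"
  have "Poly_Mapping.keys (p + q) \<subseteq> ?A" by (rule Poly_Mapping.keys_add)
  then show ?thesis
    by (simp add: meval_superset[of ?A] rhom_0[OF f] lookup_add rhom_add[OF f] distrib_right
        sum.distrib)
qed

lemma meval_sum: "rhom f \<Longrightarrow> meval f v (sum g A) = (\<Sum>a\<in>A. meval f v (g a))"
  by (induction A rule: infinite_finite_induct) (simp_all add: meval_add, simp_all add: meval_def)

lemma meval_mult_single:
  assumes f: "rhom f"
  shows "meval f v (Poly_Mapping.single m c * Poly_Mapping.single n d) =
    meval f v (Poly_Mapping.single m c) * meval f v (Poly_Mapping.single n d)"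
proof -
  let ?A = "Poly_Mapping.keys m \<union> Poly_Mapping.keys n"
  have "Poly_Mapping.keys (m + n) \<subseteq> ?A" by (rule Poly_Mapping.keys_add)
  then have "(\<Prod>i\<in>Poly_Mapping.keys (m + n). v i ^ Poly_Mapping.lookup (m + n) i) =
      (\<Prod>i\<in>?A. v i ^ Poly_Mapping.lookup (m + n) i)"
    by (intro prod_power_superset) auto
  also have "\<dots> = (\<Prod>i\<in>Poly_Mapping.keys m. v i ^ Poly_Mapping.lookup m i) *
      (\<Prod>i\<in>Poly_Mapping.keys n. v i ^ Poly_Mapping.lookup n i)"
    by (simp add: prod_power_superset[of ?A m] prod_power_superset[of ?A n] lookup_add power_add prod.distrib)
  finally show ?thesis
    by (simp add: mult_single meval_single rhom_simps[OF f])
qed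

lemma meval_mult:
  assumes f: "rhom f"
  shows "meval f v (p * q) = meval f v p * meval f v q"
proof -
  let ?s = "\<lambda>p m. Poly_Mapping.single m (Poly_Mapping.lookup p m)"
  have "meval f v (p * q) = meval f v ((\<Sum>m\<in>Poly_Mapping.keys p. ?s p m) * (\<Sum>n\<in>Poly_Mapping.keys q. ?s q n))"
    by (simp only: poly_mapping_sum_singles)
  also have "\<dots> = (\<Sum>m\<in>Poly_Mapping.keys p. meval f v (?s p m)) * (\<Sum>n\<in>Poly_Mapping.keys q. meval f v (?s q n))"
    by (simp only: sum_product meval_sum[OF f] meval_mult_single[OF f])
  also have "\<dots> = meval f v (\<Sum>m\<in>Poly_Mapping.keys p. ?s p m) * meval f v (\<Sum>n\<in>Poly_Mapping.keys q. ?s q n)"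
    by (simp only: meval_sum[OF f])
  finally show ?thesis by (simp only: poly_mapping_sum_singles)
qed

lemma rhom_meval: "rhom f \<Longrightarrow> rhom (meval f v)"
  by (rule rhomI) (use meval_Cst[of f v 1] in \<open>simp_all add: meval_add meval_mult rhom_simps\<close>)

lemma rhom_expand:
  assumes h: "rhom h"
  shows "h p = meval (\<lambda>c. h (Cst c)) (\<lambda>i. h (Var i)) p"
proof -
  have "h p = h (\<Sum>m\<in>Poly_Mapping.keys p. Poly_Mapping.single m (Poly_Mapping.lookup p m))"
    by (simp only: poly_mapping_sum_singles)
  also have "\<dots> = (\<Sum>m\<in>Poly_Mapping.keys p. h (Cst (Poly_Mapping.lookup p m) *
      (\<Prod>i\<in>Poly_Mapping.keys m. Var i ^ Poly_Mapping.lookup m i)))"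
    unfolding rhom_sum[OF h] by (intro sum.cong refl arg_cong[of _ _ h] single_expand)
  finally show ?thesis
    by (simp add: meval_def rhom_mult[OF h] rhom_prod[OF h] rhom_power[OF h] mult.assoc)
qed

lemma meval_cong:
  assumes "\<And>m. m \<in> Poly_Mapping.keys p \<Longrightarrow> f (Poly_Mapping.lookup p m) = g (Poly_Mapping.lookup p m)"
    and "\<And>i. i \<in> mvars p \<Longrightarrow> v i = w i"
  shows "meval f v p = meval g w p"
proof -
  have "v i = w i" if "m \<in> Poly_Mapping.keys p" "i \<in> Poly_Mapping.keys m" for m i
    using assms(2) that by (auto simp: mvars_def)
  then show ?thesis
    unfolding meval_def by (intro sum.cong arg_cong2[where f = "(*)"] prod.cong refl) (auto simp: assms(1))
qed

text \<open>A morphism is determined by constants and indeterminates. Only those occurring in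
  \<open>p\<close> are compared, so morphisms that differ elsewhere can be identified on polynomials
  with few indeterminates.\<close>

lemma rhom_mpoly_eqI:
  assumes "rhom f" "rhom g"
    and "\<And>m. m \<in> Poly_Mapping.keys p \<Longrightarrow> f (Cst (Poly_Mapping.lookup p m)) = g (Cst (Poly_Mapping.lookup p m))"
    and "\<And>i. i \<in> mvars p \<Longrightarrow> f (Var i) = g (Var i)"
  shows "f p = g p"
  unfolding rhom_expand[OF assms(1), of p] rhom_expand[OF assms(2), of p]
  by (rule meval_cong) (use assms in auto)

lemma rhom_Cst: "rhom (Cst :: 'a::comm_ring_1 \<Rightarrow> _)"
  by (rule rhomI) (simp_all add: single_add mult_single)

lemma mpoly_eval_conv: "mpoly_eval lam p = meval (\<lambda>c. c) lam p"
  by (simp add: mpoly_eval_def meval_def)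

lemma rhom_mpoly_eval: "rhom (mpoly_eval lam)"
  using rhom_meval[OF rhom_id, of lam] by (simp add: mpoly_eval_conv[abs_def])

lemma degree_unit: "(p :: 'a::idom poly) dvd 1 \<Longrightarrow> degree p = 0"
  using dvd_imp_degree_le[of p 1] by simp

section \<open>Irreducibility over the field of fractions\<close>

text \<open>
  \<open>irr_frac G\<close> expresses without fractions that \<open>G\<close> is irreducible as a polynomial in
  the outer indeterminate over the fraction field of its coefficient ring.
\<close>

definition irr_frac :: "'a::idom poly \<Rightarrow> bool" where
  "irr_frac G \<longleftrightarrow> degree G > 0 \<and>
     (\<forall>a U V. a \<noteq> 0 \<longrightarrow> smult a G = U * V \<longrightarrow> degree U = 0 \<or> degree V = 0)"

lemma irr_fracD:
  "irr_frac G \<Longrightarrow> a \<noteq> 0 \<Longrightarrow> smult a G = U * V \<Longrightarrow> degree U = 0 \<or> degree V = 0"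
  by (auto simp: irr_frac_def)

text \<open>A form of Gauss's lemma: the prime \<open>G\<close> divides one of the two factors,
  which therefore absorbs the whole degree in the outer indeterminate.\<close>

lemma irr_frac_prime:
  fixes G :: "'a::idom poly"
  assumes G: "prime_elem G" "degree G > 0"
  shows "irr_frac G"
  unfolding irr_frac_def
proof (intro conjI allI impI)
  fix a U V assume a: "a \<noteq> 0" and eq: "smult a G = U * V"
  have "G \<noteq> 0" using G by auto
  then have UV: "U \<noteq> 0" "V \<noteq> 0" using a eq by auto
  have deg: "degree G = degree U + degree V"
    using arg_cong[OF eq, of degree] a UV by (simp add: degree_mult_eq)
  have "G dvd U * V" unfolding eq[symmetric] by (rule dvd_smult) simp
  then have "G dvd U \<or> G dvd V" by (rule prime_elem_dvd_multD[OF G(1)])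
  then show "degree U = 0 \<or> degree V = 0"
    using UV deg dvd_imp_degree_le[of G U] dvd_imp_degree_le[of G V] by linarith
qed (fact G)

text \<open>
  A nonzero polynomial of least degree with root \<open>\<alpha>\<close> divides \<open>G\<close> up to constants, so it has the
  degree of \<open>G\<close>.
\<close>

lemma irr_frac_no_common_root:
  fixes G H :: "'a::idom poly" and f :: "'a \<Rightarrow> 'b::idom"
  assumes G: "irr_frac G" and f: "rhom f" "\<And>x. f x = 0 \<Longrightarrow> x = 0"
    and H: "H \<noteq> 0" "degree H < degree G"
    and root: "poly (map_poly f G) \<alpha> = 0"
  shows "poly (map_poly f H) \<alpha> \<noteq> 0"
proof
  assume H0: "poly (map_poly f H) \<alpha> = 0"
  note F = rhom_map_poly[OF f(1)]
  let ?R = "\<lambda>m. m \<noteq> 0 \<and> poly (map_poly f m) \<alpha> = 0"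
  define m where "m = arg_min degree ?R"
  have m: "?R m" unfolding m_def by (rule arg_min_natI[of ?R H]) (use H H0 in auto)
  have min: "degree m \<le> degree k" if "?R k" for k
    unfolding m_def by (rule arg_min_nat_le) (rule that)
  have degm: "degree m > 0"
  proof (rule ccontr)
    assume "\<not> degree m > 0"
    then obtain c where "m = [:c:]" by (auto elim: degree_eq_zeroE)
    with m show False using f(2)[of c] by (simp add: map_poly_const_rhom[OF f(1)])
  qed
  \<comment> \<open>Over a mere domain, division with remainder costs a power of the leading
    coefficient of \<open>m\<close>; \<open>irr_frac\<close> tolerates such a factor
    \<open>a\<close>.\<close>
  obtain q r where qr: "pseudo_divmod G m = (q, r)" by (cases "pseudo_divmod G m")
  define a where "a = coeff m (degree m) ^ (Suc (degree G) - degree m)"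
  have a: "a \<noteq> 0" using m by (simp add: a_def)
  have eq: "smult a G = m * q + r" and r: "r = 0 \<or> degree r < degree m"
    using pseudo_divmod[OF _ qr] m by (auto simp: a_def)
  have "map_poly f (smult a G) = map_poly f m * map_poly f q + map_poly f r"
    unfolding eq by (simp add: rhom_simps[OF F])
  then have "poly (map_poly f r) \<alpha> = 0"
    using root m by (simp add: map_poly_smult_rhom[OF f(1)] flip: minus_unique)
      (metis add_0 mult_zero_left mult_zero_right poly_add poly_mult poly_smult)
  then have "r = 0" using r min[of r] by linarith
  then have eq: "smult a G = m * q" using eq by simp
  moreover have "degree q \<noteq> 0"
  proof
    assume "degree q = 0"
    have "m * q \<noteq> 0" using eq a G by (auto simp: irr_frac_def simp flip: eq)
    then have "degree G = degree m"
      using arg_cong[OF eq, of degree] a \<open>degree q = 0\<close> by (simp add: degree_mult_eq)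
    then show False using min[of H] H H0 by simp
  qed
  ultimately show False using irr_fracD[OF G a, of m q] degm by auto
qed

section \<open>Polynomials in a power of the indeterminate\<close>

definition inflate :: "nat \<Rightarrow> 'a::comm_ring_1 poly \<Rightarrow> 'a poly" where
  "inflate n p = pcompose p (Polynomial.monom 1 n)"

lemma rhom_pcompose: "rhom (\<lambda>p. pcompose p q)"
  by (rule rhomI) (simp_all add: pcompose_1 pcompose_add pcompose_mult)

lemma rhom_inflate: "rhom (inflate n)"
  using rhom_pcompose by (simp add: inflate_def[abs_def])

lemma degree_inflate: "degree (inflate n (p :: 'a::idom poly)) = n * degree p"
  by (simp add: inflate_def degree_pcompose degree_monom_eq)

lemma inflate_0 [simp]: "inflate n 0 = 0"
  by (simp add: inflate_def)

lemma inflate_pCons: "inflate n (pCons a p) = [:a:] + Polynomial.monom 1 n * inflate n p"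
  by (simp add: inflate_def pcompose_pCons)

lemma inflate_const: "inflate n [:a:] = [:a:]"
  by (simp add: inflate_def)

lemma inflate_smult: "inflate n (smult a p) = smult a (inflate n p)"
  by (simp add: inflate_def pcompose_smult)

lemma coeff_inflate:
  assumes "n > 0"
  shows "coeff (inflate n p) (n * i) = coeff p i"
proof (induction p arbitrary: i)
  case (pCons a p)
  show ?case
  proof (cases i)
    case 0
    then show ?thesis using assms by (simp add: inflate_pCons coeff_monom_mult)
  next
    case (Suc j)
    then show ?thesis using assms pCons.IH[of j]
      by (simp add: inflate_pCons coeff_monom_mult coeff_pCons split: nat.split)
  qed
qed simp

lemma coeff_inflate_not_dvd:
  assumes "n > 0" "\<not> n dvd j"
  shows "coeff (inflate n r) j = 0"
  using assms(2)
proof (induction r arbitrary: j)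
  case (pCons a r)
  have "\<not> n dvd j - n" if "\<not> j < n" using pCons.prems that by (meson dvd_diffD dvd_refl not_le)
  moreover have "j > 0" using pCons.prems by (cases j) auto
  ultimately show ?case using pCons.IH[of "j - n"]
    by (auto simp: inflate_pCons coeff_monom_mult coeff_pCons split: nat.split)
qed simp

lemma inflate_inj: "n > 0 \<Longrightarrow> inflate n p = inflate n q \<Longrightarrow> p = q"
  by (rule poly_eqI) (metis coeff_inflate)

lemma inflate_1: "inflate (Suc 0) p = p"
  by (simp add: inflate_def monom_Suc monom_0)

lemma inflate_monom: "inflate m (Polynomial.monom 1 n) = Polynomial.monom 1 (m * n)"
  by (induction n) (simp_all add: monom_Suc inflate_pCons mult_monom, simp add: inflate_def pcompose_1 flip: one_pCons monom_0)

lemma inflate_inflate: "inflate m (inflate n p) = inflate (m * n) p"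
  using pcompose_assoc[of p "Polynomial.monom 1 n" "Polynomial.monom 1 m"] inflate_monom[of m n]
  by (metis inflate_def)

lemma map_poly_inflate:
  assumes f: "rhom f"
  shows "map_poly f (inflate n p) = inflate n (map_poly f p)"
  by (induction p)
     (simp_all add: inflate_pCons map_poly_pCons map_poly_monom_rhom[OF f] rhom_simps[OF f] rhom_simps[OF rhom_map_poly[OF f]])

lemma irreducible_inflateD:
  fixes p :: "'a::idom poly"
  assumes irr: "irreducible (inflate n p)" and n: "n > 0"
  shows "irreducible p"
proof (rule irreducibleI)
  show "p \<noteq> 0" using irr by auto
  show "\<not> p dvd 1" using irr rhom_unit[OF rhom_inflate, of p n] by (auto simp: irreducible_def)
  have unit: "a dvd 1" if "inflate n a dvd 1" for a :: "'a poly"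
  proof -
    have "n * degree a = 0" using that degree_inflate[of n a] by (simp add: degree_unit)
    then obtain d where "a = [:d:]" using n by (auto elim: degree_eq_zeroE)
    then show ?thesis using that by (simp add: inflate_const)
  qed
  fix a b assume "p = a * b"
  then have "inflate n p = inflate n a * inflate n b" by (simp add: rhom_mult[OF rhom_inflate])
  then show "a dvd 1 \<or> b dvd 1" using irreducibleD[OF irr] unit by blast
qed

text \<open>Differentiation multiplies the coefficient of \<open>y^j\<close> by \<open>j\<close>, so
  only exponents divisible by the characteristic can occur.\<close>

lemma pderiv_0_imp_inflate:
  fixes p :: "'a::idom poly"
  assumes "pderiv p = 0" "CHAR('a) > 0"
  obtains q where "p = inflate CHAR('a) q"
proof -
  let ?p = "CHAR('a)"
  define q where "q = (\<Sum>i\<le>degree p. Polynomial.monom (coeff p (?p * i)) i)"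
  have "coeff (inflate ?p q) j = coeff p j" for j
  proof (cases "?p dvd j")
    case True
    then obtain i where j: "j = ?p * i" by auto
    have "i \<le> j" using assms(2) j by simp
    then have "i > degree p \<Longrightarrow> coeff p j = 0" by (intro coeff_eq_0) simp
    then show ?thesis using j coeff_inflate[OF assms(2), of q i]
      by (auto simp: q_def coeff_sum not_le)
  next
    case False
    then obtain k where j: "j = Suc k" by (cases j) auto
    have "of_nat (Suc k) * coeff p (Suc k) = 0"
      using arg_cong[OF assms(1), of "\<lambda>q. coeff q k"] by (simp add: coeff_pderiv)
    moreover have "of_nat (Suc k) \<noteq> (0::'a)" using False j by (metis of_nat_eq_0_iff_char_dvd)
    ultimately have "coeff p j = 0" using j by simp
    moreover have "coeff (inflate ?p q) j = 0" by (rule coeff_inflate_not_dvd[OF assms(2) False])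
    ultimately show ?thesis by simp
  qed
  then have "p = inflate ?p q" by (intro poly_eqI) simp
  then show thesis by (rule that)
qed

text \<open>Each extraction of \<open>y^p\<close> divides the degree by \<open>p\<close>, so the
  process stops. For irreducible \<open>G\<close>, the final condition
  \<open>pderiv G \<noteq> 0\<close> amounts to separability.\<close>

lemma inflate_decomposition:
  fixes g :: "'a::idom poly"
  assumes p: "CHAR('a) > 0" and g: "degree g > 0"
  shows "\<exists>e G. g = inflate (CHAR('a) ^ e) G \<and> pderiv G \<noteq> 0"
  using g
proof (induction "degree g" arbitrary: g rule: less_induct)
  case less
  show ?case
  proof (cases "pderiv g = 0")
    case False
    then show ?thesis by (intro exI[of _ 0] exI[of _ g]) (simp add: inflate_1)
  next
    case True
    then obtain h where h: "g = inflate CHAR('a) h" using pderiv_0_imp_inflate p by blast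
    have "CHAR('a) > 1" using p CHAR_not_1'[where ?'a = 'a] by linarith
    then have "degree h < degree g" "degree h > 0" using less.prems h by (simp_all add: degree_inflate)
    from less.hyps[OF this] obtain e G where "h = inflate (CHAR('a) ^ e) G" "pderiv G \<noteq> 0" by blast
    with h show ?thesis by (intro exI[of _ "Suc e"] exI[of _ G]) (simp add: inflate_inflate)
  qed
qed

section \<open>The Frobenius map and p-th powers of polynomials\<close>

lemma rhom_frob: "prime CHAR('a::comm_ring_1) \<Longrightarrow> rhom (\<lambda>x::'a. x ^ CHAR('a))"
  by (rule rhomI) (simp_all add: freshmans_dream power_mult_distrib)

lemma poly_frob:
  fixes U :: "'a::comm_ring_1 poly"
  assumes p: "prime CHAR('a)"
  shows "U ^ CHAR('a) = inflate CHAR('a) (map_poly (\<lambda>c. c ^ CHAR('a)) U)"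
proof (induction U)
  case 0
  then show ?case using p prime_gt_0_nat by (simp add: power_0_left)
next
  case (pCons a U)
  have "pCons a U ^ CHAR('a) = ([:a:] + Polynomial.monom 1 1 * U) ^ CHAR('a)"
    by (simp add: monom_altdef)
  also have "\<dots> = [:a ^ CHAR('a):] + Polynomial.monom 1 CHAR('a) * U ^ CHAR('a)"
    using p by (simp add: freshmans_dream power_mult_distrib poly_const_pow monom_power)
  finally show ?case using pCons
    by (simp add: map_poly_pCons inflate_pCons rhom_0[OF rhom_frob[OF p]])
qed

lemma frob_inj:
  fixes x y :: "'a::idom"
  assumes p: "prime CHAR('a)" and "x ^ CHAR('a) = y ^ CHAR('a)"
  shows "x = y"
proof -
  have "(x - y) ^ CHAR('a) = 0" using assms(2) by (simp add: rhom_diff[OF rhom_frob[OF p]])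
  then show ?thesis by simp
qed

text \<open>The obstruction to the irreducibility of \<open>h(y^p)\<close>: by
  \<open>poly_frob\<close>, such an \<open>h\<close> makes \<open>h(y^p)\<close> a p-th power up to
  a constant.\<close>

definition frob_assoc :: "'k::field poly \<Rightarrow> bool" where
  "frob_assoc h \<longleftrightarrow> (\<exists>c w. c \<noteq> 0 \<and> smult c h = map_poly (\<lambda>x. x ^ CHAR('k)) w)"

text \<open>The quotient of two coefficients is a p-th power. Multiplying it by
  \<open>coeff h j ^ p\<close> removes the denominator, so that the same expression can be formed
  over \<open>K[\<lambda>]\<close> and specialized afterwards.\<close>

lemma frob_assoc_coeff:
  fixes h :: "'k::field poly"
  assumes p: "prime CHAR('k)" and h: "frob_assoc h"
  shows "\<exists>v. coeff h i * coeff h j ^ (CHAR('k) - 1) = v ^ CHAR('k)"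
proof (cases "coeff h j = 0")
  case True
  have "CHAR('k) \<ge> 2" using p by (rule prime_ge_2_nat)
  then show ?thesis using True by (intro exI[of _ 0]) (simp add: power_0_left)
next
  case False
  obtain q where q: "CHAR('k) = Suc q" using p by (metis not_prime_0 not0_implies_Suc)
  obtain c w where c: "c \<noteq> 0" and eq: "smult c h = map_poly (\<lambda>x. x ^ CHAR('k)) w"
    using h by (auto simp: frob_assoc_def)
  have w: "c * coeff h n = coeff w n ^ CHAR('k)" for n
    using arg_cong[OF eq, of "\<lambda>r. coeff r n"] rhom_0[OF rhom_frob[OF p]] by (simp add: coeff_map_poly)
  have "coeff w j \<noteq> 0" using w[of j] c False q by auto
  have "coeff h i * coeff h j ^ q = (c * coeff h i) / (c * coeff h j) * coeff h j ^ Suc q"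
    using c False by (simp add: field_simps)
  also have "\<dots> = (coeff w i / coeff w j * coeff h j) ^ CHAR('k)"
    unfolding w by (simp add: q power_divide power_mult_distrib)
  finally show ?thesis by (metis q diff_Suc_1)
qed

text \<open>The coefficients of \<open>h\<close> occur among those of \<open>h(y^n)\<close>. Hence
  the obstruction stays absent while irreducibility is lifted through one factor \<open>p\<close>
  after the other.\<close>

lemma frob_assoc_inflateD:
  fixes h :: "'k::field poly"
  assumes p: "prime CHAR('k)" and h: "frob_assoc (inflate n h)" and n: "n > 0"
  shows "frob_assoc h"
proof -
  note f0 = rhom_0[OF rhom_frob[OF p]]
  obtain c w where c: "c \<noteq> 0" and eq: "smult c (inflate n h) = map_poly (\<lambda>x. x ^ CHAR('k)) w"
    using h by (auto simp: frob_assoc_def)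
  define v where "v = (\<Sum>i\<le>degree w. Polynomial.monom (coeff w (n * i)) i)"
  have v: "coeff v i = coeff w (n * i)" for i
  proof -
    have "i \<le> n * i" using n by simp
    then have "i > degree w \<Longrightarrow> coeff w (n * i) = 0" by (intro coeff_eq_0) linarith
    then show ?thesis by (auto simp: v_def coeff_sum not_le)
  qed
  have "smult c h = map_poly (\<lambda>x. x ^ CHAR('k)) v"
  proof (rule poly_eqI)
    fix i
    have "coeff (smult c (inflate n h)) (n * i) = coeff w (n * i) ^ CHAR('k)"
      unfolding eq by (simp add: coeff_map_poly f0)
    then show "coeff (smult c h) i = coeff (map_poly (\<lambda>x. x ^ CHAR('k)) v) i"
      by (simp add: coeff_map_poly f0 v coeff_inflate[OF n])
  qed
  with c show ?thesis by (auto simp: frob_assoc_def)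
qed

text \<open>
  An irreducible factor \<open>w\<close> of \<open>h(y\<^sup>p)\<close> is the only one, as \<open>h\<close> divides the polynomial whose value at \<open>y\<^sup>p\<close>
  is \<open>w\<^sup>p\<close>. So \<open>h(y\<^sup>p)\<close> is \<open>w\<^sup>k\<close> up to a constant; \<open>1 < k < p\<close> would make \<open>h\<close> a \<open>k\<close>-th power, and \<open>k = p\<close> would
  make its coefficients \<open>p\<close>-th powers.
\<close>

lemma irreducible_inflate_prime:
  fixes h :: "'k::field_gcd poly"
  assumes p: "prime CHAR('k)" and irr: "irreducible h" and nh: "\<not> frob_assoc h"
  shows "irreducible (inflate CHAR('k) h)"
proof -
  let ?p = "CHAR('k)" and ?F = "inflate CHAR('k) h" and ?fr = "map_poly (\<lambda>x::'k. x ^ CHAR('k))"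
  note I = rhom_inflate[of ?p, where 'a = 'k]
  have p0: "?p > 0" using p by (rule prime_gt_0_nat)
  have degh: "degree h > 0" using irr by (metis degree_eq_zeroE dvd_field_iff gr0I irreducible_def is_unit_const_poly_iff pCons_0_0)
  then have degF: "degree ?F > 0" using p0 by (simp add: degree_inflate)
  then have "?F \<noteq> 0" "\<not> is_unit ?F" by (auto dest: degree_unit)
  then obtain w where w: "w dvd ?F" "prime w" using prime_divisor_exists by blast
  have degw: "degree w > 0" using w(2) by (metis degree_eq_zeroE dvd_field_iff gr0I is_unit_const_poly_iff not_prime_unit not_prime_0 pCons_0_0)
  have wp: "w ^ ?p = inflate ?p (?fr w)" by (rule poly_frob[OF p])
  have "h dvd ?fr w"
  proof (rule ccontr)
    assume "\<not> h dvd ?fr w"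
    then have "coprime h (?fr w)" using irr by (intro prime_elem_imp_coprime irreducible_imp_prime_elem)
    then obtain a b where "a * h + b * ?fr w = 1"
      using bezout_coefficients_fst_snd[of h "?fr w"] by auto
    from arg_cong[OF this, of "inflate ?p"]
    have eq: "inflate ?p a * ?F + inflate ?p b * w ^ ?p = 1" unfolding wp by (simp add: rhom_simps[OF I])
    have "w dvd inflate ?p a * ?F + inflate ?p b * w ^ ?p"
      using w(1) p0 by (intro dvd_add dvd_mult) (simp_all add: dvd_power)
    then show False using w(2) unfolding eq by (simp add: not_prime_unit)
  qed
  then have "?F dvd w ^ ?p" unfolding wp by (rule rhom_dvd[OF I])
  then obtain k where k: "k \<le> ?p" "normalize ?F = normalize (w ^ k)"
    using divides_primepow_weak[OF w(2)] by blast
  then obtain u where u: "is_unit u" "?F = u * w ^ k" by (metis associatedE1)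
  then obtain c where c: "u = [:c:]" "c \<noteq> 0" by (auto simp: is_unit_poly_iff dvd_field_iff)
  have Fc: "?F = smult c (w ^ k)" using u c by simp
  have "k \<noteq> 0" using degF Fc by (intro notI) simp
  moreover have "k \<noteq> ?p"
  proof
    assume "k = ?p"
    then have "inflate ?p h = inflate ?p (smult c (?fr w))" using Fc wp by (simp add: inflate_smult)
    then have "h = smult c (?fr w)" by (rule inflate_inj[OF p0])
    then have "smult (inverse c) h = ?fr w" using c by simp
    moreover have "inverse c \<noteq> 0" using c by simp
    ultimately show False using nh unfolding frob_assoc_def by blast
  qed
  moreover have "k \<le> 1"
  proof (rule ccontr)
    assume "\<not> k \<le> 1"
    then obtain l where l: "k = Suc l" "l > 0" by (cases k) auto
    have "\<not> ?p dvd k" using k(1) \<open>k \<noteq> 0\<close> \<open>k \<noteq> ?p\<close> by (auto dest: dvd_imp_le)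
    then have k0: "of_nat k \<noteq> (0 :: 'k)" by (metis of_nat_eq_0_iff_char_dvd)
    \<comment> \<open>\<open>?F\<close> is a polynomial in \<open>y^p\<close>, so its derivative
      vanishes; since \<open>k\<close> is nonzero in the field, \<open>w\<close> has derivative zero
      as well and is itself a polynomial in \<open>y^p\<close>.\<close>
    have "pderiv ?F = 0"
      using p by (simp add: inflate_def pderiv_pcompose pderiv_monom)
    then have "pderiv (w ^ Suc l) = 0"
      using c unfolding Fc l by (simp add: pderiv_smult del: power_Suc)
    then have "smult (of_nat k) (w ^ l) * pderiv w = 0"
      by (simp add: pderiv_power_Suc l del: of_nat_Suc power_Suc)
    then have "pderiv w = 0" using k0 w(2) by auto
    then obtain v where v: "w = inflate ?p v" using pderiv_0_imp_inflate p0 by blast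
    have "inflate ?p h = inflate ?p (smult c (v ^ k))" using Fc v by (simp add: inflate_smult rhom_simps[OF I])
    then have "h = smult c (v ^ k)" by (rule inflate_inj[OF p0])
    then have "h = v * smult c (v ^ l)" using l by simp
    then have "is_unit v \<or> is_unit (smult c (v ^ l))" using irr by (rule irreducibleD[rotated])
    then have "is_unit v" using l(2) c by (auto simp: is_unit_smult_iff is_unit_power_iff)
    then show False using degw v degree_unit[of v] by (simp add: degree_inflate)
  qed
  ultimately have "k = 1" by linarith
  then have "?F = [:c:] * w" using Fc by simp
  moreover have "is_unit [:c:]" using c by (simp add: is_unit_const_poly_iff dvd_field_iff)
  ultimately show ?thesis using w(2)
    by (metis irreducible_mult_unit_left prime_elem_imp_irreducible prime_imp_prime_elem)
qed

lemma irreducible_inflate: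
  fixes h :: "'k::field_gcd poly"
  assumes p: "prime CHAR('k)" and "irreducible h" and "\<not> frob_assoc h"
  shows "irreducible (inflate (CHAR('k) ^ e) h)"
  using assms(2,3)
proof (induction e arbitrary: h)
  case (Suc e)
  have "\<not> frob_assoc (inflate CHAR('k) h)"
    using frob_assoc_inflateD[OF p, of "CHAR('k)" h] Suc.prems prime_gt_0_nat[OF p] by blast
  then have "irreducible (inflate (CHAR('k) ^ e) (inflate CHAR('k) h))"
    using Suc irreducible_inflate_prime[OF p] by blast
  then show ?case by (simp add: inflate_inflate mult.commute)
qed (simp add: inflate_1)

text \<open>Otherwise a constant multiple of \<open>G(y^p)\<close> would be \<open>N ^ p\<close>
  with \<open>degree N \<le> degree G\<close>. The prime \<open>G(y^p)\<close> would then divide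
  \<open>N\<close>, although its degree is \<open>p * degree G\<close>.\<close>

lemma coeff_not_frob_if_inflate_irreducible:
  fixes G :: "'b::idom poly"
  assumes p: "prime CHAR('b)" and pr: "prime_elem (inflate CHAR('b) G)" and deg: "degree G > 0"
  shows "\<exists>i. \<nexists>v. coeff G i * lead_coeff G ^ (CHAR('b) - 1) = v ^ CHAR('b)"
proof (rule ccontr)
  let ?p = "CHAR('b)"
  assume "\<not> ?thesis"
  then obtain v where v: "\<And>i. coeff G i * lead_coeff G ^ (?p - 1) = v i ^ ?p" by metis
  define N where "N = (\<Sum>i\<le>degree G. Polynomial.monom (v i) i)"
  have cN: "coeff N i = (if i \<le> degree G then v i else 0)" for i by (simp add: N_def coeff_sum)
  have G0: "lead_coeff G \<noteq> 0" using deg by auto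
  have "coeff (map_poly (\<lambda>c. c ^ ?p) N) i = coeff (smult (lead_coeff G ^ (?p - 1)) G) i" for i
    using rhom_0[OF rhom_frob[OF p]] v[of i]
    by (cases "i \<le> degree G") (simp_all add: coeff_map_poly cN mult.commute coeff_eq_0)
  then have "map_poly (\<lambda>c. c ^ ?p) N = smult (lead_coeff G ^ (?p - 1)) G" by (rule poly_eqI)
  then have eq: "N ^ ?p = smult (lead_coeff G ^ (?p - 1)) (inflate ?p G)"
    by (simp add: poly_frob[OF p] inflate_smult)
  then have "inflate ?p G dvd N ^ ?p" by (simp add: dvd_smult)
  then have dvd: "inflate ?p G dvd N" using pr prime_elem_dvd_power by blast
  have "N \<noteq> 0"
  proof
    assume "N = 0"
    then have "smult (lead_coeff G ^ (?p - 1)) (inflate ?p G) = 0" using eq p prime_gt_0_nat by (auto simp: power_0_left)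
    then show False using G0 pr by auto
  qed
  then have "?p * degree G \<le> degree N" using dvd_imp_degree_le[OF dvd] by (simp add: degree_inflate)
  moreover have "degree N \<le> degree G" by (rule degree_le) (simp add: cN)
  ultimately have "?p * degree G \<le> 1 * degree G" by (metis le_trans nat_mult_1)
  then have "?p \<le> 1" using deg mult_le_cancel2 by blast
  then show False using prime_gt_1_nat[OF p] by simp
qed

section \<open>Descent from irreducible to separable polynomials\<close>

lemma map_poly_eq_0_rhom:
  assumes f: "rhom f" "\<And>x. f x = 0 \<Longrightarrow> x = 0" and p: "map_poly f p = 0"
  shows "p = 0"
proof (rule poly_eqI)
  fix n
  have "f (coeff p n) = coeff (map_poly f p) n" by (simp add: coeff_map_poly rhom_0[OF f(1)])
  then show "coeff p n = coeff 0 n" using f(2) p by simp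
qed

lemma degree_pderiv_less:
  fixes q :: "'a::idom poly"
  assumes "degree q > 0"
  shows "degree (pderiv q) < degree q"
proof -
  have "degree (pderiv q) \<le> degree q - 1"
    by (rule degree_le) (auto simp: coeff_pderiv intro!: coeff_eq_0)
  then show ?thesis using assms by linarith
qed

lemma rhom_of_nat: "rhom f \<Longrightarrow> f (of_nat n) = of_nat n"
  by (induction n) (simp_all add: rhom_simps)

lemma map_poly_comp_rhom:
  assumes "rhom f" "rhom g"
  shows "map_poly f (map_poly g p) = map_poly (\<lambda>x. f (g x)) p"
  by (rule poly_eqI) (simp add: coeff_map_poly rhom_0[OF assms(1)] rhom_0[OF assms(2)])

lemma degree_map_poly_rhom:
  assumes f: "rhom f" "\<And>x. f x = 0 \<Longrightarrow> x = 0"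
  shows "degree (map_poly f p) = degree p"
  by (cases "p = 0") (use f in \<open>auto intro!: degree_map_poly\<close>)

text \<open>
  Over the field \<open>K(X)\<close>, which is purely inseparable over \<open>K(\<lambda>)\<close> with \<open>\<lambda> = t X\<^sup>p\<close>, a separable
  irreducible polynomial remains irreducible: the \<open>p\<close>-th powers of its factors are defined over
  \<open>K(\<lambda>)\<close>.
\<close>

lemma irr_frac_subst:
  fixes G :: "'k::field_gcd poly poly"
  assumes p: "prime CHAR('k)" and G: "irreducible G" "degree G > 0" "pderiv G \<noteq> 0" and t: "t \<noteq> 0"
  shows "irr_frac (map_poly (\<lambda>c. pcompose c (Polynomial.monom t CHAR('k))) G)"
    (is "irr_frac (map_poly ?tau G)")
proof -
  let ?p = "CHAR('k)"
  note tau = rhom_pcompose[of "Polynomial.monom t ?p"]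
  note Tau = rhom_map_poly[OF tau]
  have p0: "?p > 0" using p by (rule prime_gt_0_nat)
  have tau0: "c = 0" if "?tau c = 0" for c
    by (rule pcompose_eq_0[OF that]) (simp add: degree_monom_eq p0 t)
  have tau_inj: "x = y" if "?tau x = ?tau y" for x y
    using tau0[of "x - y"] that by (simp add: pcompose_diff)
  have Tau_inj: "x = y" if "map_poly ?tau x = map_poly ?tau y" for x y
    by (rule map_poly_inj[of ?tau, OF rhom_0[OF tau]]) (use tau_inj that in blast)+
  have prime_G: "prime_elem G" using G(1) by (rule irreducible_imp_prime_elem)
  then have G0: "G \<noteq> 0" by auto
  have irrG: "irr_frac G" using prime_G G(2) by (rule irr_frac_prime)
  \<comment> \<open>The p-th power of \<open>u(X)\<close> is a polynomial in \<open>X^p\<close>.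
    Writing \<open>X^p = \<lambda> / t\<close> turns it into the element \<open>rho u\<close> of
    \<open>K[\<lambda>]\<close> with image \<open>u ^ p\<close>; \<open>low\<close> does the same
    for polynomials in \<open>y\<close>.\<close>
  define rho where "rho = (\<lambda>u. pcompose (map_poly (\<lambda>x::'k. x ^ ?p) u) [:0, inverse t:])"
  have rho: "?tau (rho u) = u ^ ?p" for u
  proof -
    have "pcompose [:0, inverse t:] (Polynomial.monom t ?p) = Polynomial.monom 1 ?p"
      using t by (simp add: pcompose_pCons mult_monom smult_monom)
    then show ?thesis
      using poly_frob[OF p, of u]
        pcompose_assoc[of "map_poly (\<lambda>x. x ^ ?p) u" "[:0, inverse t:]" "Polynomial.monom t ?p"]
      by (simp add: rho_def inflate_def)
  qed
  have rho_0: "rho 0 = 0" by (simp add: rho_def)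
  have rho_eq_0: "u = 0" if "rho u = 0" for u using rho[of u] that by simp
  define low where "low U = inflate ?p (map_poly rho U)" for U
  have low: "map_poly ?tau (low U) = U ^ ?p" for U
  proof -
    have "map_poly ?tau (map_poly rho U) = map_poly (\<lambda>c. c ^ ?p) U"
      using p0 by (intro poly_eqI) (simp add: coeff_map_poly rho rho_0)
    then show ?thesis using poly_frob[of U] p by (simp add: low_def map_poly_inflate[OF tau])
  qed
  have deg_low: "degree (low U) = ?p * degree U" for U
    using rho_eq_0 rho_0 by (cases "U = 0") (auto simp: low_def degree_inflate intro!: degree_map_poly)
  have degT: "degree (map_poly ?tau G) = degree G"
    by (rule degree_map_poly_rhom[OF tau tau0])
  show ?thesis
    unfolding irr_frac_def
  proof (intro conjI allI impI)
    show "degree (map_poly ?tau G) > 0" using degT G by simp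
    fix a U V assume a: "a \<noteq> 0" and eq: "smult a (map_poly ?tau G) = U * V"
    have "map_poly ?tau (smult (rho a) (G ^ ?p)) = map_poly ?tau (low U * low V)"
      unfolding map_poly_smult_rhom[OF tau] rho rhom_mult[OF Tau] rhom_power[OF Tau] low
      by (simp only: power_mult_distrib[symmetric] eq[symmetric] smult_power)
    then have low_eq: "smult (rho a) (G ^ ?p) = low U * low V" by (rule Tau_inj)
    have ra: "rho a \<noteq> 0" using rho_eq_0 a by auto
    have "smult (rho a) (G ^ ?p) \<noteq> 0" using ra G0 by simp
    then have nz: "low U \<noteq> 0" "low V \<noteq> 0" unfolding low_eq by auto
    have "map_poly ?tau G \<noteq> 0" using degT G(2) by auto
    then have "U * V \<noteq> 0" unfolding eq[symmetric] using a by simp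
    then have "U \<noteq> 0" "V \<noteq> 0" by auto
    then have degs: "degree G = degree U + degree V"
      using arg_cong[OF eq, of degree] a degT by (simp add: degree_mult_eq)
    have dvd: "G ^ ?p dvd low U * low V" unfolding low_eq[symmetric] by (rule dvd_smult) simp
    \<comment> \<open>If \<open>G\<close> misses one factor, all of \<open>G ^ p\<close> divides the
      other one, and comparing degrees leaves nothing for the first.\<close>
    have case1: "degree Y = 0" if "\<not> G dvd low Y" "G ^ ?p dvd low Y * low W" "low W \<noteq> 0" "degree G = degree W + degree Y" for W Y
    proof -
      have "G ^ ?p dvd low W" using prime_power_dvd_multD[OF prime_G that(2) p0 that(1)] .
      then have "degree (G ^ ?p) \<le> degree (low W)" using that(3) by (rule dvd_imp_degree_le)
      then have "?p * degree G \<le> ?p * degree W" using G0 by (simp add: degree_power_eq deg_low)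
      then have "degree G \<le> degree W" using p0 by simp
      then show ?thesis using that(4) by simp
    qed
    \<comment> \<open>Otherwise a root \<open>\<alpha>\<close> of the image of \<open>G\<close> is a
      root of both \<open>U\<close> and \<open>V\<close>, hence also of the derivative. This
      contradicts \<open>irr_frac G\<close>, which is applied over \<open>K[\<lambda>]\<close> with
      coefficients mapped through \<open>?tau\<close>.\<close>
    have "\<not> (G dvd low U \<and> G dvd low V)"
    proof (intro notI, elim conjE)
      assume dU: "G dvd low U" and dV: "G dvd low V"
      define f where "f = (\<lambda>c :: 'k poly. to_ac (to_fract c))"
      have f: "rhom f" by (rule rhomI) (simp_all add: f_def)
      have f0: "f x = 0 \<Longrightarrow> x = 0" for x by (simp add: f_def)
      note F = rhom_map_poly[OF f]
      have "degree (map_poly f (map_poly ?tau G)) > 0"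
        using degT G by (simp add: degree_map_poly_rhom[OF f f0])
      then obtain \<alpha> where \<alpha>: "poly (map_poly f (map_poly ?tau G)) \<alpha> = 0"
        using alg_closed_imp_poly_has_root by blast
      have root: "poly (map_poly f W) \<alpha> = 0" if "G dvd low W" for W
      proof -
        have "map_poly ?tau G dvd W ^ ?p" using rhom_dvd[OF Tau that] by (simp add: low)
        then have "map_poly f (map_poly ?tau G) dvd map_poly f W ^ ?p"
          using rhom_dvd[OF F] by (metis rhom_power[OF F])
        then obtain Q where "map_poly f W ^ ?p = map_poly f (map_poly ?tau G) * Q" by (rule dvdE)
        then have "poly (map_poly f W ^ ?p) \<alpha> = 0" using \<alpha> by simp
        then show ?thesis by (simp add: poly_power)
      qed
      have pd: "map_poly f (map_poly ?tau (pderiv Q)) = pderiv (map_poly f (map_poly ?tau Q))" for Q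
        by (rule poly_eqI) (simp add: coeff_map_poly coeff_pderiv rhom_simps[OF f] rhom_simps[OF tau]
            rhom_of_nat[OF f] rhom_of_nat[OF tau] flip: of_nat_Suc)
      have "smult (f a) (map_poly f (map_poly ?tau G)) = map_poly f U * map_poly f V"
        using arg_cong[OF eq, of "map_poly f"] by (simp add: map_poly_smult_rhom[OF f] rhom_mult[OF F])
      then have "pderiv (smult (f a) (map_poly f (map_poly ?tau G))) = pderiv (map_poly f U * map_poly f V)"
        by simp
      then have "poly (smult (f a) (pderiv (map_poly f (map_poly ?tau G)))) \<alpha> = 0"
        using root[OF dU] root[OF dV] by (simp add: pderiv_smult pderiv_mult)
      then have "poly (map_poly f (map_poly ?tau (pderiv G))) \<alpha> = 0"
        using f0[of a] a by (auto simp: pd)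
      moreover have "poly (map_poly (\<lambda>c. f (?tau c)) (pderiv G)) \<alpha> \<noteq> 0"
      proof (rule irr_frac_no_common_root[OF irrG rhom_comp[OF f tau]])
        show "x = 0" if "f (?tau x) = 0" for x using that f0 tau0 by blast
        show "degree (pderiv G) < degree G" using G(2) by (rule degree_pderiv_less)
      qed (use G(3) \<alpha> in \<open>simp_all add: map_poly_comp_rhom[OF f tau]\<close>)
      ultimately show False by (simp add: map_poly_comp_rhom[OF f tau])
    qed
    then show "degree U = 0 \<or> degree V = 0"
      using case1[of U V] case1[of V U] dvd nz degs by (auto simp: mult.commute add.commute)
  qed
qed

text \<open>Newton interpolation at points of the subfield.\<close>

lemma coeff_in_subfield:
  fixes E :: "'k::field poly"
  assumes F: "\<And>x y. x \<in> F \<Longrightarrow> y \<in> F \<Longrightarrow> x + y \<in> F" "\<And>x y. x \<in> F \<Longrightarrow> y \<in> F \<Longrightarrow> x - y \<in> F"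
    "\<And>x y. x \<in> F \<Longrightarrow> y \<in> F \<Longrightarrow> x * y \<in> F" "\<And>x y. x \<in> F \<Longrightarrow> y \<in> F \<Longrightarrow> x / y \<in> F"
    and S: "infinite S" "S \<subseteq> F" "\<And>z. z \<in> S \<Longrightarrow> poly E z \<in> F"
  shows "coeff E i \<in> F"
  using S
proof (induction "degree E" arbitrary: E S i)
  case 0
  obtain z where z: "z \<in> S" using 0 by (metis finite.emptyI ex_in_conv)
  obtain e where "E = [:e:]" using 0 by (metis degree_eq_zeroE)
  then show ?case using "0.prems"(3)[OF z] F(2)[of e e] by (auto simp: coeff_pCons split: nat.split)
next
  case (Suc d)
  obtain z where z: "z \<in> S" using Suc by (metis finite.emptyI ex_in_conv)
  \<comment> \<open>One point is removed: \<open>Q\<close> has lower degree and, being a difference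
    quotient, takes values in \<open>F\<close> at the other points.\<close>
  define Q where "Q = synthetic_div E z"
  have EQ: "E = [:- z, 1:] * Q + [:poly E z:]" using synthetic_div_correct'[of z E] by (simp add: Q_def)
  have zF: "z \<in> F" "poly E z \<in> F" using z Suc by auto
  then have F0: "0 \<in> F" using F(2)[of z z] by simp
  have Q: "coeff Q n \<in> F" for n
  proof (rule Suc.hyps(1)[of _ "S - {z}"])
    show "d = degree Q" using Suc(2) by (simp add: Q_def degree_synthetic_div flip: Suc(2))
    fix w assume w: "w \<in> S - {z}"
    have "poly E w = (w - z) * poly Q w + poly E z" by (subst EQ) (simp add: algebra_simps)
    then have "poly Q w = (poly E w - poly E z) / (w - z)" using w by (simp add: field_simps)
    then show "poly Q w \<in> F" using w Suc.prems(2,3) zF F by (metis DiffE subsetD)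
  qed (use Suc.prems in auto)
  have "coeff E n = (0 - z) * coeff Q n + (case n of 0 \<Rightarrow> poly E z | Suc m \<Rightarrow> coeff Q m)" for n
    by (subst EQ) (simp add: coeff_pCons split: nat.split)
  moreover have "(case i of 0 \<Rightarrow> poly E z | Suc m \<Rightarrow> coeff Q m) \<in> F" using zF Q by (simp split: nat.split)
  ultimately show ?case using F(1-3) F0 zF Q by metis
qed

text \<open>The p-th powers form a subfield. Infinitely many \<open>\<mu>\<close> would give
  infinitely many points \<open>\<mu>^p\<close> of it at which \<open>c(t X)\<close> has values in
  it, and interpolation would place every coefficient of \<open>c(t X)\<close> in it.\<close>

lemma finite_frob_values:
  fixes c :: "'k::field poly"
  assumes p: "prime CHAR('k)" and c: "coeff c i * t ^ i \<notin> range (\<lambda>x::'k. x ^ CHAR('k))"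
  shows "finite {\<mu>. poly c (t * \<mu> ^ CHAR('k)) \<in> range (\<lambda>x::'k. x ^ CHAR('k))}" (is "finite ?B")
proof (rule ccontr)
  let ?p = "CHAR('k)" and ?F = "range (\<lambda>x::'k. x ^ CHAR('k))"
  note f = rhom_frob[OF p]
  assume inf: "infinite ?B"
  have "coeff (pcompose c [:0, t:]) i \<in> ?F"
  proof (rule coeff_in_subfield[where S = "(\<lambda>x. x ^ ?p) ` ?B"])
    have "inj_on (\<lambda>x::'k. x ^ ?p) ?B" using frob_inj[OF p] by (auto intro: inj_onI)
    then show "infinite ((\<lambda>x. x ^ ?p) ` ?B)" using inf by (simp add: finite_image_iff)
    fix z assume "z \<in> (\<lambda>x. x ^ ?p) ` ?B"
    then show "poly (pcompose c [:0, t:]) z \<in> ?F" by (auto simp: poly_pcompose mult.commute)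
  qed (auto simp: image_iff simp flip: rhom_add[OF f] rhom_diff[OF f] power_mult_distrib power_divide)
  moreover have "coeff (pcompose c [:0, t:]) i = coeff c i * t ^ i"
    by (simp add: coeff_pcompose_linear)
  ultimately show False using c by simp
qed

text \<open>With \<open>i * a = p * b + 1\<close> from Bezout, \<open>x\<close> is the quotient of
  the p-th power \<open>x ^ (i * a)\<close> by \<open>(x ^ b) ^ p\<close>.\<close>

lemma frob_root_coprime:
  fixes x :: "'k::field"
  assumes p: "prime p" and i: "\<not> p dvd i" and x: "x ^ i = r ^ p"
  shows "x \<in> range (\<lambda>y. y ^ p)"
proof (cases "x = 0")
  case True
  then show ?thesis using prime_gt_0_nat[OF p] by (auto intro!: image_eqI[of _ _ 0])
next
  case False
  have "coprime i p" using p i by (metis coprime_commute prime_imp_coprime)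
  then obtain a b where ab: "i * a = p * b + 1" 
    using bezout_nat[of i p] i by (metis coprime_imp_gcd_eq_1 dvd_0_right)
  have "x * (x ^ b) ^ p = x ^ (i * a)" unfolding ab by (simp add: power_add power_mult mult.commute flip: power_mult)
  also have "\<dots> = (r ^ a) ^ p" by (simp add: power_mult x) (simp add: mult.commute flip: power_mult)
  finally have "x = (r ^ a / x ^ b) ^ p" using False by (simp add: power_divide field_simps)
  then show ?thesis by blast
qed

text \<open>
  For \<open>c\<close> not a \<open>p\<close>-th power, \<open>c(u X\<^sup>p)\<close> is a \<open>p\<close>-th power for \<open>u\<close> in at most one class modulo \<open>p\<close>-th powers,
  and the elements \<open>t + s\<^sup>p\<close> lie in pairwise different classes.
\<close>

lemma unique_bad_shift:
  fixes c :: "'k::field poly"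
  assumes p: "prime CHAR('k)" and c: "\<nexists>v. c = v ^ CHAR('k)"
    and t: "t \<notin> range (\<lambda>x::'k. x ^ CHAR('k))"
    and s: "\<And>i. coeff c i * (t + s ^ CHAR('k)) ^ i \<in> range (\<lambda>x::'k. x ^ CHAR('k))"
    and s': "\<And>i. coeff c i * (t + s' ^ CHAR('k)) ^ i \<in> range (\<lambda>x::'k. x ^ CHAR('k))"
  shows "s = s'"
proof (rule ccontr)
  let ?p = "CHAR('k)" and ?F = "range (\<lambda>x::'k. x ^ CHAR('k))"
  note f = rhom_frob[OF p]
  assume ne: "s \<noteq> s'"
  have p0: "?p > 0" using p by (rule prime_gt_0_nat)
  have tnz: "t + x ^ ?p \<noteq> 0" for x
  proof
    assume "t + x ^ ?p = 0"
    then have "t = (- x) ^ ?p" by (simp add: rhom_uminus[OF f] eq_neg_iff_add_eq_0)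
    with t show False by blast
  qed
  have Fdiv: "x / y \<in> ?F" if "x \<in> ?F" "y \<in> ?F" for x y using that by (auto simp flip: power_divide)
  show False
  proof (cases "\<exists>i. \<not> ?p dvd i \<and> coeff c i \<noteq> 0")
    case True
    then obtain i where i: "\<not> ?p dvd i" "coeff c i \<noteq> 0" by blast
    \<comment> \<open>Dividing the two hypotheses puts both shifts into one class modulo p-th
      powers. The relation with \<open>w\<close> can be solved for \<open>t\<close>, which becomes a
      p-th power unless \<open>w = 1\<close>; and \<open>w = 1\<close> forces
      \<open>s = s'\<close>.\<close>
    have "((t + s ^ ?p) / (t + s' ^ ?p)) ^ i \<in> ?F"
      using Fdiv[OF s s', of i i] i by (simp add: power_divide)
    then obtain w where w: "(t + s ^ ?p) / (t + s' ^ ?p) = w ^ ?p"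
      using frob_root_coprime[OF p i(1)] by blast
    then have eq: "t + s ^ ?p = w ^ ?p * (t + s' ^ ?p)" using tnz[of s'] by (simp add: field_simps)
    have "w \<noteq> 1" using eq ne frob_inj[OF p, of s s'] by auto
    then have w1: "1 - w \<noteq> 0" by simp
    have "t * (1 - w) ^ ?p = (w * s' - s) ^ ?p"
      using eq by (simp add: rhom_diff[OF f] power_mult_distrib algebra_simps)
    then have "t = ((w * s' - s) / (1 - w)) ^ ?p" using w1 by (simp add: power_divide field_simps)
    with t show False by blast
  next
    case False
    \<comment> \<open>Here \<open>c\<close> is a polynomial in \<open>X^p\<close>, and
      \<open>(t + s^p)^(p j)\<close> is itself a p-th power, so the hypothesis on \<open>s\<close>
      makes all coefficients p-th powers and \<open>c\<close> the p-th power of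
      \<open>V\<close>.\<close>
    have "\<exists>v. coeff c (?p * j) = v ^ ?p" for j
    proof -
      have "(t + s ^ ?p) ^ (?p * j) \<in> ?F" by (auto simp: mult.commute[of ?p] power_mult)
      from Fdiv[OF s[of "?p * j"] this] show ?thesis using tnz[of s] by auto
    qed
    then obtain v where v: "\<And>j. coeff c (?p * j) = v j ^ ?p" by metis
    define V where "V = (\<Sum>j\<le>degree c. Polynomial.monom (v j) j)"
    have cV: "coeff V j = v j" for j
    proof (cases "j \<le> degree c")
      case False
      moreover have "j \<le> ?p * j" using p0 by simp
      ultimately have "degree c < ?p * j" by linarith
      then have "v j = 0" using v[of j] by (simp add: coeff_eq_0)
      then show ?thesis using False by (simp add: V_def coeff_sum)
    qed (simp add: V_def coeff_sum)
    have "coeff c n = coeff (V ^ ?p) n" for n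
    proof (cases "?p dvd n")
      case True
      then obtain j where "n = ?p * j" by auto
      then show ?thesis using p0 v by (simp add: poly_frob[OF p] coeff_inflate coeff_map_poly cV)
    next
      case n: False
      have "coeff (inflate ?p r) n = 0" for r :: "'k poly" by (rule coeff_inflate_not_dvd[OF p0 n])
      moreover have "coeff c n = 0" using False n by blast
      ultimately show ?thesis by (simp add: poly_frob[OF p])
    qed
    then have "c = V ^ ?p" by (rule poly_eqI)
    with c show False by blast
  qed
qed

text \<open>
  \<open>sep_hilb A\<close> is condition (ii) in terms of univariate polynomials over \<open>K[\<lambda>]\<close>.
\<close>

definition sep_hilb :: "'k::field set \<Rightarrow> bool" where
  "sep_hilb A \<longleftrightarrow> (\<forall>Gs gp. finite Gs \<longrightarrow> (\<forall>G\<in>Gs. irr_frac G \<and> pderiv G \<noteq> 0) \<longrightarrow> gp \<noteq> 0 \<longrightarrow>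
     (\<exists>l\<in>A. poly gp l \<noteq> 0 \<and> (\<forall>G\<in>Gs. irreducible (map_poly (\<lambda>c. poly c l) G))))"

lemma sep_hilbD:
  assumes "sep_hilb A" "finite Gs" "\<And>G. G \<in> Gs \<Longrightarrow> irr_frac G \<and> pderiv G \<noteq> 0" "gp \<noteq> 0"
  obtains l where "l \<in> A" "poly gp l \<noteq> 0" "\<And>G. G \<in> Gs \<Longrightarrow> irreducible (map_poly (\<lambda>c. poly c l) G)"
proof -
  have "\<exists>l\<in>A. poly gp l \<noteq> 0 \<and> (\<forall>G\<in>Gs. irreducible (map_poly (\<lambda>c. poly c l) G))"
    using assms(1)[unfolded sep_hilb_def, rule_format, of Gs gp] assms(2-4) by simp
  then show ?thesis using that by blast
qed

section \<open>From separable to arbitrary irreducible polynomials\<close>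

definition fraction_subring :: "'k::field set \<Rightarrow> bool" where
  "fraction_subring A \<longleftrightarrow> 1 \<in> A \<and> (\<forall>x\<in>A. \<forall>y\<in>A. x + y \<in> A \<and> x * y \<in> A) \<and>
     (\<forall>k. \<exists>a\<in>A. \<exists>b\<in>A. b \<noteq> 0 \<and> k = a / b)"

lemma fraction_subring_power:
  assumes "fraction_subring A" "x \<in> A"
  shows "x ^ n \<in> A"
  using assms by (induction n) (auto simp: fraction_subring_def)

text \<open>A finite \<open>A\<close> would make the field finite and hence perfect, the Frobenius
  map being injective. Infinitude leaves room for choosing the shift \<open>s\<close>.\<close>

lemma infinite_fraction_subring:
  fixes A :: "'k::field set"
  assumes p: "prime CHAR('k)" and A: "fraction_subring A"
    and imp: "range (\<lambda>x::'k. x ^ CHAR('k)) \<noteq> UNIV"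
  shows "infinite A"
proof
  assume "finite A"
  then have "finite ((\<lambda>(a, b). a / b) ` (A \<times> A))" by simp
  moreover have "k \<in> (\<lambda>(a, b). a / b) ` (A \<times> A)" for k
  proof -
    obtain a b where "a \<in> A" "b \<in> A" "k = a / b" using A unfolding fraction_subring_def by metis
    then show ?thesis by (intro image_eqI[of _ _ "(a, b)"]) auto
  qed
  ultimately have "finite (UNIV :: 'k set)" by (meson finite_subset subsetI)
  moreover have "inj (\<lambda>x::'k. x ^ CHAR('k))" using frob_inj[OF p] by (rule injI)
  ultimately have "surj (\<lambda>x::'k. x ^ CHAR('k))" using finite_UNIV_inj_surj by blast
  then show False using imp by simp
qed

lemma sep_hilb_irreducible:
  fixes A :: "'k::field_gcd set"
  assumes hilb: "sep_hilb A" and A: "fraction_subring A"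
    and imp: "CHAR('k) > 0 \<Longrightarrow> range (\<lambda>x::'k. x ^ CHAR('k)) \<noteq> UNIV"
    and gs: "finite gs" "\<And>g. g \<in> gs \<Longrightarrow> irreducible g \<and> degree g > 0" and gp: "gp \<noteq> 0"
  obtains l where "l \<in> A" "poly gp l \<noteq> 0" "\<And>g. g \<in> gs \<Longrightarrow> irreducible (map_poly (\<lambda>c. poly c l) g)"
proof (cases "CHAR('k) = 0")
  case True
  have "irr_frac g \<and> pderiv g \<noteq> 0" if "g \<in> gs" for g
  proof
    show "irr_frac g" using gs(2)[OF that] by (intro irr_frac_prime irreducible_imp_prime_elem) auto
    have "degree g > 0" using gs(2)[OF that] by simp
    then obtain n where n: "degree g = Suc n" by (cases "degree g") auto
    have "of_nat (Suc n) \<noteq> (0 :: 'k poly)"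
      using of_nat_eq_0_iff_char_dvd[of "Suc n", where 'a = "'k poly"] True by simp
    moreover have "coeff g (Suc n) \<noteq> 0" using n by (metis leading_coeff_0_iff degree_0 nat.distinct(1))
    ultimately have "coeff (pderiv g) n \<noteq> 0" by (simp add: coeff_pderiv del: of_nat_Suc)
    then show "pderiv g \<noteq> 0" by auto
  qed
  with hilb gs(1) gp that show ?thesis by (metis sep_hilbD)
next
  case False
  let ?p = "CHAR('k)" and ?F = "range (\<lambda>x::'k. x ^ CHAR('k))"
  have p: "prime ?p" using False prime_CHAR_semidom by blast
  have p0: "?p > 0" using False by simp
  have pp: "prime CHAR('k poly)" using p by simp
  obtain t0 where t0: "t0 \<notin> ?F" using imp p0 by blast
  obtain t where t: "t \<in> A" "t \<notin> ?F"
  proof -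
    obtain a b where ab: "a \<in> A" "b \<in> A" "b \<noteq> 0" "t0 = a / b" using A unfolding fraction_subring_def by metis
    \<comment> \<open>This element is \<open>t0 * b ^ p\<close>: clearing the denominator by a p-th
      power keeps the class of \<open>t0\<close>.\<close>
    have "a * b ^ (?p - 1) \<notin> ?F"
    proof
      assume "a * b ^ (?p - 1) \<in> ?F"
      then obtain v where v: "a * b ^ (?p - 1) = v ^ ?p" by blast
      have "b ^ ?p = b * b ^ (?p - 1)" using p0 by (cases ?p) simp_all
      then have "t0 = (v / b) ^ ?p" using ab v by (simp add: power_divide flip: v)
      with t0 show False by blast
    qed
    moreover have "a * b ^ (?p - 1) \<in> A"
      using A ab fraction_subring_power[OF A] by (simp add: fraction_subring_def)
    ultimately show ?thesis by (rule that[rotated])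
  qed
  \<comment> \<open>For inseparable \<open>g\<close>, that is \<open>e > 0\<close>, the component
    \<open>c\<close> witnesses that the coefficients of \<open>G\<close> are not all p-th powers up
    to a constant; for \<open>e = 0\<close> it is a dummy.\<close>
  define good where "good g r \<longleftrightarrow> (case r of (e, G, c) \<Rightarrow> g = inflate (?p ^ e) G \<and> pderiv G \<noteq> 0 \<and>
    irreducible G \<and> degree G > 0 \<and> (e > 0 \<longrightarrow> (\<nexists>v. c = v ^ ?p) \<and> (\<exists>i j. c = coeff G i * coeff G j ^ (?p - 1))))"
    for g :: "'k poly poly" and r :: "nat \<times> 'k poly poly \<times> 'k poly"
  have "\<exists>r. good g r" if "g \<in> gs" for g
  proof -
    have g: "irreducible g" "degree g > 0" using gs(2)[OF that] by auto
    obtain e G where G: "g = inflate (?p ^ e) G" "pderiv G \<noteq> 0"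
      using inflate_decomposition[of g] g p0 by auto
    have pe: "?p ^ e > 0" using p0 by simp
    have irr: "irreducible G" using g(1) pe unfolding G(1) by (rule irreducible_inflateD)
    have deg: "degree G > 0" using g(2) unfolding G(1) by (simp add: degree_inflate)
    show ?thesis
    proof (cases e)
      case 0
      then show ?thesis using G irr deg by (intro exI[of _ "(e, G, 0)"]) (simp add: good_def)
    next
      case (Suc e')
      \<comment> \<open>A single \<open>p\<close> is split off, because it is the irreducibility of
        \<open>G(y^p)\<close> that yields the witness \<open>c\<close>.\<close>
      have "g = inflate (?p ^ e') (inflate ?p G)" using G(1) Suc by (simp add: inflate_inflate mult.commute)
      then have "irreducible (inflate ?p G)" using g(1) p0 irreducible_inflateD[of "?p ^ e'"] by simp
      then have "prime_elem (inflate ?p G)" by (rule irreducible_imp_prime_elem)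
      then obtain i where "\<nexists>v. coeff G i * lead_coeff G ^ (?p - 1) = v ^ ?p"
        using coeff_not_frob_if_inflate_irreducible[OF pp, of G] deg by auto
      then show ?thesis using G irr deg
        by (intro exI[of _ "(e, G, coeff G i * lead_coeff G ^ (?p - 1))"]) (auto simp: good_def)
    qed
  qed
  then obtain R where R: "\<And>g. g \<in> gs \<Longrightarrow> good g (R g)" by metis
  define cs where "cs = (\<lambda>g. snd (snd (R g))) ` {g \<in> gs. fst (R g) > 0}"
  have cs: "finite cs" using gs(1) by (simp add: cs_def)
  have cs2: "\<nexists>v. c = v ^ ?p" if c: "c \<in> cs" for c
  proof -
    obtain g where g: "g \<in> gs" "fst (R g) > 0" "c = snd (snd (R g))" using c by (auto simp: cs_def)
    show ?thesis using R[OF g(1)] g(2) unfolding good_def g(3) by (auto split: prod.splits)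
  qed
  \<comment> \<open>Shifts \<open>s\<close> for which \<open>u = t + s^p\<close> fails for
    \<open>c\<close>. There is at most one for each \<open>c\<close>, so a common \<open>u\<close>
    exists for all of them.\<close>
  define bad where "bad c = {s. \<forall>i. coeff c i * (t + s ^ ?p) ^ i \<in> ?F}" for c
  have "finite (bad c)" if "c \<in> cs" for c
  proof -
    have "s = s'" if "s \<in> bad c" "s' \<in> bad c" for s s'
      using unique_bad_shift[OF p cs2[OF \<open>c \<in> cs\<close>] t(2), of s s'] that by (simp add: bad_def)
    then have "bad c \<subseteq> {SOME s. s \<in> bad c}" by (metis singletonI someI subsetI)
    then show ?thesis by (rule finite_subset) simp
  qed
  then have "finite (\<Union>c\<in>cs. bad c)" using cs by blast
  with infinite_fraction_subring[OF p A imp[OF p0]] obtain s where s: "s \<in> A" "s \<notin> (\<Union>c\<in>cs. bad c)"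
    by (meson finite_subset subsetI)
  define u where "u = t + s ^ ?p"
  have uA: "u \<in> A" using A t s fraction_subring_power[OF A] by (simp add: u_def fraction_subring_def)
  have u0: "u \<noteq> 0"
  proof
    assume "u = 0"
    then have "t = (- s) ^ ?p" by (simp add: u_def rhom_uminus[OF rhom_frob[OF p]] eq_neg_iff_add_eq_0)
    with t show False by blast
  qed
  let ?tau = "\<lambda>c. pcompose c (Polynomial.monom u ?p)"
  note tau = rhom_pcompose[of "Polynomial.monom u ?p"]
  have tau0: "c = 0" if "?tau c = 0" for c
    by (rule pcompose_eq_0[OF that]) (simp add: degree_monom_eq p0 u0)
  \<comment> \<open>The finitely many \<open>\<mu>\<close> at which some \<open>c(u \<mu>^p)\<close>
    is a p-th power; \<open>gp'\<close> excludes them together with the zeros of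
    \<open>gp(u X^p)\<close>.\<close>
  define B where "B = (\<Union>c\<in>cs. {\<mu>. poly c (u * \<mu> ^ ?p) \<in> ?F})"
  have "finite {\<mu>. poly c (u * \<mu> ^ ?p) \<in> ?F}" if c: "c \<in> cs" for c
  proof -
    obtain i where "coeff c i * u ^ i \<notin> ?F" using s(2) c by (auto simp: bad_def u_def)
    then show ?thesis by (rule finite_frob_values[OF p])
  qed
  then have finB: "finite B" using cs by (simp add: B_def)
  define gp' where "gp' = ?tau gp * (\<Prod>\<mu>\<in>B. [:- \<mu>, 1:])"
  have "gp' \<noteq> 0" using tau0[of gp] gp finB by (auto simp: gp'_def)
  moreover have "irr_frac (map_poly ?tau G) \<and> pderiv (map_poly ?tau G) \<noteq> 0"
    if "G \<in> (\<lambda>g. fst (snd (R g))) ` gs" for G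
  proof
    have G: "irreducible G" "degree G > 0" "pderiv G \<noteq> 0" using R that by (force simp: good_def)+
    show "irr_frac (map_poly ?tau G)" by (rule irr_frac_subst[OF p G u0])
    have "pderiv (map_poly ?tau G) = map_poly ?tau (pderiv G)"
      by (rule poly_eqI) (simp add: coeff_map_poly coeff_pderiv rhom_simps[OF tau] rhom_of_nat[OF tau] flip: of_nat_Suc)
    moreover have "map_poly ?tau (pderiv G) \<noteq> 0"
      using map_poly_eq_0_rhom[OF tau tau0] G(3) by blast
    ultimately show "pderiv (map_poly ?tau G) \<noteq> 0" by simp
  qed
  ultimately obtain \<mu> where \<mu>: "\<mu> \<in> A" "poly gp' \<mu> \<noteq> 0"
    "\<And>G. G \<in> map_poly ?tau ` (\<lambda>g. fst (snd (R g))) ` gs \<Longrightarrow> irreducible (map_poly (\<lambda>c. poly c \<mu>) G)"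
    using sep_hilbD[OF hilb, of "map_poly ?tau ` (\<lambda>g. fst (snd (R g))) ` gs" gp'] gs(1) by blast
  define l where "l = u * \<mu> ^ ?p"
  have ptau: "poly (?tau c) \<mu> = poly c l" for c by (simp add: poly_pcompose l_def poly_monom)
  have "\<mu> \<notin> B" using \<mu>(2) finB by (auto simp: gp'_def poly_prod)
  show thesis
  proof (rule that)
    show "l \<in> A" using A uA \<mu>(1) fraction_subring_power[OF A] by (simp add: l_def fraction_subring_def)
    show "poly gp l \<noteq> 0" using \<mu>(2) ptau[of gp] by (auto simp: gp'_def)
    fix g assume g: "g \<in> gs"
    obtain e G c where r: "R g = (e, G, c)" by (cases "R g") auto
    note ev = rhom_poly[of l]
    have gd: "good g (e, G, c)" using R[OF g] r by simp
    define h where "h = map_poly (\<lambda>c. poly c l) G"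
    have "map_poly ?tau G \<in> map_poly ?tau ` (\<lambda>g. fst (snd (R g))) ` gs" using g r by force
    from \<mu>(3)[OF this] have "irreducible (map_poly (\<lambda>c. poly (?tau c) \<mu>) G)"
      by (simp add: map_poly_comp_rhom[OF rhom_poly tau])
    then have h: "irreducible h" unfolding ptau h_def .
    have gh: "map_poly (\<lambda>c. poly c l) g = inflate (?p ^ e) h"
      using gd by (simp add: good_def h_def map_poly_inflate[OF ev])
    show "irreducible (map_poly (\<lambda>c. poly c l) g)"
    proof (cases "e = 0")
      case True
      then show ?thesis using gh h by (simp add: inflate_1)
    next
      case False
      then have "c \<in> cs" using g r by (force simp: cs_def)
      then have nF: "poly c l \<notin> ?F" using \<open>\<mu> \<notin> B\<close> by (auto simp: B_def l_def)
      obtain i j where c: "c = coeff G i * coeff G j ^ (?p - 1)" using gd False by (auto simp: good_def)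
      have "\<not> frob_assoc h"
        using frob_assoc_coeff[OF p, of h i j] nF by (auto simp: c h_def coeff_map_poly poly_power)
      then show ?thesis unfolding gh using irreducible_inflate[OF p h] by blast
    qed
  qed
qed

text \<open>The substitution \<open>\<lambda> \<mapsto> a + b \<lambda>\<close> is an automorphism of \<open>K[\<lambda>]\<close>.\<close>

lemma sep_hilb_irreducible_congruence:
  fixes A :: "'k::field_gcd set"
  assumes hilb: "sep_hilb A" and A: "fraction_subring A"
    and imp: "CHAR('k) > 0 \<Longrightarrow> range (\<lambda>x::'k. x ^ CHAR('k)) \<noteq> UNIV"
    and gs: "finite gs" "\<And>g. g \<in> gs \<Longrightarrow> irreducible g \<and> degree g > 0" and gp: "gp \<noteq> 0" and b: "b \<noteq> 0"
  obtains l where "l \<in> A" "poly gp (a + b * l) \<noteq> 0"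
    "\<And>g. g \<in> gs \<Longrightarrow> irreducible (map_poly (\<lambda>c. poly c (a + b * l)) g)"
proof -
  define s where "s = (\<lambda>c::'k poly. pcompose c [:a, b:])"
  define t where "t = (\<lambda>c::'k poly. pcompose c [:- a / b, inverse b:])"
  have s: "rhom s" and t: "rhom t" unfolding s_def t_def by (rule rhom_pcompose)+
  have ts: "t (s c) = c" and st: "s (t c) = c" for c
    using b by (simp_all add: s_def t_def pcompose_pCons field_simps flip: pcompose_assoc)
  note S = rhom_map_poly[OF s] and T = rhom_map_poly[OF t]
  have TS: "map_poly t (map_poly s g) = g" "map_poly s (map_poly t g) = g" for g
    by (simp_all add: map_poly_comp_rhom[OF t s] map_poly_comp_rhom[OF s t] ts st)
  have s0: "s c = 0 \<Longrightarrow> c = 0" for c using ts[of c] rhom_0[OF t] by simp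
  have "irreducible (map_poly s g) \<and> degree (map_poly s g) > 0" if "g \<in> gs" for g
    using gs(2)[OF that] irreducible_retract[OF T S, of "map_poly s g"]
    by (simp add: TS degree_map_poly_rhom[OF s s0])
  moreover have "s gp \<noteq> 0" using s0 gp by blast
  ultimately obtain l where l: "l \<in> A" "poly (s gp) l \<noteq> 0"
    "\<And>g. g \<in> map_poly s ` gs \<Longrightarrow> irreducible (map_poly (\<lambda>c. poly c l) g)"
    using sep_hilb_irreducible[OF hilb A imp, of "map_poly s ` gs" "s gp"] gs(1) by blast
  have ps: "poly (s c) l = poly c (a + b * l)" for c by (simp add: s_def poly_pcompose mult.commute)
  show thesis
  proof (rule that[OF l(1)])
    show "poly gp (a + b * l) \<noteq> 0" using l(2) by (simp add: ps)
    fix g assume "g \<in> gs"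
    then have "irreducible (map_poly (\<lambda>c. poly c l) (map_poly s g))" by (intro l(3)) simp
    then show "irreducible (map_poly (\<lambda>c. poly c (a + b * l)) g)"
      by (simp add: map_poly_comp_rhom[OF rhom_poly s] ps)
  qed
qed

lemma Cst_eq_iff: "Cst x = Cst y \<longleftrightarrow> x = y"
  by (metis lookup_single_eq)

section \<open>Degrees of multivariate polynomials\<close>

lemma lookup_diff_single:
  "Poly_Mapping.lookup (m - Poly_Mapping.single i (Poly_Mapping.lookup m i)) j =
     (if j = i then 0 else Poly_Mapping.lookup (m :: nat \<Rightarrow>\<^sub>0 nat) j)"
  by (simp add: lookup_minus lookup_single when_def)

lemma diff_single_inj:
  assumes "m - Poly_Mapping.single i (Poly_Mapping.lookup m i) = n - Poly_Mapping.single i (Poly_Mapping.lookup n i)"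
    and "Poly_Mapping.lookup m i = Poly_Mapping.lookup (n :: nat \<Rightarrow>\<^sub>0 nat) i"
  shows "m = n"
proof (rule poly_mapping_eqI)
  fix j
  show "Poly_Mapping.lookup m j = Poly_Mapping.lookup n j"
  proof (cases "j = i")
    case False
    then show ?thesis
      using lookup_diff_single[of m i j] lookup_diff_single[of n i j] assms(1) by simp
  qed (simp add: assms(2))
qed

text \<open>Singles out \<open>X_i\<close> as the outer indeterminate, over the polynomials in the
  others, so that degrees of univariate polynomials become available.\<close>

definition split_var :: "nat \<Rightarrow> 'a::comm_ring_1 mpoly \<Rightarrow> 'a mpoly poly" where
  "split_var i = meval (\<lambda>c. [:Cst c:]) (\<lambda>j. if j = i then [:0, 1:] else [:Var j:])"

lemma rhom_const_Cst: "rhom (\<lambda>c::'a::comm_ring_1. [:Cst c:])"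
  by (rule rhom_comp[OF rhom_pCons rhom_Cst])

lemma rhom_split_var: "rhom (split_var i)"
  unfolding split_var_def by (rule rhom_meval[OF rhom_const_Cst])

lemma split_var_single:
  fixes c :: "'a::comm_ring_1"
  shows "split_var i (Poly_Mapping.single m c) = Polynomial.monom
     (Poly_Mapping.single (m - Poly_Mapping.single i (Poly_Mapping.lookup m i)) c) (Poly_Mapping.lookup m i)"
proof -
  let ?n = "m - Poly_Mapping.single i (Poly_Mapping.lookup m i)"
  let ?v = "\<lambda>j. if j = i then [:0, 1:] else [:Var j::'a mpoly:]"
  let ?A = "Poly_Mapping.keys m - {i}"
  have n: "Poly_Mapping.keys ?n \<subseteq> ?A" by (auto simp: in_keys_iff lookup_diff_single simp del: lookup_minus split: if_splits)
  have "(\<Prod>j\<in>Poly_Mapping.keys m. ?v j ^ Poly_Mapping.lookup m j) =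
      (\<Prod>j\<in>insert i ?A. ?v j ^ Poly_Mapping.lookup m j)"
    by (rule prod_power_superset) auto
  also have "\<dots> = [:0, 1:] ^ Poly_Mapping.lookup m i * (\<Prod>j\<in>?A. ?v j ^ Poly_Mapping.lookup m j)"
    by (subst prod.insert) auto
  also have "(\<Prod>j\<in>?A. ?v j ^ Poly_Mapping.lookup m j) = (\<Prod>j\<in>?A. [:Var j:] ^ Poly_Mapping.lookup ?n j)"
    by (rule prod.cong) (auto simp: lookup_diff_single simp del: lookup_minus)
  also have "\<dots> = [:\<Prod>j\<in>?A. Var j ^ Poly_Mapping.lookup ?n j:]"
    by (simp only: rhom_prod[OF rhom_pCons] rhom_power[OF rhom_pCons])
  also have "(\<Prod>j\<in>?A. Var j ^ Poly_Mapping.lookup ?n j) =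
      (\<Prod>j\<in>Poly_Mapping.keys ?n. Var j ^ Poly_Mapping.lookup ?n j :: 'a mpoly)"
    by (rule prod_power_superset[symmetric]) (use n in auto)
  finally have "split_var i (Poly_Mapping.single m c) = [:Cst c:] * ([:0, 1:] ^ Poly_Mapping.lookup m i *
      [:\<Prod>j\<in>Poly_Mapping.keys ?n. Var j ^ Poly_Mapping.lookup ?n j:])"
    by (simp add: split_var_def meval_single)
  also have "\<dots> = [:Poly_Mapping.single ?n c:] * [:0, 1:] ^ Poly_Mapping.lookup m i"
    by (subst (2) single_expand) (simp add: mult_ac)
  finally show ?thesis by (simp add: monom_altdef)
qed

lemma split_var_expand:
  "split_var i p = (\<Sum>m\<in>Poly_Mapping.keys p. Polynomial.monom
     (Poly_Mapping.single (m - Poly_Mapping.single i (Poly_Mapping.lookup m i)) (Poly_Mapping.lookup p m))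
     (Poly_Mapping.lookup m i))"
proof -
  have "split_var i p = split_var i (\<Sum>m\<in>Poly_Mapping.keys p. Poly_Mapping.single m (Poly_Mapping.lookup p m))"
    by (simp only: poly_mapping_sum_singles)
  then show ?thesis by (simp only: rhom_sum[OF rhom_split_var] split_var_single)
qed

definition vdeg :: "nat \<Rightarrow> 'a::comm_ring_1 mpoly \<Rightarrow> nat" where
  "vdeg i p = degree (split_var i p)"

text \<open>Distinct monomials with the same exponent of \<open>X_i\<close> remain distinct when
  \<open>X_i\<close> is deleted, so nothing cancels.\<close>

lemma coeff_split_var_nonzero:
  assumes "m \<in> Poly_Mapping.keys p"
  shows "coeff (split_var i p) (Poly_Mapping.lookup m i) \<noteq> 0"
proof -
  let ?n = "\<lambda>m. m - Poly_Mapping.single i (Poly_Mapping.lookup m i)"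
  have "Poly_Mapping.lookup (coeff (split_var i p) (Poly_Mapping.lookup m i)) (?n m) =
    (\<Sum>m'\<in>Poly_Mapping.keys p. if m' = m then Poly_Mapping.lookup p m' else 0)"
    unfolding split_var_expand coeff_sum lookup_sum
  proof (rule sum.cong)
    fix x
    show "Poly_Mapping.lookup (coeff (Polynomial.monom (Poly_Mapping.single (?n x) (Poly_Mapping.lookup p x))
        (Poly_Mapping.lookup x i)) (Poly_Mapping.lookup m i)) (?n m) = (if x = m then Poly_Mapping.lookup p x else 0)"
      using diff_single_inj[of x i m] by (auto simp: lookup_single when_def)
  qed simp
  also have "\<dots> \<noteq> 0" using assms by (simp add: in_keys_iff)
  finally show ?thesis by auto
qed

lemma lookup_le_vdeg: "m \<in> Poly_Mapping.keys p \<Longrightarrow> Poly_Mapping.lookup m i \<le> vdeg i p"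
  unfolding vdeg_def using coeff_split_var_nonzero by (rule le_degree)

lemma vdeg_le:
  assumes "\<And>m. m \<in> Poly_Mapping.keys p \<Longrightarrow> Poly_Mapping.lookup m i \<le> n"
  shows "vdeg i p \<le> n"
  unfolding vdeg_def split_var_expand
  by (rule degree_sum_le) (use assms in \<open>auto intro: order_trans[OF degree_monom_le]\<close>)

lemma split_var_eq_0: "split_var i p = 0 \<Longrightarrow> p = 0"
  using coeff_split_var_nonzero[of _ p i] by (metis coeff_0 keys_eq_empty ex_in_conv)

lemma vdeg_mult:
  fixes p q :: "'a::idom mpoly"
  assumes "p \<noteq> 0" "q \<noteq> 0"
  shows "vdeg i (p * q) = vdeg i p + vdeg i q"
  unfolding vdeg_def rhom_mult[OF rhom_split_var]
  by (rule degree_mult_eq) (use assms split_var_eq_0 in blast)+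

lemma vdeg_eq_0_iff: "vdeg i p = 0 \<longleftrightarrow> i \<notin> mvars p"
proof
  assume "vdeg i p = 0"
  then have "Poly_Mapping.lookup m i = 0" if "m \<in> Poly_Mapping.keys p" for m
    using lookup_le_vdeg[OF that, of i] by simp
  then show "i \<notin> mvars p" by (auto simp: mvars_def in_keys_iff)
next
  assume "i \<notin> mvars p"
  then have "vdeg i p \<le> 0" by (intro vdeg_le) (auto simp: mvars_def in_keys_iff)
  then show "vdeg i p = 0" by simp
qed

text \<open>Degrees in each indeterminate add up over a domain. Hence factors involve no
  indeterminates beyond those of the product.\<close>

lemma mvars_mult:
  fixes p q :: "'a::idom mpoly"
  assumes "p \<noteq> 0" "q \<noteq> 0"
  shows "mvars (p * q) = mvars p \<union> mvars q"
proof (rule Set.set_eqI)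
  fix i
  show "i \<in> mvars (p * q) \<longleftrightarrow> i \<in> mvars p \<union> mvars q"
    using vdeg_mult[OF assms, of i] vdeg_eq_0_iff[of i p] vdeg_eq_0_iff[of i q] vdeg_eq_0_iff[of i "p * q"] by auto
qed

lemma mvars_empty:
  assumes "mvars p = {}"
  shows "p = Cst (Poly_Mapping.lookup p 0)"
proof (rule poly_mapping_eqI)
  fix m
  have "m \<notin> Poly_Mapping.keys p" if "m \<noteq> 0"
    using assms that by (auto simp: mvars_def)
  then show "Poly_Mapping.lookup p m = Poly_Mapping.lookup (Cst (Poly_Mapping.lookup p 0)) m"
    by (cases "m = 0") (auto simp: in_keys_iff lookup_single when_def)
qed

lemma finite_mvars: "finite (mvars p)"
  by (simp add: mvars_def)

lemma mvars_0 [simp]: "mvars 0 = {}"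
  by (simp add: mvars_def)

lemma mvars_Cst [simp]: "mvars (Cst c) = {}"
  by (cases "c = 0") (simp_all add: mvars_def)

lemma mvars_Var [simp]: "mvars (Var i :: 'a::comm_ring_1 mpoly) = {i}"
  by (simp add: mvars_def)

lemma mvars_add: "mvars (p + q) \<subseteq> mvars p \<union> mvars q"
  using Poly_Mapping.keys_add[of p q] by (auto simp: mvars_def)

lemma mvars_mult_subset: "mvars (p * q) \<subseteq> mvars p \<union> mvars (q :: 'a::comm_ring_1 mpoly)"
proof
  fix i assume "i \<in> mvars (p * q)"
  then obtain m where m: "m \<in> Poly_Mapping.keys (p * q)" "i \<in> Poly_Mapping.keys m" by (auto simp: mvars_def)
  obtain a b where ab: "m = a + b" "a \<in> Poly_Mapping.keys p" "b \<in> Poly_Mapping.keys q"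
    using m(1) Poly_Mapping.keys_mult[of p q] by blast
  have "i \<in> Poly_Mapping.keys a \<union> Poly_Mapping.keys b" using m(2) Poly_Mapping.keys_add[of a b] ab by auto
  then show "i \<in> mvars p \<union> mvars q" using ab by (auto simp: mvars_def)
qed

lemma mvars_power: "mvars (p ^ n) \<subseteq> mvars (p :: 'a::comm_ring_1 mpoly)"
proof (induction n)
  case 0
  then show ?case using mvars_Cst[of "1::'a"] by simp
next
  case (Suc n)
  then show ?case using mvars_mult_subset[of p "p ^ n"] by auto
qed

lemma mvars_sum: "mvars (sum f A) \<subseteq> (\<Union>a\<in>A. mvars (f a))"
proof (induction A rule: infinite_finite_induct)
  case (insert x F)
  then show ?case using mvars_add[of "f x" "sum f F"] by auto
qed simp_all

lemma mvars_prod: "mvars (prod f A) \<subseteq> (\<Union>a\<in>A. mvars (f a :: 'a::comm_ring_1 mpoly))"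
proof (induction A rule: infinite_finite_induct)
  case (insert x F)
  then show ?case using mvars_mult_subset[of "f x" "prod f F"] by auto
qed (use mvars_Cst[of "1::'a"] in simp_all)

lemma mvars_meval:
  fixes v :: "nat \<Rightarrow> 'b::comm_ring_1 mpoly"
  shows "mvars (meval f v p) \<subseteq>
    (\<Union>m\<in>Poly_Mapping.keys p. mvars (f (Poly_Mapping.lookup p m))) \<union> (\<Union>i\<in>mvars p. mvars (v i))"
proof -
  have 1: "mvars (f c * (\<Prod>i\<in>Poly_Mapping.keys m. v i ^ Poly_Mapping.lookup m i)) \<subseteq>
      mvars (f c) \<union> (\<Union>i\<in>Poly_Mapping.keys m. mvars (v i))" for c m
  proof -
    have "mvars (\<Prod>i\<in>Poly_Mapping.keys m. v i ^ Poly_Mapping.lookup m i) \<subseteq>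
        (\<Union>i\<in>Poly_Mapping.keys m. mvars (v i ^ Poly_Mapping.lookup m i))"
      by (rule mvars_prod)
    also have "\<dots> \<subseteq> (\<Union>i\<in>Poly_Mapping.keys m. mvars (v i))"
      by (intro UN_mono order_refl mvars_power)
    finally show ?thesis
      using mvars_mult_subset[of "f c" "\<Prod>i\<in>Poly_Mapping.keys m. v i ^ Poly_Mapping.lookup m i"] by blast
  qed
  have "mvars (meval f v p) \<subseteq> (\<Union>m\<in>Poly_Mapping.keys p.
      mvars (f (Poly_Mapping.lookup p m)) \<union> (\<Union>i\<in>Poly_Mapping.keys m. mvars (v i)))"
    unfolding meval_def by (rule order_trans[OF mvars_sum]) (intro UN_mono order_refl 1)
  then show ?thesis by (simp add: mvars_def[of p] UN_Un_distrib)
qed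

section \<open>Specialization of one indeterminate\<close>

definition spec :: "nat \<Rightarrow> 'a::comm_ring_1 \<Rightarrow> 'a mpoly \<Rightarrow> 'a mpoly" where
  "spec k l = meval Cst (\<lambda>i. if i = k then Cst l else Var i)"

lemma rhom_spec: "rhom (spec k l)"
  unfolding spec_def by (rule rhom_meval[OF rhom_Cst])

lemma spec_Cst: "spec k l (Cst c) = Cst c"
  by (simp add: spec_def meval_Cst)

lemma spec_Var: "spec k l (Var i) = (if i = k then Cst l else Var i)"
  by (simp add: spec_def meval_Var[OF rhom_Cst])

lemma mvars_spec: "mvars (spec k l p) \<subseteq> mvars p - {k}"
  unfolding spec_def using mvars_meval[of Cst "\<lambda>i. if i = k then Cst l else Var i" p]
  by (auto split: if_splits)

lemma spec_conv_split_var: "spec k l p = poly (split_var k p) (Cst l)"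
  by (rule rhom_mpoly_eqI[OF rhom_spec rhom_comp[OF rhom_poly rhom_split_var]])
     (simp_all add: spec_Cst spec_Var split_var_def meval_Cst meval_Var[OF rhom_const_Cst])

lemma finite_spec_zeros:
  fixes Q :: "'a::idom mpoly"
  assumes "Q \<noteq> 0"
  shows "finite {l. spec k l Q = 0}"
proof -
  have "finite {x. poly (split_var k Q) x = 0}"
    using assms split_var_eq_0 by (intro poly_roots_finite) blast
  then have "finite (Cst -` {x. poly (split_var k Q) x = 0})"
    by (rule finite_vimageI) (simp add: inj_on_def Cst_eq_iff)
  then show ?thesis by (simp add: spec_conv_split_var vimage_def)
qed

lemma spec_commute: "i \<noteq> k \<Longrightarrow> spec i x (spec k y p) = spec k y (spec i x p)"
  by (rule rhom_mpoly_eqI[OF rhom_comp[OF rhom_spec rhom_spec] rhom_comp[OF rhom_spec rhom_spec]])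
     (auto simp add: spec_Cst spec_Var)

text \<open>It expresses the occurrence of \<open>X_i\<close> by the nonvanishing of
  \<open>p - spec i l p\<close>, a condition that can be carried through further
  specializations.\<close>

lemma spec_eq_self_iff: "spec i l p = p \<longleftrightarrow> i \<notin> mvars p"
proof
  assume "spec i l p = p"
  then show "i \<notin> mvars p" using mvars_spec[of i l p] by auto
next
  assume i: "i \<notin> mvars p"
  show "spec i l p = p"
    by (rule rhom_mpoly_eqI[OF rhom_spec rhom_id]) (use i in \<open>auto simp: spec_Cst spec_Var\<close>)
qed

section \<open>Kronecker's substitution\<close>

lemma digit_sum:
  fixes d :: "nat \<Rightarrow> nat"
  assumes "\<And>j. j < n \<Longrightarrow> d j < D" and "i < n"
  shows "(\<Sum>j<n. d j * D ^ j) div D ^ i mod D = d i"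
  using assms
proof (induction n arbitrary: d i)
  case (Suc n)
  have D: "D > 0" using Suc.prems(1)[of 0] by simp
  have "(\<Sum>j<Suc n. d j * D ^ j) = d 0 + D * (\<Sum>j<n. d (Suc j) * D ^ j)"
    by (simp add: sum.lessThan_Suc_shift sum_distrib_left mult_ac del: sum.lessThan_Suc)
  then show ?case
  proof (cases i)
    case (Suc i')
    have "(d 0 + D * (\<Sum>j<n. d (Suc j) * D ^ j)) div D ^ i mod D = (\<Sum>j<n. d (Suc j) * D ^ j) div D ^ i' mod D"
      using Suc.prems(1)[of 0] D by (simp add: Suc div_mult2_eq)
    also have "\<dots> = d (Suc i')" using Suc.IH[of "\<lambda>j. d (Suc j)" i'] Suc.prems Suc by simp
    finally show ?thesis using Suc \<open>(\<Sum>j<Suc n. d j * D ^ j) = _\<close> by simp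
  qed (use Suc.prems in simp)
qed simp

lemma sum_digits:
  fixes D b :: nat
  shows "(\<Sum>j<n. (b div D ^ j mod D) * D ^ j) = b mod D ^ n"
proof (induction n)
  case (Suc n)
  have "b mod D ^ Suc n = D ^ n * (b div D ^ n mod D) + b mod D ^ n"
    by (simp add: mod_mult2_eq mult.commute[of D])
  then show ?case using Suc by (simp add: mult.commute)
qed simp

text \<open>\<open>X_k\<close> is kept as the inner indeterminate, and the exponents of the later
  ones become digits in base \<open>D\<close> of the exponent of \<open>y\<close>. The value
  \<open>0\<close> is a default for indices below \<open>k\<close>, which are already specialized at
  this stage.\<close>

definition kron :: "nat \<Rightarrow> nat \<Rightarrow> 'a::comm_ring_1 mpoly \<Rightarrow> 'a poly poly" where
  "kron k D = meval (\<lambda>c. [:[:c:]:])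
     (\<lambda>i. if i = k then [:[:0, 1:]:] else if i < k then 0 else Polynomial.monom 1 (D ^ (i - Suc k)))"

definition kron1 :: "nat \<Rightarrow> nat \<Rightarrow> 'a::comm_ring_1 mpoly \<Rightarrow> 'a poly" where
  "kron1 k D = meval (\<lambda>c. [:c:])
     (\<lambda>i. if i \<le> k then 0 else Polynomial.monom 1 (D ^ (i - Suc k)))"

definition emb :: "nat \<Rightarrow> 'a::comm_ring_1 poly \<Rightarrow> 'a mpoly" where
  "emb k c = poly (map_poly Cst c) (Var k)"

text \<open>The exponents are the digits of \<open>b\<close> in base \<open>D\<close>; for
  \<open>D \<ge> 2\<close>, \<open>Suc b\<close> digits suffice.\<close>

definition digit_monom :: "nat \<Rightarrow> nat \<Rightarrow> nat \<Rightarrow> 'a::comm_ring_1 mpoly" where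
  "digit_monom k D b = (\<Prod>j<Suc b. Var (Suc k + j) ^ (b div D ^ j mod D))"

text \<open>A right inverse of \<open>kron\<close> for \<open>D \<ge> 2\<close>. It is linear over
  \<open>K[X_k]\<close> but not multiplicative, as adding exponents in a product may cause
  carries.\<close>

definition unkron :: "nat \<Rightarrow> nat \<Rightarrow> 'a::comm_ring_1 poly poly \<Rightarrow> 'a mpoly" where
  "unkron k D u = (\<Sum>b\<le>degree u. emb k (coeff u b) * digit_monom k D b)"

lemma rhom_const2: "rhom (\<lambda>c::'a::comm_ring_1. [:[:c:]:])"
  by (rule rhom_comp[OF rhom_pCons rhom_pCons])

lemma rhom_kron: "rhom (kron k D)"
  unfolding kron_def by (rule rhom_meval[OF rhom_const2])

lemma rhom_kron1: "rhom (kron1 k D)"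
  unfolding kron1_def by (rule rhom_meval[OF rhom_pCons])

lemma rhom_emb: "rhom (emb k)"
  unfolding emb_def[abs_def] by (rule rhom_comp[OF rhom_poly rhom_map_poly[OF rhom_Cst]])

lemma kron_Cst: "kron k D (Cst c) = [:[:c:]:]"
  by (simp add: kron_def meval_Cst)

lemma kron_Var: "kron k D (Var i) =
    (if i = k then [:[:0, 1:]:] else if i < k then 0 else Polynomial.monom 1 (D ^ (i - Suc k)))"
  by (simp add: kron_def meval_Var[OF rhom_const2])

lemma kron1_Cst: "kron1 k D (Cst c) = [:c:]"
  by (simp add: kron1_def meval_Cst)

lemma kron1_Var: "kron1 k D (Var i) = (if i \<le> k then 0 else Polynomial.monom 1 (D ^ (i - Suc k)))"
  by (simp add: kron1_def meval_Var[OF rhom_pCons])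

lemma emb_const: "emb k [:c:] = Cst c"
  by (simp add: emb_def map_poly_pCons)

lemma emb_X: "emb k [:0, 1:] = Var k"
  by (simp add: emb_def map_poly_pCons)

lemma rhom_poly_eqI:
  assumes f: "rhom f" and g: "rhom g" and "\<And>c. f [:c:] = g [:c:]" "f [:0, 1:] = g [:0, 1:]"
  shows "f p = g p"
proof (induction p)
  case (pCons a p)
  have eq: "pCons a p = [:a:] + [:0, 1:] * p" by simp
  show ?case
    unfolding eq rhom_add[OF f] rhom_add[OF g] rhom_mult[OF f] rhom_mult[OF g] assms(3,4) pCons.IH ..
qed (simp add: rhom_0[OF f] rhom_0[OF g])

lemma kron_emb: "kron k D (emb k c) = [:c:]"
  by (rule rhom_poly_eqI[OF rhom_comp[OF rhom_kron rhom_emb] rhom_pCons])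
     (simp_all add: emb_const emb_X kron_Cst kron_Var)

lemma spec_emb: "spec k l (emb k c) = Cst (poly c l)"
  by (rule rhom_poly_eqI[OF rhom_comp[OF rhom_spec rhom_emb] rhom_comp[OF rhom_Cst rhom_poly]])
     (simp_all add: emb_const emb_X spec_Cst spec_Var)

lemma kron_digit_monom:
  assumes "D \<ge> 2"
  shows "kron k D (digit_monom k D b) = Polynomial.monom 1 b"
proof -
  have pm: "(\<Prod>j\<in>A. Polynomial.monom (1::'a poly) (e j)) = Polynomial.monom 1 (\<Sum>j\<in>A. e j)" for A :: "nat set" and e
    by (induction A rule: infinite_finite_induct) (simp_all add: mult_monom)
  have "kron k D (digit_monom k D b :: _ \<Rightarrow>\<^sub>0 'a) = Polynomial.monom 1 (\<Sum>j<Suc b. (b div D ^ j mod D) * D ^ j)"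
    unfolding digit_monom_def
    by (simp add: rhom_prod[OF rhom_kron] rhom_power[OF rhom_kron] kron_Var monom_power pm mult.commute
        del: prod.lessThan_Suc sum.lessThan_Suc)
  also have "(\<Sum>j<Suc b. (b div D ^ j mod D) * D ^ j) = b"
  proof -
    have "b < 2 ^ b" by (rule less_exp)
    also have "\<dots> \<le> D ^ b" using assms by (rule power_mono) simp
    also have "\<dots> \<le> D ^ Suc b" using assms by simp
    finally show ?thesis unfolding sum_digits by simp
  qed
  finally show ?thesis .
qed

lemma spec_digit_monom: "spec k l (digit_monom k D b) = digit_monom k D b"
  unfolding digit_monom_def by (simp add: rhom_prod[OF rhom_spec] rhom_power[OF rhom_spec] spec_Var del: prod.lessThan_Suc)

lemma unkron_superset:
  assumes "degree u \<le> n"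
  shows "unkron k D u = (\<Sum>b\<le>n. emb k (coeff u b) * digit_monom k D b)"
  unfolding unkron_def
  by (rule sum.mono_neutral_left) (use assms in \<open>auto simp: coeff_eq_0 rhom_0[OF rhom_emb]\<close>)

lemma unkron_add: "unkron k D (u + v) = unkron k D u + unkron k D v"
proof -
  let ?n = "max (degree u) (degree v)"
  have "degree (u + v) \<le> ?n" by (rule degree_add_le_max)
  then show ?thesis
    by (simp add: unkron_superset[of _ ?n] rhom_add[OF rhom_emb] distrib_right sum.distrib)
qed

lemma unkron_0: "unkron k D 0 = 0"
  by (simp add: unkron_def rhom_0[OF rhom_emb])

lemma unkron_sum: "unkron k D (sum f A) = (\<Sum>a\<in>A. unkron k D (f a))"
  by (induction A rule: infinite_finite_induct) (simp_all add: unkron_add unkron_0)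

lemma unkron_smult: "unkron k D (smult c u) = emb k c * unkron k D u"
  unfolding unkron_superset[OF degree_smult_le[of c u]]
  by (simp add: unkron_def rhom_mult[OF rhom_emb] sum_distrib_left mult.assoc)

lemma unkron_monom: "unkron k D (Polynomial.monom c b) = emb k c * digit_monom k D b"
proof (cases "c = 0")
  case False
  have "unkron k D (Polynomial.monom c b) = (\<Sum>b'\<le>b. if b = b' then emb k c * digit_monom k D b' else 0)"
    unfolding unkron_superset[OF degree_monom_le]
    by (rule sum.cong) (auto simp: rhom_0[OF rhom_emb])
  then show ?thesis by simp
qed (simp add: unkron_0 rhom_0[OF rhom_emb])

lemma kron_unkron:
  assumes "D \<ge> 2"
  shows "kron k D (unkron k D u) = u"
proof -
  have "kron k D (unkron k D u) = (\<Sum>b\<le>degree u. Polynomial.monom (coeff u b) b)"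
    unfolding unkron_def
    by (simp add: rhom_sum[OF rhom_kron] rhom_mult[OF rhom_kron] kron_emb kron_digit_monom[OF assms] smult_monom)
  then show ?thesis by (simp add: poly_as_sum_of_monoms)
qed

lemma unkron_kron_single:
  fixes c :: "'a::comm_ring_1"
  assumes m: "Poly_Mapping.keys m \<subseteq> {k..}" "\<And>i. i > k \<Longrightarrow> Poly_Mapping.lookup m i < D"
  shows "unkron k D (kron k D (Poly_Mapping.single m c)) = Poly_Mapping.single m c"
proof -
  obtain N0 where N0: "Poly_Mapping.keys m \<subseteq> {..<N0}" using finite_nat_bounded finite_keys by blast
  define d where "d j = Poly_Mapping.lookup m (Suc k + j)" for j
  have dD: "d j < D" for j by (simp add: d_def m(2))
  have d0: "d j = 0" if "j \<ge> N0" for j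
    using N0 that by (auto simp: d_def in_keys_iff subset_iff)
  define b where "b = (\<Sum>j<N0. d j * D ^ j)"
  define N where "N = max N0 (Suc b)"
  have bN: "b = (\<Sum>j<N. d j * D ^ j)"
    unfolding b_def by (rule sum.mono_neutral_left) (auto simp: N_def d0)
  have dig: "b div D ^ j mod D = d j" if "j < N" for j
    unfolding bN using dD that by (rule digit_sum)
  have "inj_on (\<lambda>j. Suc k + j) {..<N}" by (simp add: inj_on_def)
  let ?A = "insert k ((\<lambda>j. Suc k + j) ` {..<N})"
  have sub: "Poly_Mapping.keys m \<subseteq> ?A"
  proof
    fix i assume i: "i \<in> Poly_Mapping.keys m"
    show "i \<in> ?A"
    proof (cases "i = k")
      case False
      then have "i = Suc k + (i - Suc k)" "i - Suc k < N" using m(1) N0 i by (auto simp: N_def subset_iff)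
      then show ?thesis by blast
    qed simp
  qed
  have prod_A: "(\<Prod>i\<in>Poly_Mapping.keys m. v i ^ Poly_Mapping.lookup m i) =
      v k ^ Poly_Mapping.lookup m k * (\<Prod>j<N. v (Suc k + j) ^ d j)" for v :: "nat \<Rightarrow> 'b::comm_ring_1"
  proof -
    have "(\<Prod>i\<in>Poly_Mapping.keys m. v i ^ Poly_Mapping.lookup m i) = (\<Prod>i\<in>?A. v i ^ Poly_Mapping.lookup m i)"
      by (rule prod_power_superset) (use sub in auto)
    also have "\<dots> = v k ^ Poly_Mapping.lookup m k * (\<Prod>i\<in>(\<lambda>j. Suc k + j) ` {..<N}. v i ^ Poly_Mapping.lookup m i)"
      by (subst prod.insert) auto
    also have "(\<Prod>i\<in>(\<lambda>j. Suc k + j) ` {..<N}. v i ^ Poly_Mapping.lookup m i) = (\<Prod>j<N. v (Suc k + j) ^ d j)"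
      by (subst prod.reindex) (auto simp: inj_on_def d_def)
    finally show ?thesis .
  qed
  have pm: "(\<Prod>j\<in>A. Polynomial.monom (1::'a poly) (e j)) = Polynomial.monom 1 (\<Sum>j\<in>A. e j)" for A :: "nat set" and e
    by (induction A rule: infinite_finite_induct) (simp_all add: mult_monom)
  have dm: "digit_monom k D b = (\<Prod>j<N. Var (Suc k + j) ^ d j :: _ \<Rightarrow>\<^sub>0 'a)"
  proof -
    \<comment> \<open>The two products differ in length. Beyond position \<open>b\<close> the digits
      vanish because \<open>b < D ^ j\<close>; for \<open>D < 2\<close> the bound
      \<open>d j < D\<close> alone forces this.\<close>
    have "d j = 0" if "j \<ge> Suc b" "j < N" for j
    proof -
      have "b < 2 ^ b" by (rule less_exp)
      also have "\<dots> \<le> 2 ^ j" using that by (intro power_increasing) auto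
      finally have "D \<ge> 2 \<Longrightarrow> b < D ^ j" using power_mono[of 2 D j] by linarith
      then show ?thesis using dig[of j] dD[of j] that by (cases "D \<ge> 2") auto
    qed
    then have "(\<Prod>j<N. Var (Suc k + j) ^ d j) = (\<Prod>j<Suc b. Var (Suc k + j) ^ d j :: _ \<Rightarrow>\<^sub>0 'a)"
      by (intro prod.mono_neutral_right) (auto simp: N_def)
    also have "\<dots> = digit_monom k D b"
      unfolding digit_monom_def by (rule prod.cong) (auto simp: dig N_def)
    finally show ?thesis ..
  qed
  have "kron k D (Poly_Mapping.single m c) = [:[:c:]:] * ([:[:0, 1:]:] ^ Poly_Mapping.lookup m k *
      (\<Prod>j<N. Polynomial.monom 1 (D ^ j) ^ d j))"
    unfolding kron_def meval_single[of "\<lambda>c. [:[:c:]:]", simplified] prod_A by simp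
  also have "(\<Prod>j<N. Polynomial.monom (1::'a poly) (D ^ j) ^ d j) = Polynomial.monom 1 b"
    by (simp add: monom_power pm bN mult.commute)
  also have "[:[:c:]:] * ([:[:0, 1:]:] ^ Poly_Mapping.lookup m k * Polynomial.monom 1 b) =
      Polynomial.monom ([:c:] * [:0, 1:] ^ Poly_Mapping.lookup m k) b"
    by (simp add: poly_const_pow smult_monom)
  finally have "unkron k D (kron k D (Poly_Mapping.single m c)) =
      Cst c * (Var k ^ Poly_Mapping.lookup m k * digit_monom k D b)"
    by (simp only: unkron_monom rhom_mult[OF rhom_emb] rhom_power[OF rhom_emb] emb_const emb_X mult.assoc)
  also have "\<dots> = Poly_Mapping.single m c"
    by (simp only: dm single_expand[of m] prod_A)
  finally show ?thesis .
qed

text \<open>Exponents below \<open>D\<close> are genuine digits, so each monomial can be read off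
  from its power of \<open>y\<close>.\<close>

lemma unkron_kron:
  assumes P: "mvars P \<subseteq> {k..}" "\<And>i. i > k \<Longrightarrow> vdeg i P < D"
  shows "unkron k D (kron k D P) = P"
proof -
  have "unkron k D (kron k D P) = unkron k D (kron k D
      (\<Sum>m\<in>Poly_Mapping.keys P. Poly_Mapping.single m (Poly_Mapping.lookup P m)))"
    by (simp only: poly_mapping_sum_singles)
  also have "\<dots> = (\<Sum>m\<in>Poly_Mapping.keys P. Poly_Mapping.single m (Poly_Mapping.lookup P m))"
    unfolding rhom_sum[OF rhom_kron] unkron_sum
  proof (rule sum.cong)
    fix m assume m: "m \<in> Poly_Mapping.keys P"
    show "unkron k D (kron k D (Poly_Mapping.single m (Poly_Mapping.lookup P m))) =
      Poly_Mapping.single m (Poly_Mapping.lookup P m)"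
    proof (rule unkron_kron_single)
      show "Poly_Mapping.keys m \<subseteq> {k..}" using P(1) m by (auto simp: mvars_def)
      show "Poly_Mapping.lookup m i < D" if "i > k" for i
        using lookup_le_vdeg[OF m, of i] P(2)[OF that] by simp
    qed
  qed simp
  finally show ?thesis by (simp only: poly_mapping_sum_singles)
qed

definition unkron1 :: "nat \<Rightarrow> nat \<Rightarrow> 'a::comm_ring_1 poly \<Rightarrow> 'a mpoly" where
  "unkron1 k D v = unkron k D (map_poly (\<lambda>c. [:c:]) v)"

lemma unkron1_smult: "unkron1 k D (smult c v) = Cst c * unkron1 k D v"
  by (simp add: unkron1_def map_poly_smult_rhom[OF rhom_pCons] unkron_smult emb_const)

lemma unkron1_const: "unkron1 k D [:c:] = Cst c"
  by (simp add: unkron1_def map_poly_const_rhom[OF rhom_pCons] unkron_def emb_const digit_monom_def)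

lemma spec_unkron: "spec k l (unkron k D u) = unkron1 k D (map_poly (\<lambda>c. poly c l) u)"
proof -
  have "degree (map_poly (\<lambda>c. [:c:]) (map_poly (\<lambda>c. poly c l) u)) \<le> degree u"
    by (rule degree_le) (simp add: coeff_map_poly coeff_eq_0)
  then show ?thesis
    by (simp add: unkron1_def unkron_superset[of _ "degree u"] rhom_sum[OF rhom_spec] rhom_mult[OF rhom_spec]
        spec_emb spec_digit_monom coeff_map_poly emb_const)
qed

lemma kron1_spec: "kron1 k D (spec k l P) = map_poly (\<lambda>c. poly c l) (kron k D P)"
  by (rule rhom_mpoly_eqI[OF rhom_comp[OF rhom_kron1 rhom_spec] rhom_comp[OF rhom_map_poly[OF rhom_poly] rhom_kron]])
     (simp_all add: spec_Cst spec_Var kron1_Cst kron1_Var kron_Cst kron_Var map_poly_pCons map_poly_monom_rhom[OF rhom_poly])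

lemma unkron1_kron1:
  assumes U: "mvars U \<subseteq> {k<..}" "\<And>i. i > k \<Longrightarrow> vdeg i U < D"
  shows "unkron1 k D (kron1 k D U) = U"
proof -
  have "map_poly (\<lambda>c. [:c:]) (kron1 k D U) = kron k D U"
    by (rule rhom_mpoly_eqI[OF rhom_comp[OF rhom_map_poly[OF rhom_pCons] rhom_kron1] rhom_kron])
       (use U(1) in \<open>auto simp: kron1_Cst kron1_Var kron_Cst kron_Var map_poly_pCons map_poly_monom_rhom[OF rhom_pCons] one_pCons\<close>)
  moreover have "mvars U \<subseteq> {k..}" using U(1) by auto
  ultimately show ?thesis using unkron_kron[of U k D] U(2) by (simp add: unkron1_def)
qed

section \<open>Factorizations after specialization and Kronecker's criterion\<close>

fun splits :: "'a::comm_monoid_mult list \<Rightarrow> ('a \<times> 'a) list" where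
  "splits [] = [(1, 1)]"
| "splits (g # gs) = map (\<lambda>(u, w). (g * u, w)) (splits gs) @ map (\<lambda>(u, w). (u, g * w)) (splits gs)"

lemma splits_prod: "(u, w) \<in> set (splits gs) \<Longrightarrow> u * w = prod_list gs"
  by (induction gs arbitrary: u w) (auto simp: mult_ac)

text \<open>Each prime \<open>f g\<close> goes to one of the two factors. The pair
  \<open>(a, b)\<close> is formed before \<open>f\<close> is applied, so finitely many pairs over
  \<open>K[\<lambda>]\<close> serve all specializations \<open>f\<close> at once.\<close>

lemma splits_factorization:
  fixes f :: "'a::comm_ring_1 \<Rightarrow> 'k::field_gcd poly"
  assumes f: "rhom f" and "\<And>g. g \<in> set gs \<Longrightarrow> prime_elem (f g)"
    and "u * v = smult c (prod_list (map f gs))" "c \<noteq> 0"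
  shows "\<exists>(a, b)\<in>set (splits gs). \<exists>d e. d \<noteq> 0 \<and> e \<noteq> 0 \<and> u = smult d (f a) \<and> v = smult e (f b)"
  using assms(2-)
proof (induction gs arbitrary: u v)
  case Nil
  then have uv: "u * v = [:c:]" by simp
  then have "degree u + degree v = 0" using Nil.prems(3) degree_mult_eq[of u v] by (cases "u = 0 \<or> v = 0") auto
  then obtain x y where xy: "u = [:x:]" "v = [:y:]" by (metis add_is_0 degree_eq_zeroE)
  then have "x \<noteq> 0" "y \<noteq> 0" using uv Nil.prems(3) by auto
  then show ?case using xy by (auto simp: rhom_1[OF f] intro!: exI[of _ x] exI[of _ y])
next
  case (Cons g gs)
  have pr: "prime_elem (f g)" and g0: "f g \<noteq> 0" using Cons.prems(1)[of g] by auto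
  have eq: "u * v = f g * smult c (prod_list (map f gs))" using Cons.prems(2) by simp
  then have "f g dvd u * v" by (metis dvd_triv_left)
  then consider u' where "u = f g * u'" | v' where "v = f g * v'"
    using prime_elem_dvd_multD[OF pr] by (blast elim: dvdE)
  then show ?case
  proof cases
    case 1
    then have "u' * v = smult c (prod_list (map f gs))" using eq g0 by (simp add: mult.assoc del: mult_smult_right)
    from Cons.IH[OF _ this Cons.prems(3)] Cons.prems(1) obtain a b d e where
      "(a, b) \<in> set (splits gs)" "d \<noteq> 0" "e \<noteq> 0" "u' = smult d (f a)" "v = smult e (f b)" by auto
    moreover from this have "(g * a, b) \<in> set (splits (g # gs))" by force
    moreover have "u = smult d (f (g * a))" using 1 calculation by (simp add: rhom_mult[OF f])
    ultimately show ?thesis by blast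
  next
    case 2
    then have "u * v' = smult c (prod_list (map f gs))" using eq g0 by (simp add: mult.left_commute del: mult_smult_right)
    from Cons.IH[OF _ this Cons.prems(3)] Cons.prems(1) obtain a b d e where
      "(a, b) \<in> set (splits gs)" "d \<noteq> 0" "e \<noteq> 0" "u = smult d (f a)" "v' = smult e (f b)" by auto
    moreover from this have "(a, g * b) \<in> set (splits (g # gs))" by force
    moreover have "v = smult e (f (g * b))" using 2 calculation by (simp add: rhom_mult[OF f])
    ultimately show ?thesis by blast
  qed
qed

text \<open>Unique factorization, with the primes that are constant in \<open>y\<close> collected in
  \<open>d\<close>, so that the others have the positive degree required by
  \<open>sep_hilb_irreducible\<close>.\<close>

lemma poly_poly_factorization:
  fixes F :: "'k::field_gcd poly poly"
  assumes "F \<noteq> 0"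
  shows "\<exists>d gs. d \<noteq> 0 \<and> F = smult d (prod_list gs) \<and> (\<forall>g\<in>set gs. irreducible g \<and> degree g > 0)"
  using assms
proof (induction F rule: prime_divisors_induct)
  case zero
  then show ?case by simp
next
  case (unit F)
  then obtain d where "F = [:d:]" by (metis degree_eq_zeroE degree_unit)
  with unit show ?case by (intro exI[of _ d] exI[of _ "[]"]) auto
next
  case (factor q F)
  then obtain d gs where F: "d \<noteq> 0" "F = smult d (prod_list gs)" "\<And>g. g \<in> set gs \<Longrightarrow> irreducible g \<and> degree g > 0"
    by auto
  have q: "irreducible q" using factor by (simp add: prime_elem_imp_irreducible prime_imp_prime_elem)
  show ?case
  proof (cases "degree q = 0")
    case True
    then obtain c where "q = [:c:]" by (metis degree_eq_zeroE)
    moreover from this have "c \<noteq> 0" using q by auto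
    ultimately show ?thesis using F by (intro exI[of _ "c * d"] exI[of _ gs]) (auto simp: mult.commute)
  next
    case False
    then show ?thesis using F q by (intro exI[of _ d] exI[of _ "q # gs"]) auto
  qed
qed

lemma vdeg_spec_le:
  assumes "j \<noteq> k"
  shows "vdeg j (spec k l p) \<le> vdeg j p"
proof -
  have "split_var j (spec k l p) = map_poly (spec k l) (split_var j p)"
    by (rule rhom_mpoly_eqI[OF rhom_comp[OF rhom_split_var rhom_spec] rhom_comp[OF rhom_map_poly[OF rhom_spec] rhom_split_var]])
       (use assms in \<open>auto simp: spec_Cst spec_Var split_var_def meval_Cst meval_Var[OF rhom_const_Cst]
          map_poly_pCons rhom_0[OF rhom_spec] rhom_1[OF rhom_spec]\<close>)
  then show ?thesis
    unfolding vdeg_def by (auto intro!: degree_le simp: coeff_map_poly coeff_eq_0 rhom_0[OF rhom_spec])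
qed

text \<open>
  Kronecker's criterion: a proper factorization of the specialized polynomial comes from a
  distribution \<open>(u, w)\<close> of the irreducible factors of the substituted polynomial, and the
  product of the multivariate polynomials that correspond to \<open>u\<close> and \<open>w\<close> differs from \<open>P\<close>, since \<open>P\<close>
  is irreducible.
\<close>

lemma kronecker_step:
  fixes P :: "'k::field_gcd mpoly"
  assumes P: "irreducible P" "mvars P \<subseteq> {k..}" and i: "i > k" "i \<in> mvars P"
  obtains gs Qs where "finite gs" "\<And>g. g \<in> gs \<Longrightarrow> irreducible g \<and> degree g > 0"
    "finite Qs" "0 \<notin> Qs"
    "\<And>l. \<lbrakk>\<And>g. g \<in> gs \<Longrightarrow> irreducible (map_poly (\<lambda>c. poly c l) g);
           \<And>Q. Q \<in> Qs \<Longrightarrow> spec k l Q \<noteq> 0\<rbrakk> \<Longrightarrow> irreducible (spec k l P)"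
proof -
  have P0: "P \<noteq> 0" using P by auto
  \<comment> \<open>Strictly above all degrees of \<open>P\<close>, and thereby of all factors of
    its specialization; the second \<open>Suc\<close> secures \<open>D \<ge> 2\<close>.\<close>
  define D where "D = Suc (Suc (\<Sum>i\<in>mvars P. vdeg i P))"
  have D2: "D \<ge> 2" by (simp add: D_def)
  have vD: "vdeg j P < D" for j
  proof (cases "j \<in> mvars P")
    case True
    then have "vdeg j P \<le> (\<Sum>i\<in>mvars P. vdeg i P)" by (intro member_le_sum) (auto simp: finite_mvars)
    then show ?thesis by (simp add: D_def)
  next
    case False
    then show ?thesis using D2 by (simp add: vdeg_eq_0_iff[THEN iffD2])
  qed
  have uk: "unkron k D (kron k D P) = P" using P(2) vD by (rule unkron_kron)
  then have "kron k D P \<noteq> 0" using P0 unkron_0 by metis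
  then obtain d gs where d: "d \<noteq> 0" and fac: "kron k D P = smult d (prod_list gs)"
    and gs: "\<And>g. g \<in> set gs \<Longrightarrow> irreducible g \<and> degree g > 0"
    using poly_poly_factorization by metis
  define Z where "Z = (\<lambda>(u, w). emb k d * (unkron k D u * unkron k D w))"
  \<comment> \<open>Three kinds of conditions: \<open>d\<close> must not vanish at \<open>l\<close>,
    the indeterminate \<open>X_i\<close> must survive, and no product from a proper distribution may
    coincide with \<open>P\<close> after specialization.\<close>
  define Qs where "Qs = insert (emb k d) (insert (P - spec i 0 P)
     ((\<lambda>x. Z x - P) ` {x \<in> set (splits gs). degree (fst x) > 0 \<and> degree (snd x) > 0}))"
  show thesis
  proof (rule that[of "set gs" Qs])
    show "finite Qs" by (simp add: Qs_def)
    \<comment> \<open>One factor of the irreducible \<open>P\<close> would be a unit, and so would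
      its image under \<open>kron\<close>, against the positive degrees in \<open>y\<close>.\<close>
    have "Z (u, w) \<noteq> P" if "(u, w) \<in> set (splits gs)" and deg: "degree u > 0" "degree w > 0" for u w
    proof
      assume "Z (u, w) = P"
      then have eq: "P = (emb k d * unkron k D u) * unkron k D w" by (simp add: Z_def mult.assoc)
      have "emb k d * unkron k D u dvd 1 \<or> unkron k D w dvd 1" using P(1) eq by (rule irreducibleD)
      then show False
      proof
        assume "emb k d * unkron k D u dvd 1"
        from rhom_unit[OF rhom_kron this, of k D] have "smult d u dvd 1"
          by (simp add: rhom_mult[OF rhom_kron] kron_emb kron_unkron[OF D2])
        then show False using degree_unit[of "smult d u"] d deg by simp
      next
        assume "unkron k D w dvd 1"
        from rhom_unit[OF rhom_kron this, of k D] have "w dvd 1" by (simp add: kron_unkron[OF D2])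
        then show False using degree_unit[of w] deg by simp
      qed
    qed
    moreover have "emb k d \<noteq> 0"
      using kron_emb[of k D d] d rhom_0[OF rhom_kron] by (metis pCons_eq_0_iff)
    moreover have "P - spec i 0 P \<noteq> 0" using i spec_eq_self_iff[of i 0 P] by auto
    ultimately show "0 \<notin> Qs" by (auto simp: Qs_def)
    fix l
    assume irr: "\<And>g. g \<in> set gs \<Longrightarrow> irreducible (map_poly (\<lambda>c. poly c l) g)"
      and Q: "\<And>Q. Q \<in> Qs \<Longrightarrow> spec k l Q \<noteq> 0"
    let ?ev = "map_poly (\<lambda>c. poly c l)"
    note ev = rhom_map_poly[OF rhom_poly[of l]]
    have "spec k l (emb k d) \<noteq> 0" by (rule Q) (simp add: Qs_def)
    then have dl: "poly d l \<noteq> 0" by (auto simp: spec_emb)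
    have nvar: "i \<in> mvars (spec k l P)"
    proof -
      have "spec k l (P - spec i 0 P) \<noteq> 0" by (rule Q) (simp add: Qs_def)
      then have "spec i 0 (spec k l P) \<noteq> spec k l P"
        using i spec_commute[of i k 0 l P] by (simp add: rhom_diff[OF rhom_spec])
      then show ?thesis using spec_eq_self_iff by blast
    qed
    have facl: "kron1 k D (spec k l P) = smult (poly d l) (prod_list (map ?ev gs))"
      by (simp add: kron1_spec fac map_poly_smult_rhom[OF rhom_poly] rhom_prod_list[OF ev])
    show "irreducible (spec k l P)"
    proof (rule irreducibleI)
      show S0: "spec k l P \<noteq> 0" using nvar by auto
      show "\<not> spec k l P dvd 1"
      proof
        assume "spec k l P dvd 1"
        then obtain R where R: "1 = spec k l P * R" by (rule dvdE)
        then have "R \<noteq> 0" by auto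
        then have "mvars (spec k l P) \<subseteq> mvars (1 :: 'k mpoly)" unfolding R using mvars_mult[OF S0] by simp
        then show False using nvar mvars_Cst[of "1::'k"] by auto
      qed
      fix U V assume UV: "spec k l P = U * V"
      have UV0: "U \<noteq> 0" "V \<noteq> 0" using UV S0 by auto
      have bnd: "mvars W \<subseteq> {k<..}" "vdeg j W < D" if "W = U \<or> W = V" for W j
      proof -
        have "mvars W \<subseteq> mvars (spec k l P)" unfolding UV using mvars_mult[OF UV0] that by auto
        also have "\<dots> \<subseteq> {k<..}"
        proof
          fix x assume "x \<in> mvars (spec k l P)"
          then have "x \<in> mvars P" "x \<noteq> k" using mvars_spec[of k l P] by auto
          moreover from this have "k \<le> x" using P(2) by auto
          ultimately show "x \<in> {k<..}" by simp
        qed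
        finally show "mvars W \<subseteq> {k<..}" .
        have "vdeg j W \<le> vdeg j (spec k l P)" unfolding UV using vdeg_mult[OF UV0, of j] that by auto
        also have "\<dots> \<le> vdeg j P"
        proof (cases "j = k")
          case True
          then have "vdeg j (spec k l P) = 0" using mvars_spec[of k l P] by (auto simp: vdeg_eq_0_iff)
          then show ?thesis by simp
        next
          case False
          show ?thesis by (rule vdeg_spec_le[OF False])
        qed
        finally show "vdeg j W < D" using vD[of j] by simp
      qed
      \<comment> \<open>The degrees of \<open>U\<close> and \<open>V\<close> stay below
        \<open>D\<close>, so both factors can be recovered from their images in
        \<open>K[y]\<close>.\<close>
      have inv: "unkron1 k D (kron1 k D W) = W" if "W = U \<or> W = V" for W
        by (rule unkron1_kron1) (use bnd that in auto)
      have "kron1 k D U * kron1 k D V = smult (poly d l) (prod_list (map ?ev gs))"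
        using facl unfolding UV by (simp add: rhom_mult[OF rhom_kron1])
      then obtain a b x y where ab: "(a, b) \<in> set (splits gs)" "x \<noteq> 0" "y \<noteq> 0"
        "kron1 k D U = smult x (?ev a)" "kron1 k D V = smult y (?ev b)"
        using splits_factorization[OF ev, of gs "kron1 k D U" "kron1 k D V" "poly d l"] irr dl
        by (fastforce simp: irreducible_imp_prime_elem)
      have const: "W dvd 1" if W: "W = U \<or> W = V" and e: "kron1 k D W = smult z (?ev c)" "degree c = 0" for W z c
      proof -
        obtain c' where "c = [:c':]" using e(2) by (metis degree_eq_zeroE)
        then have "kron1 k D W = [:z * poly c' l:]" using e(1) by (simp add: map_poly_const_rhom[OF rhom_poly])
        then obtain t where eq: "W = Cst t" using inv[OF W] unkron1_const by metis
        then have "t \<noteq> 0" using W UV0 by auto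
        then have "Cst t * Cst (inverse t) = 1" by (simp add: mult_single)
        then show ?thesis unfolding eq by (metis dvdI)
      qed
      show "U dvd 1 \<or> V dvd 1"
      proof (rule ccontr)
        assume "\<not> (U dvd 1 \<or> V dvd 1)"
        then have deg: "degree a > 0" "degree b > 0" using const ab(4,5) by blast+
        have u: "U = Cst x * spec k l (unkron k D a)"
          using inv[of U] unfolding ab(4) by (simp add: unkron1_smult spec_unkron)
        have v: "V = Cst y * spec k l (unkron k D b)"
          using inv[of V] unfolding ab(5) by (simp add: unkron1_smult spec_unkron)
        have evab: "?ev a * ?ev b = prod_list (map ?ev gs)"
          using arg_cong[OF splits_prod[OF ab(1)], of ?ev] by (simp add: rhom_mult[OF ev] rhom_prod_list[OF ev])
        \<comment> \<open>Comparing constants gives \<open>x * y = d(l)\<close>, exactly the scalar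
          that makes \<open>U * V\<close> the specialization of \<open>Z (a, b)\<close>.\<close>
        have "smult (x * y) (prod_list (map ?ev gs)) = smult (poly d l) (prod_list (map ?ev gs))"
        proof -
          have "smult (x * y) (prod_list (map ?ev gs)) = kron1 k D U * kron1 k D V"
            unfolding ab(4,5) evab[symmetric] by (simp add: mult.commute)
          then show ?thesis unfolding facl[symmetric] UV rhom_mult[OF rhom_kron1] .
        qed
        moreover have "prod_list (map ?ev gs) \<noteq> 0"
        proof
          assume "prod_list (map ?ev gs) = 0"
          then obtain g where "g \<in> set gs" "?ev g = 0" by (auto simp: prod_list_zero_iff)
          then show False using irr[of g] by simp
        qed
        moreover have "c = c'" if "smult c q = smult c' q" "q \<noteq> 0" for c c' :: 'k and q
        proof -
          have "smult (c - c') q = 0" by (simp only: smult_diff_left that(1) diff_self)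
          then show ?thesis using that(2) by simp
        qed
        ultimately have "x * y = poly d l" by blast
        then have "Cst x * Cst y = spec k l (emb k d)" by (simp add: mult_single spec_emb)
        then have "spec k l P = spec k l (Z (a, b))"
          unfolding UV u v by (simp add: Z_def rhom_mult[OF rhom_spec] mult_ac)
        moreover have "spec k l (Z (a, b) - P) \<noteq> 0"
          by (rule Q) (use ab(1) deg in \<open>auto simp: Qs_def image_iff intro!: bexI[of _ "(a, b)"]\<close>)
        ultimately show False by (simp add: rhom_diff[OF rhom_spec])
      qed
    qed
  qed (use gs in auto)
qed

text \<open>The Kronecker conditions of all \<open>P\<close> are united and met by one value. The
  free parameter is \<open>l\<close> in \<open>a + b * l\<close>, which encodes the
  congruence.\<close>

lemma specialize_one:
  fixes A :: "'k::field_gcd set"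
  assumes hilb: "sep_hilb A" and A: "fraction_subring A"
    and imp: "CHAR('k) > 0 \<Longrightarrow> range (\<lambda>x::'k. x ^ CHAR('k)) \<noteq> UNIV"
    and Ps: "finite Ps" "\<And>P. P \<in> Ps \<Longrightarrow> irreducible P \<and> mvars P \<subseteq> {k..} \<and> (\<exists>i>k. i \<in> mvars P)"
    and Qs: "finite Qs" "0 \<notin> Qs" and b: "b \<noteq> 0"
  obtains l where "l \<in> A" "\<And>P. P \<in> Ps \<Longrightarrow> irreducible (spec k (a + b * l) P)"
    "\<And>Q. Q \<in> Qs \<Longrightarrow> spec k (a + b * l) Q \<noteq> 0"
proof -
  define good where "good P r \<longleftrightarrow> (case r of (gs, Qs) \<Rightarrow> finite gs \<and> (\<forall>g\<in>gs. irreducible g \<and> degree g > 0) \<and>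
      finite Qs \<and> 0 \<notin> Qs \<and> (\<forall>l. (\<forall>g\<in>gs. irreducible (map_poly (\<lambda>c. poly c l) g)) \<longrightarrow>
      (\<forall>Q\<in>Qs. spec k l Q \<noteq> 0) \<longrightarrow> irreducible (spec k l P)))"
    for P :: "'k mpoly" and r :: "'k poly poly set \<times> 'k mpoly set"
  have "\<exists>r. good P r" if P: "P \<in> Ps" for P
  proof -
    obtain i where i: "i > k" "i \<in> mvars P" using Ps(2)[OF P] by blast
    have P': "irreducible P" "mvars P \<subseteq> {k..}" using Ps(2)[OF P] by auto
    show ?thesis
    proof (rule kronecker_step[OF P' i])
      fix gs Qs
      assume K: "finite gs" "\<And>g. g \<in> gs \<Longrightarrow> irreducible g \<and> degree g > 0" "finite Qs" "0 \<notin> Qs"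
        "\<And>l. \<lbrakk>\<And>g. g \<in> gs \<Longrightarrow> irreducible (map_poly (\<lambda>c. poly c l) g);
               \<And>Q. Q \<in> Qs \<Longrightarrow> spec k l Q \<noteq> 0\<rbrakk> \<Longrightarrow> irreducible (spec k l P)"
      have "good P (gs, Qs)" unfolding good_def prod.case
        by (intro conjI ballI allI impI K) blast+
      then show ?thesis by blast
    qed
  qed
  then obtain R where R: "\<And>P. P \<in> Ps \<Longrightarrow> good P (R P)" by metis
  define gs where "gs = (\<Union>P\<in>Ps. fst (R P))"
  define Qs' where "Qs' = Qs \<union> (\<Union>P\<in>Ps. snd (R P))"
  have R': "finite (fst (R P))" "finite (snd (R P))" "0 \<notin> snd (R P)"
    "\<And>g. g \<in> fst (R P) \<Longrightarrow> irreducible g \<and> degree g > 0" if "P \<in> Ps" for P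
    using R[OF that] by (auto simp: good_def split: prod.splits)
  have gs_fin: "finite gs" unfolding gs_def by (rule finite_UN_I[OF Ps(1)]) (rule R'(1))
  have gs: "irreducible g \<and> degree g > 0" if g: "g \<in> gs" for g
  proof -
    obtain P where "P \<in> Ps" "g \<in> fst (R P)" using g unfolding gs_def by blast
    then show ?thesis by (rule R'(4))
  qed
  have "finite (\<Union>P\<in>Ps. snd (R P))" by (rule finite_UN_I[OF Ps(1)]) (rule R'(2))
  then have Qs': "finite Qs'" "0 \<notin> Qs'" using R'(3) Qs by (auto simp: Qs'_def)
  define B where "B = (\<Union>Q\<in>Qs'. {l. spec k l Q = 0})"
  have "finite {l. spec k l Q = 0}" if "Q \<in> Qs'" for Q
    using finite_spec_zeros[of Q k] Qs'(2) that by metis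
  then have B: "finite B" using Qs'(1) by (auto simp: B_def)
  define gp where "gp = (\<Prod>x\<in>B. [:- x, 1:])"
  have "gp \<noteq> 0" using B by (simp add: gp_def)
  from sep_hilb_irreducible_congruence[OF hilb A imp gs_fin gs this b]
  obtain l where l: "l \<in> A" "poly gp (a + b * l) \<noteq> 0"
    "\<And>g. g \<in> gs \<Longrightarrow> irreducible (map_poly (\<lambda>c. poly c (a + b * l)) g)" by blast
  have "a + b * l \<notin> B" using l(2) B by (auto simp: gp_def poly_prod)
  then have Q: "spec k (a + b * l) Q \<noteq> 0" if "Q \<in> Qs'" for Q using that by (auto simp: B_def)
  show thesis
  proof (rule that[OF l(1)])
    show "spec k (a + b * l) Q \<noteq> 0" if "Q \<in> Qs" for Q using Q that by (simp add: Qs'_def)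
    fix P assume P: "P \<in> Ps"
    obtain gs1 Qs1 where r: "R P = (gs1, Qs1)" by (cases "R P")
    have "g \<in> gs" if "g \<in> gs1" for g using P r that by (force simp: gs_def)
    moreover have "Q \<in> Qs'" if "Q \<in> Qs1" for Q using P r that by (force simp: Qs'_def)
    ultimately show "irreducible (spec k (a + b * l) P)"
      using R[OF P] l(3) Q unfolding r good_def by simp
  qed
qed

section \<open>Successive specialization\<close>

definition specs :: "nat \<Rightarrow> (nat \<Rightarrow> 'a::comm_ring_1) \<Rightarrow> 'a mpoly \<Rightarrow> 'a mpoly" where
  "specs n lam = meval Cst (\<lambda>i. if i \<in> {1..n} then Cst (lam i) else Var i)"

lemma rhom_specs: "rhom (specs n lam)"
  unfolding specs_def by (rule rhom_meval[OF rhom_Cst])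

lemma specs_Cst: "specs n lam (Cst c) = Cst c"
  by (simp add: specs_def meval_Cst)

lemma specs_Var: "specs n lam (Var i) = (if i \<in> {1..n} then Cst (lam i) else Var i)"
  by (simp add: specs_def meval_Var[OF rhom_Cst])

lemma mvars_specs: "mvars (specs n lam p) \<subseteq> mvars p - {1..n}"
proof
  fix x assume "x \<in> mvars (specs n lam p)"
  then obtain i where "i \<in> mvars p" "x \<in> mvars ((if i \<in> {1..n} then Cst (lam i) else Var i) :: 'a mpoly)"
    unfolding specs_def using mvars_meval[of Cst "\<lambda>i. if i \<in> {1..n} then Cst (lam i) else Var i" p] by auto
  then show "x \<in> mvars p - {1..n}" by (auto split: if_splits)
qed

lemma specs_0: "specs 0 lam p = p"
  by (rule rhom_mpoly_eqI[OF rhom_specs rhom_id]) (simp_all add: specs_Cst specs_Var)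

lemma specs_Suc: "specs (Suc n) lam p = spec (Suc n) (lam (Suc n)) (specs n lam p)"
  by (rule rhom_mpoly_eqI[OF rhom_specs rhom_comp[OF rhom_spec rhom_specs]])
     (auto simp: specs_Cst specs_Var spec_Cst spec_Var le_Suc_eq)

lemma specs_cong: "(\<And>i. i \<in> {1..n} \<Longrightarrow> lam i = lam' i) \<Longrightarrow> specs n lam p = specs n lam' p"
  by (rule rhom_mpoly_eqI[OF rhom_specs rhom_specs]) (auto simp: specs_Cst specs_Var)

lemma specs_spec_commute: "i > n \<Longrightarrow> specs n lam (spec i x p) = spec i x (specs n lam p)"
  by (rule rhom_mpoly_eqI[OF rhom_comp[OF rhom_specs rhom_spec] rhom_comp[OF rhom_spec rhom_specs]])
     (auto simp: specs_Cst specs_Var spec_Cst spec_Var)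

lemma specs_eq_eval:
  "mvars p \<subseteq> {1..n} \<Longrightarrow> specs n lam p = Cst (mpoly_eval lam p)"
  by (rule rhom_mpoly_eqI[OF rhom_specs rhom_comp[OF rhom_Cst rhom_mpoly_eval]])
     (auto simp: specs_Cst specs_Var mpoly_eval_conv meval_Cst meval_Var[OF rhom_id])

lemma Fract_1_eq: "to_frac = (to_fract :: 'a::idom \<Rightarrow> 'a fract)"
  by (simp add: to_fract_def fun_eq_iff)

lemma rhom_to_fract: "rhom (to_fract :: 'a::idom \<Rightarrow> 'a fract)"
  by (simp add: rhom_def)

lemma fraction_subring_range: "fraction_subring (range (to_fract :: 'a::idom \<Rightarrow> 'a fract))"
  unfolding fraction_subring_def
proof (intro conjI ballI allI)
  show "1 \<in> range (to_fract :: 'a \<Rightarrow> 'a fract)" by (metis rangeI to_fract_1)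
  fix x y :: "'a fract" assume "x \<in> range to_fract" "y \<in> range to_fract"
  then show "x + y \<in> range to_fract" "x * y \<in> range to_fract"
    by (auto simp flip: to_fract_add to_fract_mult)
next
  fix k :: "'a fract"
  obtain a b where "k = to_fract a / to_fract b" "b \<noteq> 0"
    by (cases k) (auto simp: Fract_conv_to_fract)
  then show "\<exists>a\<in>range to_fract. \<exists>b\<in>range to_fract. b \<noteq> 0 \<and> k = a / b" by auto
qed

lemma specialize_all:
  fixes l0 :: "'a::idom" and a :: "nat \<Rightarrow> 'a"
  assumes hilb: "sep_hilb (range (to_fract :: 'a \<Rightarrow> 'a fract))"
    and imp: "CHAR('a fract) > 0 \<Longrightarrow> range (\<lambda>x::'a fract. x ^ CHAR('a fract)) \<noteq> UNIV"
    and Ps: "finite Ps" "\<And>P. P \<in> Ps \<Longrightarrow> irreducible P \<and> mvars P \<subseteq> {1..} \<and> (\<exists>i>r. i \<in> mvars P)"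
    and Qs: "finite Qs" "0 \<notin> Qs" and l0: "l0 \<noteq> 0"
  obtains l where "\<And>i. i \<in> {1..r} \<Longrightarrow> l i \<noteq> 0 \<and> l0 * (\<Prod>j\<in>{1..<i}. l j) dvd l i - a i"
    "\<And>P. P \<in> Ps \<Longrightarrow> irreducible (specs r (\<lambda>i. to_fract (l i)) P)"
    "\<And>Q. Q \<in> Qs \<Longrightarrow> specs r (\<lambda>i. to_fract (l i)) Q \<noteq> 0"
proof -
  obtain ip where ip: "\<And>P. P \<in> Ps \<Longrightarrow> ip P > r \<and> ip P \<in> mvars P" using Ps(2) by metis
  \<comment> \<open>Each \<open>P\<close> keeps an indeterminate of index above \<open>r\<close> as
    long as these differences stay nonzero; this is what allows the next Kronecker step.\<close>
  define Qs' where "Qs' = Qs \<union> (\<lambda>P. P - spec (ip P) 0 P) ` Ps"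
  have "P - spec (ip P) 0 P \<noteq> 0" if "P \<in> Ps" for P
    using ip[OF that] spec_eq_self_iff[of "ip P" 0 P] by auto
  then have Qs': "finite Qs'" "0 \<notin> Qs'" using Qs Ps(1) by (auto simp: Qs'_def)
  define S where "S n l \<longleftrightarrow> (\<forall>i\<in>{1..n}. l i \<noteq> 0 \<and> l0 * (\<Prod>j\<in>{1..<i}. l j) dvd l i - a i) \<and>
    (\<forall>P\<in>Ps. irreducible (specs n (\<lambda>i. to_fract (l i)) P)) \<and>
    (\<forall>Q\<in>Qs'. specs n (\<lambda>i. to_fract (l i)) Q \<noteq> 0)" for n l
  have "\<exists>l. S n l" if "n \<le> r" for n
    using that
  proof (induction n)
    case 0
    have "S 0 (\<lambda>_. 0)" using Ps Qs' by (auto simp: S_def specs_0)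
    then show ?case by blast
  next
    case (Suc n)
    then obtain l where l: "S n l" by auto
    \<comment> \<open>The modulus for the next coordinate; it is nonzero because the coordinates
      chosen so far are.\<close>
    define b where "b = l0 * (\<Prod>j\<in>{1..n}. l j)"
    have b: "b \<noteq> 0" using l l0 by (simp add: b_def S_def)
    let ?sp = "specs n (\<lambda>i. to_fract (l i))"
    have 1: "irreducible P \<and> mvars P \<subseteq> {Suc n..} \<and> (\<exists>i>Suc n. i \<in> mvars P)" if P: "P \<in> ?sp ` Ps" for P
    proof -
      obtain P' where P': "P' \<in> Ps" "P = ?sp P'" using P by blast
      have "?sp (P' - spec (ip P') 0 P') \<noteq> 0" using l P'(1) by (auto simp: S_def Qs'_def)
      then have "spec (ip P') 0 P \<noteq> P"
        using ip[OF P'(1)] Suc.prems by (simp add: rhom_diff[OF rhom_specs] specs_spec_commute P'(2))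
      then have "ip P' \<in> mvars P" using spec_eq_self_iff by blast
      moreover have "ip P' > r" using ip[OF P'(1)] by simp
      moreover have "mvars P \<subseteq> {Suc n..}"
      proof
        fix x assume "x \<in> mvars P"
        then have "x \<in> mvars P'" "x \<notin> {1..n}" using mvars_specs[of n _ P'] P'(2) by blast+
        then show "x \<in> {Suc n..}" using Ps(2)[OF P'(1)] by auto
      qed
      moreover have "irreducible P" using l P' by (simp add: S_def)
      ultimately show ?thesis using Suc.prems by (meson Suc_le_lessD le_less_trans less_le_trans)
    qed
    \<comment> \<open>The indeterminate itself joins the polynomials that must not vanish, which
      makes the new coordinate nonzero.\<close>
    have 2: "0 \<notin> insert (Var (Suc n)) (?sp ` Qs')"
    proof -
      have "Var (Suc n) \<noteq> (0 :: 'a fract mpoly)" using mvars_Var[where 'a = "'a fract"] mvars_0 by (metis insert_not_empty)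
      then show ?thesis using l by (auto simp: S_def)
    qed
    have fin1: "finite (?sp ` Ps)" and fin2: "finite (insert (Var (Suc n)) (?sp ` Qs'))" and b': "to_fract b \<noteq> 0"
      using Ps(1) Qs'(1) b by simp_all
    obtain m where m: "m \<in> range (to_fract :: 'a \<Rightarrow> 'a fract)"
      "\<And>P. P \<in> ?sp ` Ps \<Longrightarrow> irreducible (spec (Suc n) (to_fract (a (Suc n)) + to_fract b * m) P)"
      "\<And>Q. Q \<in> insert (Var (Suc n)) (?sp ` Qs') \<Longrightarrow> spec (Suc n) (to_fract (a (Suc n)) + to_fract b * m) Q \<noteq> 0"
      using specialize_one[OF hilb fraction_subring_range imp fin1 1 fin2 2 b', where a = "to_fract (a (Suc n))"] by blast
    obtain m' where m': "m = to_fract m'" using m(1) by blast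
    define l' where "l' = l(Suc n := a (Suc n) + b * m')"
    have l'n: "to_fract (a (Suc n)) + to_fract b * m = to_fract (l' (Suc n))" by (simp add: l'_def m')
    have sp': "?sp Q = specs n (\<lambda>i. to_fract (l' i)) Q" for Q by (rule specs_cong) (simp add: l'_def)
    have "spec (Suc n) (to_fract (l' (Suc n))) (Var (Suc n)) \<noteq> 0" unfolding l'n[symmetric] by (rule m(3)) simp
    then have "l' (Suc n) \<noteq> 0" by (auto simp: spec_Var)
    moreover have "l0 * (\<Prod>j\<in>{1..<Suc n}. l' j) dvd l' (Suc n) - a (Suc n)"
    proof -
      have "(\<Prod>j\<in>{1..<Suc n}. l' j) = (\<Prod>j\<in>{1..n}. l j)" by (rule prod.cong) (auto simp: l'_def)
      then show ?thesis by (simp add: l'_def b_def)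
    qed
    moreover have "l' i \<noteq> 0 \<and> l0 * (\<Prod>j\<in>{1..<i}. l' j) dvd l' i - a i" if i: "i \<in> {1..n}" for i
    proof -
      have "(\<Prod>j\<in>{1..<i}. l' j) = (\<Prod>j\<in>{1..<i}. l j)" by (rule prod.cong) (use i in \<open>auto simp: l'_def\<close>)
      then show ?thesis using l i by (auto simp: l'_def S_def)
    qed
    moreover have "irreducible (specs (Suc n) (\<lambda>i. to_fract (l' i)) P)" if "P \<in> Ps" for P
      unfolding specs_Suc l'n[symmetric] sp'[symmetric] by (rule m(2)) (use that in blast)
    moreover have "specs (Suc n) (\<lambda>i. to_fract (l' i)) Q \<noteq> 0" if "Q \<in> Qs'" for Q
      unfolding specs_Suc l'n[symmetric] sp'[symmetric] by (rule m(3)) (use that in blast)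
    ultimately have "S (Suc n) l'" unfolding S_def by (auto simp: le_Suc_eq)
    then show ?case by blast
  qed
  then obtain l where "S r l" by blast
  then show thesis by (intro that[of l]) (auto simp: S_def Qs'_def)
qed

section \<open>The rings of the definition of Hilbert subsets\<close>

lemma mpoly_ring_simps [simp]:
  "p \<otimes>\<^bsub>mpoly_ring S n\<^esub> q = p * q" "\<one>\<^bsub>mpoly_ring S n\<^esub> = 1" "\<zero>\<^bsub>mpoly_ring S n\<^esub> = 0"
  by (simp_all add: mpoly_ring_def ring_of_type_algebra_def)

lemma carrier_mpoly_ring:
  "p \<in> carrier (mpoly_ring S n) \<longleftrightarrow> mvars p \<subseteq> {1..n} \<and> (\<forall>m. Poly_Mapping.lookup p m \<in> S)"
  by (auto simp: mpoly_ring_def mvars_def ring_of_type_algebra_def)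

text \<open>Irreducibility is defined by proper divisors in the carrier. If the cofactor
  \<open>c\<close> of a proper divisor \<open>b\<close> were a unit, \<open>a\<close> would divide
  \<open>b\<close>; so the hypothesis on factorizations makes \<open>b\<close> the unit.\<close>

lemma ring_irreducible_mpoly_ringI:
  assumes "a \<noteq> 0" "a \<notin> Units (mpoly_ring S n)"
    and "\<And>u v. u \<in> carrier (mpoly_ring S n) \<Longrightarrow> v \<in> carrier (mpoly_ring S n) \<Longrightarrow> a = u * v \<Longrightarrow>
      u \<in> Units (mpoly_ring S n) \<or> v \<in> Units (mpoly_ring S n)"
  shows "ring_irreducible\<^bsub>mpoly_ring S n\<^esub> a"
  unfolding ring_irreducible_def Divisibility.irreducible_def
proof (intro conjI ballI impI)
  fix b assume b: "b \<in> carrier (mpoly_ring S n)" "properfactor (mpoly_ring S n) b a"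
  then obtain c where c: "c \<in> carrier (mpoly_ring S n)" "a = b * c" and
    na: "\<not> (\<exists>d\<in>carrier (mpoly_ring S n). b = a * d)"
    by (auto simp: properfactor_def factor_def)
  have "c \<notin> Units (mpoly_ring S n)"
  proof
    assume "c \<in> Units (mpoly_ring S n)"
    then obtain d where d: "d \<in> carrier (mpoly_ring S n)" "c * d = 1" by (auto simp: Units_def)
    then have "b = a * d" using c by (simp add: mult.assoc)
    with na d show False by blast
  qed
  then show "b \<in> Units (mpoly_ring S n)" using assms(3)[OF b(1) c] by blast
qed (use assms in auto)

lemma ring_irreducible_mpoly_ringD:
  assumes "ring_irreducible\<^bsub>mpoly_ring S n\<^esub> a"
  shows "a \<noteq> 0" "a \<notin> Units (mpoly_ring S n)"
    and "\<lbrakk>u \<in> carrier (mpoly_ring S n); v \<in> carrier (mpoly_ring S n); 1 \<in> S; 0 \<in> S; a = u * v\<rbrakk> \<Longrightarrow>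
      u \<in> Units (mpoly_ring S n) \<or> v \<in> Units (mpoly_ring S n)"
proof -
  show a0: "a \<noteq> 0" and "a \<notin> Units (mpoly_ring S n)"
    using assms by (auto simp: ring_irreducible_def Divisibility.irreducible_def)
  assume u: "u \<in> carrier (mpoly_ring S n)" and v: "v \<in> carrier (mpoly_ring S n)" and S: "1 \<in> S" "0 \<in> S" and a: "a = u * v"
  show "u \<in> Units (mpoly_ring S n) \<or> v \<in> Units (mpoly_ring S n)"
  proof (cases "\<exists>d\<in>carrier (mpoly_ring S n). u = a * d")
    case True
    then obtain d where d: "d \<in> carrier (mpoly_ring S n)" "u = a * d" by blast
    have "u * (v * d) = u * 1" using d a by (simp add: mult.assoc)
    moreover have "u \<noteq> 0" using a a0 by auto
    ultimately have "v * d = 1" using mult_left_cancel by blast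
    then show ?thesis using v d(1) by (auto simp: Units_def mult.commute)
  next
    case False
    then have "properfactor (mpoly_ring S n) u a" using v a by (auto simp: properfactor_def factor_def)
    then show ?thesis using assms u by (auto simp: ring_irreducible_def Divisibility.irreducible_def)
  qed
qed

section \<open>Units of \<open>mpoly_ring\<close> and the field \<open>ratfuns r\<close>\<close>

lemma unit_mpoly:
  fixes u v :: "'a::idom mpoly"
  assumes "u * v = 1"
  shows "\<exists>c. u = Cst c" "mvars u = {}"
proof -
  have "u \<noteq> 0" "v \<noteq> 0" using assms by auto
  then have "mvars u \<union> mvars v = mvars (1 :: 'a mpoly)" using mvars_mult assms by metis
  then show "mvars u = {}" using mvars_Cst[of "1::'a"] by simp
  then show "\<exists>c. u = Cst c" using mvars_empty by blast
qed

lemma Units_mpoly_ringD: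
  assumes "u \<in> Units (mpoly_ring S n)"
  obtains c where "u = Cst c" "c \<in> S" "c \<noteq> 0"
proof -
  obtain v where v: "u * v = 1" and u: "u \<in> carrier (mpoly_ring S n)" using assms by (auto simp: Units_def)
  then obtain c where c: "u = Cst c" using unit_mpoly by blast
  moreover have "c \<in> S" using u c by (metis carrier_mpoly_ring lookup_single_eq)
  moreover have "c \<noteq> 0" using v c by auto
  ultimately show thesis by (rule that)
qed

lemma Cst_in_carrier: "c \<in> S \<Longrightarrow> 0 \<in> S \<Longrightarrow> Cst c \<in> carrier (mpoly_ring S n)"
  by (auto simp: carrier_mpoly_ring lookup_single when_def)

lemma Cst_in_Units:
  fixes c :: "'k::field"
  assumes "c \<in> S" "inverse c \<in> S" "0 \<in> S" "c \<noteq> 0"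
  shows "Cst c \<in> Units (mpoly_ring S n)"
  using assms Cst_in_carrier[of c S n] Cst_in_carrier[of "inverse c" S n]
  by (auto simp: Units_def mult_single intro!: bexI[of _ "Cst (inverse c)"])

lemma mvars_1 [simp]: "mvars (1 :: 'a::comm_ring_1 mpoly) = {}"
  using mvars_Cst[of "1::'a"] by simp

lemma ratfuns_iff:
  "c \<in> ratfuns r \<longleftrightarrow> (\<exists>p q. mvars p \<subseteq> {1..r} \<and> mvars q \<subseteq> {1..r} \<and> q \<noteq> 0 \<and> c = to_fract p / to_fract q)"
  by (auto simp: ratfuns_def carrier_mpoly_ring Fract_conv_to_fract)

lemma ratfuns_to_fract: "mvars p \<subseteq> {1..r} \<Longrightarrow> to_fract p \<in> ratfuns r"
  unfolding ratfuns_iff by (intro exI[of _ p] exI[of _ 1]) auto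

lemma ratfuns_0: "0 \<in> ratfuns r" and ratfuns_1: "1 \<in> ratfuns r"
  using ratfuns_to_fract[of 0 r] ratfuns_to_fract[of 1 r] by simp_all

lemma ratfuns_mult:
  assumes "c \<in> ratfuns r" "d \<in> ratfuns r"
  shows "c * d \<in> ratfuns r"
proof -
  obtain p q p' q' where *: "mvars p \<subseteq> {1..r}" "mvars q \<subseteq> {1..r}" "q \<noteq> 0" "c = to_fract p / to_fract q"
    "mvars p' \<subseteq> {1..r}" "mvars q' \<subseteq> {1..r}" "q' \<noteq> 0" "d = to_fract p' / to_fract q'"
    using assms unfolding ratfuns_iff by blast
  then have "c * d = to_fract (p * p') / to_fract (q * q')" by simp
  moreover have "mvars (p * p') \<subseteq> {1..r}" "mvars (q * q') \<subseteq> {1..r}"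
    using * mvars_mult_subset[of p p'] mvars_mult_subset[of q q'] by blast+
  ultimately show ?thesis using * unfolding ratfuns_iff by (intro exI[of _ "p * p'"] exI[of _ "q * q'"]) auto
qed

lemma ratfuns_inverse: "c \<in> ratfuns r \<Longrightarrow> inverse c \<in> ratfuns r"
proof (cases "c = 0")
  case False
  assume "c \<in> ratfuns r"
  then obtain p q where *: "mvars p \<subseteq> {1..r}" "mvars q \<subseteq> {1..r}" "q \<noteq> 0" "c = to_fract p / to_fract q"
    unfolding ratfuns_iff by blast
  with False have "p \<noteq> 0" "inverse c = to_fract q / to_fract p" by auto
  with * show ?thesis unfolding ratfuns_iff by blast
qed simp

lemma ratfuns_common_denominator:
  fixes C :: "'k::field mpoly fract set"
  assumes "finite C" "C \<subseteq> ratfuns r"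
  shows "\<exists>Q. Q \<noteq> 0 \<and> mvars Q \<subseteq> {1..r} \<and> (\<forall>c\<in>C. \<exists>p. mvars p \<subseteq> {1..r} \<and> to_fract Q * c = to_fract p)"
  using assms
proof (induction C rule: finite_induct)
  case empty
  then show ?case by (intro exI[of _ 1]) auto
next
  case (insert c C)
  then obtain Q where Q: "Q \<noteq> 0" "mvars Q \<subseteq> {1..r}"
    "\<And>c. c \<in> C \<Longrightarrow> \<exists>p. mvars p \<subseteq> {1..r} \<and> to_fract Q * c = to_fract p" by auto
  obtain p q where c: "mvars p \<subseteq> {1..r}" "mvars q \<subseteq> {1..r}" "q \<noteq> 0" "c = to_fract p / to_fract q"
    using insert.prems ratfuns_iff by blast
  have vars: "mvars (x * y) \<subseteq> {1..r}" if "mvars x \<subseteq> {1..r}" "mvars y \<subseteq> {1..r}" for x y :: "'k mpoly"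
    using mvars_mult_subset[of x y] that by blast
  show ?case
  proof (rule exI[of _ "Q * q"], intro conjI ballI)
    show "Q * q \<noteq> 0" "mvars (Q * q) \<subseteq> {1..r}" using Q c vars by auto
    fix d assume "d \<in> insert c C"
    then consider "d = c" | "d \<in> C" by blast
    then show "\<exists>p. mvars p \<subseteq> {1..r} \<and> to_fract (Q * q) * d = to_fract p"
    proof cases
      case 1
      then have "to_fract (Q * q) * d = to_fract (Q * p)" using c by simp
      then show ?thesis using vars Q(2) c(1) by blast
    next
      case 2
      then obtain p' where p': "mvars p' \<subseteq> {1..r}" "to_fract Q * d = to_fract p'" using Q(3) by blast
      then have "to_fract (Q * q) * d = to_fract (q * p')" by (simp add: mult_ac)
      then show ?thesis using vars c(2) p'(1) by blast
    qed
  qed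
qed

section \<open>Passage between \<open>K[\<lambda>, x]\<close> and
  \<open>K(\<lambda>)[x]\<close>\<close>

definition map_coeffs :: "('a::comm_ring_1 \<Rightarrow> 'b::comm_ring_1) \<Rightarrow> 'a mpoly \<Rightarrow> 'b mpoly" where
  "map_coeffs f = meval (\<lambda>c. Cst (f c)) Var"

lemma rhom_map_coeffs: "rhom f \<Longrightarrow> rhom (map_coeffs f)"
  unfolding map_coeffs_def by (intro rhom_meval rhom_comp[OF rhom_Cst])

lemma map_coeffs_Cst: "rhom f \<Longrightarrow> map_coeffs f (Cst c) = Cst (f c)"
  by (simp add: map_coeffs_def meval_Cst rhom_0)

lemma map_coeffs_Var: "rhom f \<Longrightarrow> map_coeffs f (Var i) = Var i"
  by (simp add: map_coeffs_def meval_Var rhom_comp[OF rhom_Cst])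

lemma lookup_map_coeffs:
  assumes "rhom f"
  shows "Poly_Mapping.lookup (map_coeffs f p) m = f (Poly_Mapping.lookup p m)"
proof -
  have "map_coeffs f p = (\<Sum>n\<in>Poly_Mapping.keys p. Poly_Mapping.single n (f (Poly_Mapping.lookup p n)))"
    unfolding map_coeffs_def meval_def by (intro sum.cong refl single_expand[symmetric])
  then show ?thesis
    by (simp add: lookup_sum lookup_single when_def in_keys_iff rhom_0[OF assms])
qed

lemma lookup_Cst_mult: "Poly_Mapping.lookup (Cst c * p) m = c * Poly_Mapping.lookup p m"
  for p :: "'a::comm_ring_1 mpoly"
  by (simp add: Poly_Mapping.map.rep_eq when_def flip: mult_map_scale_conv_mult)

lemma mvars_map_coeffs: "rhom f \<Longrightarrow> mvars (map_coeffs f p) \<subseteq> mvars p"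
  by (auto simp: mvars_def in_keys_iff lookup_map_coeffs) (metis in_keys_iff rhom_0)

text \<open>
  Both groups of indeterminates together: \<open>\<lambda>\<^sub>i\<close> is the indeterminate with index \<open>i\<close>, and \<open>x\<^sub>j\<close> the
  one with index \<open>r + j\<close>.
\<close>

definition nest :: "nat \<Rightarrow> 'a::comm_ring_1 mpoly \<Rightarrow> 'a mpoly mpoly" where
  "nest r = meval (\<lambda>c. Cst (Cst c)) (\<lambda>i. if i \<le> r then Cst (Var i) else Var (i - r))"

definition flatten :: "nat \<Rightarrow> 'a::comm_ring_1 mpoly mpoly \<Rightarrow> 'a mpoly" where
  "flatten r = meval (\<lambda>c. c) (\<lambda>j. Var (r + j))"

lemma rhom_Cst_Cst: "rhom (\<lambda>c::'a::comm_ring_1. Cst (Cst c) :: 'a mpoly mpoly)"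
  by (rule rhom_comp[OF rhom_Cst rhom_Cst])

lemma rhom_nest: "rhom (nest r)"
  unfolding nest_def by (rule rhom_meval[OF rhom_Cst_Cst])

lemma rhom_flatten: "rhom (flatten r)"
  unfolding flatten_def by (rule rhom_meval[OF rhom_id])

lemma nest_Cst: "nest r (Cst c) = Cst (Cst c)"
  by (simp add: nest_def meval_Cst)

lemma nest_Var: "nest r (Var i) = (if i \<le> r then Cst (Var i) else Var (i - r))"
  by (simp add: nest_def meval_Var[OF rhom_Cst_Cst])

lemma flatten_Cst: "flatten r (Cst c) = c"
  by (simp add: flatten_def meval_Cst)

lemma flatten_Var: "flatten r (Var j) = Var (r + j)"
  by (simp add: flatten_def meval_Var[OF rhom_id])

lemma nest_flatten:
  assumes "mvars f \<subseteq> {1..}" "\<And>m. mvars (Poly_Mapping.lookup f m) \<subseteq> {..r}"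
  shows "nest r (flatten r f) = f"
proof (rule rhom_mpoly_eqI[OF rhom_comp[OF rhom_nest rhom_flatten] rhom_id])
  fix m
  show "nest r (flatten r (Cst (Poly_Mapping.lookup f m))) = Cst (Poly_Mapping.lookup f m)"
    unfolding flatten_Cst
    by (rule rhom_mpoly_eqI[OF rhom_nest rhom_Cst]) (use assms(2)[of m] in \<open>auto simp: nest_Cst nest_Var\<close>)
next
  fix j assume "j \<in> mvars f"
  then show "nest r (flatten r (Var j)) = Var j" using assms(1) by (auto simp: flatten_Var nest_Var)
qed

lemma mvars_nest: "mvars p \<subseteq> {1..r + n} \<Longrightarrow> mvars (nest r p) \<subseteq> {1..n}"
proof
  fix x assume p: "mvars p \<subseteq> {1..r + n}" and "x \<in> mvars (nest r p)"
  then obtain i where i: "i \<in> mvars p" "x \<in> mvars ((if i \<le> r then Cst (Var i) else Var (i - r)) :: 'a mpoly mpoly)"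
    unfolding nest_def using mvars_meval[of "\<lambda>c. Cst (Cst c)" "\<lambda>i. if i \<le> r then Cst (Var i) else Var (i - r)" p] by auto
  then have "i > r" "x = i - r" by (auto split: if_splits)
  then show "x \<in> {1..n}" using p i(1) by auto
qed

lemma mvars_lookup_nest:
  assumes "mvars p \<subseteq> {1..}"
  shows "mvars (Poly_Mapping.lookup (nest r p) m) \<subseteq> {1..r}"
proof
  fix x assume x: "x \<in> mvars (Poly_Mapping.lookup (nest r p) m)"
  show "x \<in> {1..r}"
  proof (rule ccontr)
    assume nx: "x \<notin> {1..r}"
    \<comment> \<open>Setting \<open>X_x\<close> to zero inside the coefficients changes nothing for
      \<open>x\<close> outside \<open>{1..r}\<close>, so \<open>X_x\<close> occurs in no
      coefficient.\<close>
    have "map_coeffs (spec x 0) (nest r p) = nest r p"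
      by (rule rhom_mpoly_eqI[OF rhom_comp[OF rhom_map_coeffs[OF rhom_spec] rhom_nest] rhom_nest])
         (use assms nx in \<open>auto simp: nest_Cst nest_Var map_coeffs_Cst map_coeffs_Var rhom_spec spec_Cst spec_Var\<close>)
    then have "spec x 0 (Poly_Mapping.lookup (nest r p) m) = Poly_Mapping.lookup (nest r p) m"
      using lookup_map_coeffs[OF rhom_spec, of x 0 "nest r p" m] by simp
    then show False using x spec_eq_self_iff by blast
  qed
qed

definition nestf :: "nat \<Rightarrow> 'a::idom mpoly \<Rightarrow> 'a mpoly fract mpoly" where
  "nestf r p = map_coeffs to_fract (nest r p)"

lemma rhom_nestf: "rhom (nestf r)"
  unfolding nestf_def[abs_def] by (rule rhom_comp[OF rhom_map_coeffs[OF rhom_to_fract] rhom_nest])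

lemma nestf_carrier:
  fixes p :: "'k::field mpoly"
  assumes "mvars p \<subseteq> {1..r + n}"
  shows "nestf r p \<in> carrier (mpoly_ring (ratfuns r) n)"
proof -
  have "mvars (nestf r p) \<subseteq> {1..n}"
    unfolding nestf_def using mvars_map_coeffs[OF rhom_to_fract] mvars_nest[OF assms] by blast
  moreover have "mvars p \<subseteq> {1..}" using assms by auto
  ultimately show ?thesis
    unfolding carrier_mpoly_ring nestf_def lookup_map_coeffs[OF rhom_to_fract]
    using mvars_lookup_nest ratfuns_to_fract by blast
qed

lemma Cst_mult_carrier:
  assumes "c \<in> ratfuns r" "f \<in> carrier (mpoly_ring (ratfuns r) n)"
  shows "Cst c * f \<in> carrier (mpoly_ring (ratfuns r) n)"
proof -
  show ?thesis
    using assms mvars_mult_subset[of "Cst c" f] by (auto simp: carrier_mpoly_ring ratfuns_mult lookup_Cst_mult)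
qed

text \<open>
  Among the polynomials over \<open>K\<close> that are associated to \<open>f\<close> over \<open>K(\<lambda>)\<close>, one of least degree is
  irreducible, since a factor that is constant in \<open>x\<close> could be dropped.
\<close>

lemma irreducible_model:
  fixes f :: "'k::field mpoly fract mpoly"
  assumes f: "f \<in> carrier (mpoly_ring (ratfuns r) n)" "ring_irreducible\<^bsub>mpoly_ring (ratfuns r) n\<^esub> f"
  obtains P c where "irreducible P" "mvars P \<subseteq> {1..r + n}" "\<exists>i>r. i \<in> mvars P"
    "c \<in> ratfuns r" "c \<noteq> 0" "nestf r P = Cst c * f"
proof -
  let ?R = "mpoly_ring (ratfuns r :: 'k mpoly fract set) n"
  have f0: "f \<noteq> 0" and fU: "f \<notin> Units ?R" using ring_irreducible_mpoly_ringD(1,2)[OF f(2)] by auto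
  define model where "model P c \<longleftrightarrow> mvars P \<subseteq> {1..r + n} \<and> c \<in> ratfuns r \<and> c \<noteq> 0 \<and> nestf r P = Cst c * f" for P c
  have "\<exists>P c. model P c"
  proof -
    have C: "Poly_Mapping.lookup f ` Poly_Mapping.keys f \<subseteq> ratfuns r" using f(1) by (auto simp: carrier_mpoly_ring)
    obtain Q where Q: "Q \<noteq> 0" "mvars Q \<subseteq> {1..r}" and
      "\<forall>c\<in>Poly_Mapping.lookup f ` Poly_Mapping.keys f. \<exists>p. mvars p \<subseteq> {1..r} \<and> to_fract Q * c = to_fract p"
      using ratfuns_common_denominator[OF finite_imageI[OF finite_keys] C] by blast
    then have "\<forall>m\<in>Poly_Mapping.keys f. \<exists>p. mvars p \<subseteq> {1..r} \<and> to_fract Q * Poly_Mapping.lookup f m = to_fract p"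
      by blast
    from bchoice[OF this] obtain N where N: "\<And>m. m \<in> Poly_Mapping.keys f \<Longrightarrow>
        mvars (N m) \<subseteq> {1..r} \<and> to_fract Q * Poly_Mapping.lookup f m = to_fract (N m)" by blast
    define f0 where "f0 = (\<Sum>m\<in>Poly_Mapping.keys f. Poly_Mapping.single m (N m))"
    have l0: "Poly_Mapping.lookup f0 m = (if m \<in> Poly_Mapping.keys f then N m else 0)" for m
      by (simp add: f0_def lookup_sum lookup_single when_def)
    have "Poly_Mapping.keys f0 \<subseteq> Poly_Mapping.keys f" using l0 by (auto simp: in_keys_iff split: if_splits)
    then have v0: "mvars f0 \<subseteq> {1..n}" using f(1) by (fastforce simp: mvars_def carrier_mpoly_ring)
    have v0': "mvars (Poly_Mapping.lookup f0 m) \<subseteq> {1..r}" for m using N by (simp add: l0)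
    have "nest r (flatten r f0) = f0"
    proof (rule nest_flatten)
      show "mvars f0 \<subseteq> {1..}" using v0 by auto
      show "mvars (Poly_Mapping.lookup f0 m) \<subseteq> {..r}" for m using v0'[of m] by auto
    qed
    moreover have "map_coeffs to_fract f0 = Cst (to_fract Q) * f"
    proof (rule poly_mapping_eqI)
      fix m
      show "Poly_Mapping.lookup (map_coeffs to_fract f0) m = Poly_Mapping.lookup (Cst (to_fract Q) * f) m"
        using N[of m] by (simp add: lookup_map_coeffs[OF rhom_to_fract] lookup_Cst_mult l0 in_keys_iff)
    qed
    moreover have "mvars (flatten r f0) \<subseteq> {1..r + n}"
    proof
      fix x assume "x \<in> mvars (flatten r f0)"
      then consider m where "x \<in> mvars (Poly_Mapping.lookup f0 m)" | i where "i \<in> mvars f0" "x = r + i"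
        unfolding flatten_def using mvars_meval[of "\<lambda>c. c" "\<lambda>j. Var (r + j)" f0] by auto
      then show "x \<in> {1..r + n}" using v0 v0' by cases fastforce+
    qed
    ultimately have "model (flatten r f0) (to_fract Q)"
      using Q ratfuns_to_fract by (simp add: model_def nestf_def)
    then show ?thesis by blast
  qed
  \<comment> \<open>The measure of minimality: additive on products, and zero only on constants of
    \<open>K\<close> among polynomials in these indeterminates.\<close>
  define tdeg where "tdeg P = (\<Sum>i\<in>{1..r + n}. vdeg i P)" for P :: "'k mpoly"
  define P where "P = arg_min tdeg (\<lambda>P. \<exists>c. model P c)"
  obtain P1 where "\<exists>c. model P1 c" using \<open>\<exists>P c. model P c\<close> by blast
  then have "\<exists>c. model P c" unfolding P_def by (rule arg_min_natI)
  then obtain c where Pc: "mvars P \<subseteq> {1..r + n}" "c \<in> ratfuns r" "c \<noteq> 0" "nestf r P = Cst c * f"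
    by (auto simp: model_def)
  have min: "tdeg P \<le> tdeg U" if "model U d" for U d
    unfolding P_def by (rule arg_min_nat_le) (use that in blast)
  have inv: "Cst (inverse c) * (Cst c * g) = g" "Cst c * (Cst (inverse c) * g) = g" for g :: "'k mpoly fract mpoly"
    using Pc(3) by (simp_all add: mult_single flip: mult.assoc)
  have f_eq: "f = Cst (inverse c) * nestf r P" using inv(1)[of f] Pc(4) by simp
  have Cst0: "Cst c \<noteq> 0" using Pc(3) by (metis lookup_single_eq lookup_zero)
  then have "nestf r P \<noteq> 0" unfolding Pc(4) using f0 by simp
  then have P0: "P \<noteq> 0" using rhom_0[OF rhom_nestf] by metis
  have cst_unit: "Cst d \<in> Units ?R" if "d \<in> ratfuns r" "d \<noteq> 0" for d
    using that ratfuns_inverse ratfuns_0 by (intro Cst_in_Units) auto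
  \<comment> \<open>If \<open>V\<close> is constant in \<open>x\<close>, then \<open>U\<close> is
    again associated to \<open>f\<close> over \<open>K(\<lambda>)\<close>, so minimality leaves
    \<open>V\<close> no degree at all.\<close>
  have drop: "V dvd 1" if UV: "P = U * V" and x: "nestf r V = Cst x" "x \<in> ratfuns r" "x \<noteq> 0" for U V x
  proof -
    have UV0: "U \<noteq> 0" "V \<noteq> 0" using UV P0 by auto
    have vars: "mvars U \<subseteq> {1..r + n}" "mvars V \<subseteq> {1..r + n}" using mvars_mult[OF UV0] UV Pc(1) by auto
    have eq: "nestf r U * Cst x = Cst c * f" using Pc(4) UV x(1) by (simp add: rhom_mult[OF rhom_nestf])
    have "nestf r U * (Cst x * Cst (inverse x)) = Cst (inverse x) * (nestf r U * Cst x)"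
      by (simp only: mult_ac)
    also have "\<dots> = Cst (inverse x) * Cst c * f" unfolding eq by (simp only: mult.assoc)
    finally have "nestf r U = Cst (inverse x * c) * f"
      using x(3) by (simp add: mult_single)
    moreover have "inverse x * c \<in> ratfuns r" by (intro ratfuns_mult ratfuns_inverse x Pc)
    ultimately have "model U (inverse x * c)"
      using vars x Pc by (auto simp: model_def)
    then have "tdeg P \<le> tdeg U" by (rule min)
    moreover have "tdeg P = tdeg U + tdeg V"
      unfolding tdeg_def UV using UV0 by (simp add: vdeg_mult sum.distrib)
    ultimately have "tdeg V = 0" by simp
    then have "mvars V = {}" using vars by (fastforce simp: tdeg_def vdeg_eq_0_iff)
    then obtain v where v: "V = Cst v" using mvars_empty by blast
    then have "v \<noteq> 0" using UV0 by auto
    then have "V * Cst (inverse v) = 1" by (simp add: v mult_single)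
    then show ?thesis by (metis dvdI)
  qed
  have "irreducible P"
  proof (rule irreducibleI)
    show "\<not> P dvd 1"
    proof
      assume "P dvd 1"
      then obtain R where R: "P * R = 1" by (metis dvdE)
      obtain d where d: "P = Cst d" using unit_mpoly[OF R] by blast
      then have "d \<noteq> 0" using P0 by auto
      have "nestf r P = Cst (to_fract (Cst d))"
        by (simp add: nestf_def d nest_Cst map_coeffs_Cst[OF rhom_to_fract])
      then have "f = Cst (inverse c * to_fract (Cst d))" using f_eq by (simp add: mult_single)
      moreover have "inverse c * to_fract (Cst d) \<in> ratfuns r"
        using Pc(2) by (intro ratfuns_mult ratfuns_inverse ratfuns_to_fract) simp_all
      moreover have "inverse c * to_fract (Cst d) \<noteq> 0" using Pc(3) P0 d by simp
      ultimately show False using fU cst_unit by blast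
    qed
    fix U V assume UV: "P = U * V"
    have UV0: "U \<noteq> 0" "V \<noteq> 0" using UV P0 by auto
    have vars: "mvars U \<subseteq> {1..r + n}" "mvars V \<subseteq> {1..r + n}" using mvars_mult[OF UV0] UV Pc(1) by auto
    have "f = (Cst (inverse c) * nestf r U) * nestf r V"
      unfolding f_eq UV by (simp add: rhom_mult[OF rhom_nestf] mult.assoc)
    moreover have "Cst (inverse c) * nestf r U \<in> carrier ?R" "nestf r V \<in> carrier ?R"
      using nestf_carrier vars Pc(2) ratfuns_inverse by (blast intro: Cst_mult_carrier)+
    ultimately have "Cst (inverse c) * nestf r U \<in> Units ?R \<or> nestf r V \<in> Units ?R"
      using ring_irreducible_mpoly_ringD(3)[OF f(2)] ratfuns_0 ratfuns_1 by blast
    then show "U dvd 1 \<or> V dvd 1"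
    proof
      assume "Cst (inverse c) * nestf r U \<in> Units ?R"
      then obtain x where x: "Cst (inverse c) * nestf r U = Cst x" "x \<in> ratfuns r" "x \<noteq> 0"
        by (rule Units_mpoly_ringD)
      then have U: "nestf r U = Cst (c * x)" using inv(2)[of "nestf r U"] by (simp add: mult_single)
      have "P = V * U" using UV by (simp only: mult.commute)
      then have "U dvd 1"
        by (rule drop[OF _ U]) (use x Pc in \<open>auto intro: ratfuns_mult\<close>)
      then show ?thesis ..
    next
      assume "nestf r V \<in> Units ?R"
      then obtain x where x: "nestf r V = Cst x" "x \<in> ratfuns r" "x \<noteq> 0"
        by (rule Units_mpoly_ringD)
      then have "V dvd 1" using drop[of U V x] UV by simp
      then show ?thesis ..
    qed
  qed (fact P0)
  \<comment> \<open>A \<open>P\<close> without any \<open>x\<close> would make \<open>f\<close> a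
    nonzero element of \<open>K(\<lambda>)\<close>, hence a unit.\<close>
  moreover have "\<exists>i>r. i \<in> mvars P"
  proof (rule ccontr)
    assume "\<not> ?thesis"
    then have v: "mvars P \<subseteq> {1..r}" using Pc(1) by (auto simp: subset_iff not_less)
    have "nest r P = Cst P"
      by (rule rhom_mpoly_eqI[OF rhom_nest rhom_Cst]) (use v in \<open>auto simp: nest_Cst nest_Var\<close>)
    then have "nestf r P = Cst (to_fract P)" by (simp add: nestf_def map_coeffs_Cst[OF rhom_to_fract])
    then have "f = Cst (inverse c * to_fract P)" using f_eq by (simp add: mult_single)
    moreover have "inverse c * to_fract P \<in> ratfuns r"
      using Pc(2) v by (intro ratfuns_mult ratfuns_inverse ratfuns_to_fract)
    moreover have "inverse c * to_fract P \<noteq> 0" using Pc(3) P0 by simp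
    ultimately show False using fU cst_unit by blast
  qed
  ultimately show thesis using that Pc by blast
qed

section \<open>Points of a Hilbert subset from irreducible specializations\<close>

lemma ring_irreducible_if_irreducible:
  fixes h :: "'k::field mpoly"
  assumes "irreducible h"
  shows "ring_irreducible\<^bsub>mpoly_ring UNIV n\<^esub> h"
proof (rule ring_irreducible_mpoly_ringI)
  show "h \<noteq> 0" using assms by auto
  show "h \<notin> Units (mpoly_ring UNIV n)"
  proof
    assume "h \<in> Units (mpoly_ring UNIV n)"
    then obtain v where "h * v = 1" by (auto simp: Units_def)
    then have "h dvd 1" by (metis dvdI)
    then show False using assms by (simp add: irreducible_def)
  qed
  fix u v assume "h = u * v"
  then have "u dvd 1 \<or> v dvd 1" using assms irreducibleD by blast
  moreover have "w \<in> Units (mpoly_ring UNIV n)" if w: "w dvd 1" for w :: "'k mpoly"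
  proof -
    obtain x where x: "w * x = 1" using w by (metis dvdE)
    obtain c where "w = Cst c" using unit_mpoly(1)[OF x] by blast
    moreover from this have "c \<noteq> 0" using x by auto
    ultimately show ?thesis by (simp add: Cst_in_Units)
  qed
  ultimately show "u \<in> Units (mpoly_ring UNIV n) \<or> v \<in> Units (mpoly_ring UNIV n)" by blast
qed

lemma irreducible_Cst_mult:
  fixes h :: "'k::field mpoly"
  assumes "irreducible h" "c \<noteq> 0"
  shows "irreducible (Cst c * h)"
proof (rule irreducibleI)
  have c: "Cst (inverse c) * Cst c = (1 :: 'k mpoly)" using assms(2) by (simp add: mult_single)
  then have inv: "Cst (inverse c) * (Cst c * g) = g" for g :: "'k mpoly"
    by (simp flip: mult.assoc)
  show "Cst c * h \<noteq> 0" using inv[of h] assms(1) by auto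
  show "\<not> Cst c * h dvd 1" using assms(1) dvd_mult_right[of "Cst c" h 1] by (auto simp: irreducible_def)
  fix a b assume "Cst c * h = a * b"
  then have "h = (Cst (inverse c) * a) * b" using inv[of h] by (simp add: mult.assoc)
  then have "Cst (inverse c) * a dvd 1 \<or> b dvd 1" using assms(1) irreducibleD by blast
  then show "a dvd 1 \<or> b dvd 1" using dvd_mult_right by blast
qed

text \<open>With \<open>c = p / q\<close>, the nonvanishing of \<open>p * q\<close> makes
  \<open>1 / c\<close> defined and nonzero at the point, so the specialized \<open>f\<close> is the
  specialized \<open>P\<close> times a nonzero constant.\<close>

lemma specialize_model:
  fixes f :: "'k::field mpoly fract mpoly"
  assumes P: "mvars P \<subseteq> {1..r + n}" and c: "c \<in> ratfuns r" "c \<noteq> 0" "nestf r P = Cst c * f"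
  obtains Q where "Q \<noteq> 0" "\<And>lam. specs r lam Q \<noteq> 0 \<Longrightarrow> irreducible (specs r lam P) \<Longrightarrow>
    \<exists>h. specializes_to r lam f h \<and> h \<in> carrier (mpoly_ring UNIV n) \<and> ring_irreducible\<^bsub>mpoly_ring UNIV n\<^esub> h"
proof -
  obtain p q where pq: "mvars p \<subseteq> {1..r}" "mvars q \<subseteq> {1..r}" "q \<noteq> 0" "c = to_fract p / to_fract q"
    using c(1) unfolding ratfuns_iff by blast
  have p0: "p \<noteq> 0" using pq c(2) by auto
  have vP: "mvars P \<subseteq> {1..}" using P by auto
  show thesis
  proof (rule that[of "p * q"])
    show "p * q \<noteq> 0" using p0 pq by simp
    fix lam
    assume Q: "specs r lam (p * q) \<noteq> 0" and irr: "irreducible (specs r lam P)"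
    have ev: "mpoly_eval lam p \<noteq> 0" "mpoly_eval lam q \<noteq> 0"
      using Q by (auto simp: rhom_mult[OF rhom_specs] specs_eq_eval[OF pq(1)] specs_eq_eval[OF pq(2)])
    note E = rhom_map_coeffs[OF rhom_mpoly_eval[of lam]]
    define h0 where "h0 = map_coeffs (mpoly_eval lam) (nest r P)"
    \<comment> \<open>In \<open>P\<close> the indeterminate \<open>x_j\<close> has index
      \<open>r + j\<close>, in \<open>f\<close> it has index \<open>j\<close>. Irreducibility is
      carried back along \<open>shift\<close>, of which \<open>unshift\<close> is a left
      inverse.\<close>
    define shift :: "'k mpoly \<Rightarrow> 'k mpoly" where "shift = meval Cst (\<lambda>j. Var (r + j))"
    define unshift :: "'k mpoly \<Rightarrow> 'k mpoly" where "unshift = meval Cst (\<lambda>j. Var (j - r))"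
    have sh: "rhom shift" "rhom unshift" unfolding shift_def unshift_def by (rule rhom_meval[OF rhom_Cst])+
    have sh_simps: "shift (Cst x) = Cst x" "unshift (Cst x) = Cst x" "shift (Var i) = Var (r + i)" "unshift (Var i) = Var (i - r)" for x i
      by (simp_all add: shift_def unshift_def meval_Cst meval_Var[OF rhom_Cst])
    have us: "unshift (shift x) = x" for x
      by (rule rhom_mpoly_eqI[OF rhom_comp[OF sh(2,1)] rhom_id]) (simp_all add: sh_simps)
    have "shift h0 = specs r lam P"
      unfolding h0_def
      by (rule rhom_mpoly_eqI[OF rhom_comp[OF sh(1) rhom_comp[OF E rhom_nest]] rhom_specs])
         (use vP in \<open>auto simp: nest_Cst nest_Var map_coeffs_Cst map_coeffs_Var rhom_mpoly_eval sh_simps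
            specs_Cst specs_Var mpoly_eval_conv meval_Cst meval_Var[OF rhom_id]\<close>)
    then have h0: "irreducible h0" using irreducible_retract[OF sh us, of h0] irr by simp
    define h where "h = Cst (mpoly_eval lam q / mpoly_eval lam p) * h0"
    have "irreducible h" unfolding h_def by (rule irreducible_Cst_mult[OF h0]) (use ev in simp)
    then have "ring_irreducible\<^bsub>mpoly_ring UNIV n\<^esub> h" by (rule ring_irreducible_if_irreducible)
    moreover have "h \<in> carrier (mpoly_ring UNIV n)"
    proof -
      have "mvars h0 \<subseteq> {1..n}" unfolding h0_def using mvars_map_coeffs[OF rhom_mpoly_eval] mvars_nest[OF P] by blast
      then show ?thesis
        using mvars_mult_subset[of "Cst (mpoly_eval lam q / mpoly_eval lam p)" h0] by (auto simp: h_def carrier_mpoly_ring)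
    qed
    moreover have "specializes_to r lam f h"
      unfolding specializes_to_def ratfun_value_def
    proof
      fix m
      let ?Pm = "Poly_Mapping.lookup (nest r P) m"
      have "Poly_Mapping.lookup (nestf r P) m = c * Poly_Mapping.lookup f m"
        unfolding c(3) by (rule lookup_Cst_mult)
      then have "to_fract ?Pm = c * Poly_Mapping.lookup f m"
        by (simp add: nestf_def lookup_map_coeffs[OF rhom_to_fract])
      then have "Poly_Mapping.lookup f m = Fraction_Field.Fract (q * ?Pm) p"
        using p0 pq by (simp add: Fract_conv_to_fract field_simps)
      moreover have "Poly_Mapping.lookup h m = mpoly_eval lam (q * ?Pm) / mpoly_eval lam p"
        by (simp add: h_def h0_def lookup_Cst_mult lookup_map_coeffs[OF rhom_mpoly_eval] rhom_mult[OF rhom_mpoly_eval])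
      moreover have "mvars (q * ?Pm) \<subseteq> {1..r}"
        using mvars_mult_subset[of q ?Pm] mvars_lookup_nest[OF vP, of r m] pq(2) by blast
      ultimately show "\<exists>pa\<in>carrier (mpoly_ring UNIV r). \<exists>qa\<in>carrier (mpoly_ring UNIV r).
          Poly_Mapping.lookup f m = Fraction_Field.Fract pa qa \<and> mpoly_eval lam qa \<noteq> 0 \<and>
          Poly_Mapping.lookup h m = mpoly_eval lam pa / mpoly_eval lam qa"
        using ev pq(1) by (intro bexI[of _ "q * ?Pm"] bexI[of _ p]) (auto simp: carrier_mpoly_ring)
    qed
    ultimately show "\<exists>h. specializes_to r lam f h \<and> h \<in> carrier (mpoly_ring UNIV n) \<and>
        ring_irreducible\<^bsub>mpoly_ring UNIV n\<^esub> h" by blast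
  qed
qed

lemma hilbert_subset_congruence:
  fixes l0 :: "'a::idom" and a :: "nat \<Rightarrow> 'a"
  assumes hilb: "sep_hilb (range (to_fract :: 'a \<Rightarrow> 'a fract))"
    and imp: "CHAR('a fract) > 0 \<Longrightarrow> range (\<lambda>x::'a fract. x ^ CHAR('a fract)) \<noteq> UNIV"
    and l0: "l0 \<noteq> 0" and H: "hilbert_subset r H"
  shows "\<exists>lam\<in>H. \<exists>l. \<forall>i\<in>{1..r}. lam i = to_fract (l i) \<and> l i \<noteq> 0 \<and> l0 * (\<Prod>j\<in>{1..<i}. l j) dvd l i - a i"
proof -
  obtain n F g where D: "hilbert_data r n F g" and H: "H = hilbert_set r n F g"
    using H by (auto simp: hilbert_subset_def)
  have F: "finite F" "\<And>f. f \<in> F \<Longrightarrow> f \<in> carrier (mpoly_ring (ratfuns r) n) \<and>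
      ring_irreducible\<^bsub>mpoly_ring (ratfuns r) n\<^esub> f"
    and g: "mvars g \<subseteq> {1..r}" "g \<noteq> 0"
    using D by (auto simp: hilbert_data_def carrier_mpoly_ring[of g])
  define good where "good f P Q \<longleftrightarrow> irreducible P \<and> mvars P \<subseteq> {1..r + n} \<and> (\<exists>i>r. i \<in> mvars P) \<and> Q \<noteq> 0 \<and>
    (\<forall>lam. specs r lam Q \<noteq> 0 \<longrightarrow> irreducible (specs r lam P) \<longrightarrow>
      (\<exists>h. specializes_to r lam f h \<and> h \<in> carrier (mpoly_ring UNIV n) \<and> ring_irreducible\<^bsub>mpoly_ring UNIV n\<^esub> h))"
    for f and P Q :: "'a fract mpoly"
  have "\<exists>P Q. good f P Q" if f: "f \<in> F" for f
  proof -
    have f': "f \<in> carrier (mpoly_ring (ratfuns r) n)" "ring_irreducible\<^bsub>mpoly_ring (ratfuns r) n\<^esub> f" using F(2)[OF f] by auto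
    obtain P c where P: "irreducible P" "mvars P \<subseteq> {1..r + n}" "\<exists>i>r. i \<in> mvars P"
      "c \<in> ratfuns r" "c \<noteq> 0" "nestf r P = Cst c * f"
      using irreducible_model[OF f'] by blast
    obtain Q where "Q \<noteq> 0" "\<And>lam. specs r lam Q \<noteq> 0 \<Longrightarrow> irreducible (specs r lam P) \<Longrightarrow>
      \<exists>h. specializes_to r lam f h \<and> h \<in> carrier (mpoly_ring UNIV n) \<and> ring_irreducible\<^bsub>mpoly_ring UNIV n\<^esub> h"
      using specialize_model[OF P(2,4-6)] by blast
    with P have "good f P Q" by (simp add: good_def)
    then show ?thesis by blast
  qed
  then obtain PP QQ where G: "\<And>f. f \<in> F \<Longrightarrow> good f (PP f) (QQ f)" by metis
  have Ps: "irreducible P \<and> mvars P \<subseteq> {1..} \<and> (\<exists>i>r. i \<in> mvars P)" if "P \<in> PP ` F" for P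
    using G that by (fastforce simp: good_def)
  have Qs: "0 \<notin> insert g (QQ ` F)" using G g(2) by (auto simp: good_def)
  have fin: "finite (PP ` F)" "finite (insert g (QQ ` F))" using F(1) by auto
  obtain l where l: "\<And>i. i \<in> {1..r} \<Longrightarrow> l i \<noteq> 0 \<and> l0 * (\<Prod>j\<in>{1..<i}. l j) dvd l i - a i"
    "\<And>P. P \<in> PP ` F \<Longrightarrow> irreducible (specs r (\<lambda>i. to_fract (l i)) P)"
    "\<And>Q. Q \<in> insert g (QQ ` F) \<Longrightarrow> specs r (\<lambda>i. to_fract (l i)) Q \<noteq> 0"
    using specialize_all[OF hilb imp fin(1) Ps fin(2) Qs l0, where a = a] by blast
  define lam where "lam = restrict (\<lambda>i. to_fract (l i)) {1..r}"
  have sl: "specs r (\<lambda>i. to_fract (l i)) p = specs r lam p" for p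
    by (rule specs_cong) (simp add: lam_def)
  have "lam \<in> H"
    unfolding H hilbert_set_def
  proof (intro CollectI conjI ballI)
    show "lam \<in> {1..r} \<rightarrow>\<^sub>E UNIV" by (simp add: lam_def)
    show "mpoly_eval lam g \<noteq> 0" using l(3)[of g] by (auto simp: sl specs_eq_eval[OF g(1)])
    fix f assume f: "f \<in> F"
    have "specs r lam (QQ f) \<noteq> 0" "irreducible (specs r lam (PP f))"
      unfolding sl[symmetric] using f l(2,3) by blast+
    then show "\<exists>h. specializes_to r lam f h \<and> h \<in> carrier (mpoly_ring UNIV n) \<and>
        ring_irreducible\<^bsub>mpoly_ring UNIV n\<^esub> h"
      using G[OF f] unfolding good_def by blast
  qed
  moreover have "\<forall>i\<in>{1..r}. lam i = to_fract (l i) \<and> l i \<noteq> 0 \<and> l0 * (\<Prod>j\<in>{1..<i}. l j) dvd l i - a i"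
    using l(1) by (simp add: lam_def)
  ultimately show ?thesis by blast
qed

section \<open>Separable Hilbert subsets of the field\<close>

text \<open>Ignoring the exponents of all indeterminates but the first amounts to setting the others
  to \<open>1\<close>; in this form \<open>univariate\<close> is visibly a morphism.\<close>

lemma univariate_conv: "univariate f = meval (\<lambda>c. [:c:]) (\<lambda>i. if i = 1 then [:0, 1:] else 1) f"
proof -
  have "Polynomial.monom c (Poly_Mapping.lookup m 1) =
      [:c:] * (\<Prod>i\<in>Poly_Mapping.keys m. (if i = 1 then [:0, 1:] else 1) ^ Poly_Mapping.lookup m i)" for c :: 'a and m
  proof -
    have "(\<Prod>i\<in>Poly_Mapping.keys m. (if i = 1 then [:0, 1:] else 1) ^ Poly_Mapping.lookup m i) =
        (\<Prod>i\<in>insert 1 (Poly_Mapping.keys m). (if i = 1 then [:0, 1::'a:] else 1) ^ Poly_Mapping.lookup m i)"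
      by (rule prod_power_superset) auto
    also have "\<dots> = [:0, 1:] ^ Poly_Mapping.lookup m 1 *
        (\<Prod>i\<in>Poly_Mapping.keys m - {1}. (if i = 1 then [:0, 1:] else 1) ^ Poly_Mapping.lookup m i)"
      by (subst prod.insert_remove) auto
    also have "(\<Prod>i\<in>Poly_Mapping.keys m - {1}. (if i = 1 then [:0, 1::'a:] else 1) ^ Poly_Mapping.lookup m i) = 1"
      by (rule prod.neutral) auto
    finally show ?thesis by (simp add: monom_altdef)
  qed
  then show ?thesis unfolding univariate_def meval_def by (intro sum.cong refl)
qed

lemma rhom_univariate: "rhom univariate"
  unfolding univariate_conv[abs_def] by (rule rhom_meval[OF rhom_pCons])

lemma univariate_Cst: "univariate (Cst c) = [:c:]"
  by (simp add: univariate_conv meval_Cst)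

lemma univariate_Var: "univariate (Var 1) = [:0, 1:]"
  by (simp add: univariate_conv meval_Var[OF rhom_pCons])

lemma univariate_emb: "univariate (emb 1 p) = p"
  by (rule rhom_poly_eqI[OF rhom_comp[OF rhom_univariate rhom_emb] rhom_id])
     (simp_all add: emb_const emb_X univariate_Cst univariate_Var[unfolded One_nat_def])

lemma emb_univariate: "mvars f \<subseteq> {1} \<Longrightarrow> emb 1 (univariate f) = f"
  by (rule rhom_mpoly_eqI[OF rhom_comp[OF rhom_emb rhom_univariate] rhom_id])
     (auto simp: univariate_Cst univariate_Var[unfolded One_nat_def] emb_const emb_X[unfolded One_nat_def])

lemma mvars_emb: "mvars (emb k p) \<subseteq> {k}"
proof (induction p)
  case (pCons a p)
  have "emb k (pCons a p) = Cst a + Var k * emb k p"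
    by (simp add: emb_def map_poly_pCons)
  moreover have "mvars (Cst a + Var k * emb k p) \<subseteq> {k}"
    using mvars_add[of "Cst a" "Var k * emb k p"] mvars_mult_subset[of "Var k" "emb k p"] pCons.IH by auto
  ultimately show ?case by simp
qed (simp add: rhom_0[OF rhom_emb])

lemma map_coeffs_emb: "rhom f \<Longrightarrow> map_coeffs f (emb k p) = emb k (map_poly f p)"
  by (rule rhom_poly_eqI[OF rhom_comp[OF rhom_map_coeffs rhom_emb] rhom_comp[OF rhom_emb rhom_map_poly]])
     (simp_all add: emb_const emb_X map_coeffs_Cst map_coeffs_Var map_poly_const_rhom map_poly_pCons rhom_0 rhom_1)

lemma emb_altdef: "emb k p = (\<Sum>i\<le>degree p. Poly_Mapping.single (Poly_Mapping.single k i) (coeff p i))"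
proof -
  have eq: "emb k p = (\<Sum>i\<le>degree p. emb k (Polynomial.monom (coeff p i) i))"
    unfolding rhom_sum[OF rhom_emb, symmetric] by (simp add: poly_as_sum_of_monoms)
  have monom: "emb k (Polynomial.monom c i) = Poly_Mapping.single (Poly_Mapping.single k i) c" for c i
  proof -
    have "emb k (Polynomial.monom c i) = emb k ([:c:] * [:0, 1:] ^ i)" by (simp add: monom_altdef)
    also have "\<dots> = Cst c * Var k ^ i"
      by (simp only: rhom_mult[OF rhom_emb] rhom_power[OF rhom_emb] emb_const emb_X)
    finally show ?thesis unfolding Var_power by (simp add: mult_single)
  qed
  show ?thesis unfolding eq monom ..
qed

lemma lookup_emb: "Poly_Mapping.lookup (emb k p) (Poly_Mapping.single k i) = coeff p i"
proof -
  have "Poly_Mapping.single k j = Poly_Mapping.single k i \<longleftrightarrow> j = i" for j by (metis lookup_single_eq)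
  then show ?thesis
    by (simp add: emb_altdef lookup_sum lookup_single when_def coeff_eq_0)
qed

lemma mpoly_eval_emb: "mpoly_eval lam (emb k p) = poly p (lam k)"
  by (rule rhom_poly_eqI[OF rhom_comp[OF rhom_mpoly_eval rhom_emb] rhom_poly])
     (simp_all add: emb_const emb_X mpoly_eval_conv meval_Cst meval_Var[OF rhom_id])

section \<open>Polynomials over \<open>K[\<lambda>]\<close> as data of separable Hilbert
  subsets\<close>

definition frac_emb :: "'k::field poly \<Rightarrow> 'k mpoly fract" where
  "frac_emb c = to_fract (emb 1 c)"

lemma rhom_frac_emb: "rhom frac_emb"
  unfolding frac_emb_def[abs_def] by (rule rhom_comp[OF rhom_to_fract rhom_emb])

lemma frac_emb_inj: "frac_emb x = frac_emb y \<Longrightarrow> x = y"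
  by (metis frac_emb_def to_fract_eq_iff univariate_emb)

lemma frac_emb_eq_0: "frac_emb x = 0 \<Longrightarrow> x = 0"
  using frac_emb_inj[of x 0] by (simp add: rhom_0[OF rhom_frac_emb])

lemma frac_emb_in_ratfuns: "frac_emb x \<in> ratfuns 1"
  unfolding frac_emb_def using mvars_emb[of 1 x] by (intro ratfuns_to_fract) auto

lemma to_fract_eq_frac_emb: "mvars p \<subseteq> {1..1} \<Longrightarrow> to_fract p = frac_emb (univariate p)"
  using emb_univariate[of p] by (simp add: frac_emb_def)

lemma clear_denominators:
  fixes W :: "'k::field mpoly fract poly"
  assumes "\<And>i. coeff W i \<in> ratfuns 1"
  obtains a U where "a \<noteq> 0" "smult (frac_emb a) W = map_poly frac_emb U"
proof -
  have "coeff W ` {..degree W} \<subseteq> ratfuns 1" using assms by blast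
  from ratfuns_common_denominator[OF _ this] obtain Q where Q: "Q \<noteq> 0" "mvars Q \<subseteq> {1..1}"
    "\<And>i. i \<le> degree W \<Longrightarrow> \<exists>p. mvars p \<subseteq> {1..1} \<and> to_fract Q * coeff W i = to_fract p" by auto
  have Q': "to_fract Q = frac_emb (univariate Q)" using Q(2) by (rule to_fract_eq_frac_emb)
  have "\<exists>u. frac_emb (univariate Q) * coeff W i = frac_emb u" for i
  proof (cases "i \<le> degree W")
    case True
    then show ?thesis using Q(3)[of i] to_fract_eq_frac_emb unfolding Q' by metis
  next
    case False
    then show ?thesis by (intro exI[of _ 0]) (simp add: coeff_eq_0 rhom_0[OF rhom_frac_emb])
  qed
  then obtain u where u: "\<And>i. frac_emb (univariate Q) * coeff W i = frac_emb (u i)" by metis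
  define U where "U = (\<Sum>i\<le>degree W. Polynomial.monom (u i) i)"
  have "frac_emb (coeff U i) = frac_emb (u i)" for i
  proof (cases "i \<le> degree W")
    case False
    then have "frac_emb (u i) = 0" using u[of i] by (simp add: coeff_eq_0)
    then show ?thesis using False by (simp add: U_def coeff_sum rhom_0[OF rhom_frac_emb])
  qed (simp add: U_def coeff_sum)
  then have "smult (frac_emb (univariate Q)) W = map_poly frac_emb U"
    by (intro poly_eqI) (simp add: coeff_map_poly rhom_0[OF rhom_frac_emb] u)
  moreover have "univariate Q \<noteq> 0" using Q(1) emb_univariate[of Q] Q(2) by (auto simp: rhom_0[OF rhom_emb])
  ultimately show thesis by (rule that[rotated])
qed

lemma emb_frac_emb_carrier: "emb 1 (map_poly frac_emb G) \<in> carrier (mpoly_ring (ratfuns 1) 1)"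
proof -
  have "Poly_Mapping.lookup (emb 1 (map_poly frac_emb G)) m \<in> ratfuns 1" for m
    by (simp add: lookup_map_coeffs[OF rhom_frac_emb] frac_emb_in_ratfuns del: One_nat_def
        flip: map_coeffs_emb[OF rhom_frac_emb])
  then show ?thesis using mvars_emb[of 1 "map_poly frac_emb G"] by (simp add: carrier_mpoly_ring)
qed

text \<open>Clearing the denominators of a factorization over \<open>K(\<lambda>)\<close> gives one
  of a multiple of \<open>G\<close> over \<open>K[\<lambda>]\<close>, which \<open>irr_frac\<close>
  controls.\<close>

lemma ring_irreducible_emb:
  fixes G :: "'k::field poly poly"
  assumes G: "irr_frac G"
  shows "ring_irreducible\<^bsub>mpoly_ring (ratfuns 1) 1\<^esub> (emb 1 (map_poly frac_emb G))"
proof (rule ring_irreducible_mpoly_ringI)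
  let ?R = "mpoly_ring (ratfuns 1 :: 'k mpoly fract set) 1"
  note E = rhom_map_poly[OF rhom_frac_emb]
  have deg: "degree (map_poly frac_emb W) = degree W" for W :: "'k poly poly"
    by (rule degree_map_poly_rhom[OF rhom_frac_emb frac_emb_eq_0])
  have G0: "degree G > 0" using G by (simp add: irr_frac_def)
  show ne: "emb 1 (map_poly frac_emb G) \<noteq> 0"
  proof
    assume "emb 1 (map_poly frac_emb G) = 0"
    then have "univariate (emb 1 (map_poly frac_emb G)) = univariate 0" by (rule arg_cong)
    then have "map_poly frac_emb G = 0" unfolding univariate_emb rhom_0[OF rhom_univariate] .
    then show False using deg[of G] G0 by simp
  qed
  show "emb 1 (map_poly frac_emb G) \<notin> Units ?R"
  proof
    assume "emb 1 (map_poly frac_emb G) \<in> Units ?R"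
    then obtain c where "emb 1 (map_poly frac_emb G) = Cst c" by (rule Units_mpoly_ringD)
    then have "map_poly frac_emb G = [:c:]" using univariate_emb[of "map_poly frac_emb G"] univariate_Cst by metis
    then show False using deg[of G] G0 by simp
  qed
  fix u v assume u: "u \<in> carrier ?R" and v: "v \<in> carrier ?R" and uv: "emb 1 (map_poly frac_emb G) = u * v"
  have coeffs: "coeff (univariate w) i \<in> ratfuns 1" if "w \<in> carrier ?R" for w i
  proof -
    have e: "emb 1 (univariate w) = w" using that by (intro emb_univariate) (auto simp: carrier_mpoly_ring)
    show ?thesis
      using that lookup_emb[of 1 "univariate w" i, symmetric] unfolding e carrier_mpoly_ring by metis
  qed
  obtain a U where U: "a \<noteq> 0" "smult (frac_emb a) (univariate u) = map_poly frac_emb U"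
    using clear_denominators coeffs[OF u] by blast
  obtain b V where V: "b \<noteq> 0" "smult (frac_emb b) (univariate v) = map_poly frac_emb V"
    using clear_denominators coeffs[OF v] by blast
  have prod: "map_poly frac_emb G = univariate u * univariate v"
    using arg_cong[OF uv, of univariate] unfolding univariate_emb rhom_mult[OF rhom_univariate] .
  have "map_poly frac_emb (smult (a * b) G) = map_poly frac_emb (U * V)"
    unfolding map_poly_smult_rhom[OF rhom_frac_emb] rhom_mult[OF E] U(2)[symmetric] V(2)[symmetric] prod
    by (simp add: rhom_mult[OF rhom_frac_emb] mult_ac)
  then have "smult (a * b) G = U * V"
    using map_poly_inj[of frac_emb "smult (a * b) G" "U * V"] rhom_0[OF rhom_frac_emb] frac_emb_inj by blast
  then have "degree U = 0 \<or> degree V = 0" using irr_fracD[OF G, of "a * b"] U(1) V(1) by simp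
  moreover have "w \<in> Units ?R" if w: "w \<in> carrier ?R" "w \<noteq> 0" and c: "c \<noteq> 0"
    "smult (frac_emb c) (univariate w) = map_poly frac_emb W" "degree W = 0" for w c W
  proof -
    have "frac_emb c \<noteq> 0" using c(1) frac_emb_eq_0 by blast
    then have "degree (univariate w) = 0" using arg_cong[OF c(2), of degree] deg[of W] c(3) by simp
    then obtain d where d: "univariate w = [:d:]" by (metis degree_eq_zeroE)
    have w_eq: "w = Cst d"
      using emb_univariate[of w] w(1) d emb_const[of 1 d] by (auto simp: carrier_mpoly_ring)
    then have "d \<noteq> 0" using w(2) by auto
    moreover have "d \<in> ratfuns 1" using coeffs[OF w(1), of 0] d by simp
    ultimately show ?thesis unfolding w_eq using ratfuns_inverse ratfuns_0 by (intro Cst_in_Units)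
  qed
  moreover have "u \<noteq> 0" "v \<noteq> 0" using ne uv by auto
  ultimately show "u \<in> Units ?R \<or> v \<in> Units ?R" using u v U V by blast
qed

text \<open>A multiple root would be a root of the nonzero derivative, whose degree is smaller than
  that of \<open>G\<close>; \<open>irr_frac\<close> forbids this.\<close>

lemma separable_emb:
  fixes G :: "'k::field poly poly"
  assumes G: "irr_frac G" "pderiv G \<noteq> 0"
  shows "separable_in_x (emb 1 (map_poly frac_emb G))"
proof -
  define f where "f = (\<lambda>c :: 'k poly. to_ac (frac_emb c))"
  have f: "rhom f" unfolding f_def by (rule rhom_comp[OF _ rhom_frac_emb]) (simp add: rhom_def)
  have f0: "x = 0" if "f x = 0" for x using that frac_emb_eq_0 by (simp add: f_def)
  have eq: "map_poly to_ac (map_poly frac_emb G) = map_poly f G"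
    unfolding f_def by (rule map_poly_comp_rhom[OF _ rhom_frac_emb]) (simp add: rhom_def)
  have G0: "degree G > 0" using G by (simp add: irr_frac_def)
  have pd: "pderiv (map_poly f G) = map_poly f (pderiv G)"
    by (rule poly_eqI) (simp add: coeff_map_poly coeff_pderiv rhom_simps[OF f] rhom_of_nat[OF f] flip: of_nat_Suc)
  have nz: "map_poly f G \<noteq> 0" using degree_map_poly_rhom[OF f f0, of G] G0 by auto
  have "Polynomial.order \<alpha> (map_poly f G) \<le> 1" for \<alpha>
  proof (rule ccontr)
    assume "\<not> ?thesis"
    then have "[:- \<alpha>, 1:] ^ 2 dvd map_poly f G"
      using order_divides[of \<alpha> 2 "map_poly f G"] by simp
    then obtain q where "map_poly f G = [:- \<alpha>, 1:] ^ 2 * q" by (rule dvdE)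
    then have q: "map_poly f G = [:- \<alpha>, 1:] * ([:- \<alpha>, 1:] * q)" by (simp only: power2_eq_square mult.assoc)
    then have "poly (map_poly f G) \<alpha> = 0" by simp
    moreover have "poly (pderiv (map_poly f G)) \<alpha> = 0" unfolding q by (simp only: pderiv_mult poly_add poly_mult) simp
    ultimately show False
      using irr_frac_no_common_root[OF G(1) f f0 G(2) degree_pderiv_less[OF G0]] unfolding pd by blast
  qed
  then have "Polynomial.order \<alpha> (map_poly f G) = 0 \<or> Polynomial.order \<alpha> (map_poly f G) = 1" for \<alpha>
    by (metis le_neq_implies_less less_one)
  then show ?thesis
    using nz by (simp add: separable_in_x_def univariate_emb[unfolded One_nat_def] eq rsquarefree_def)
qed

text \<open>\<open>ratfun_value\<close> admits any representing fraction. Cross-multiplication in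
  the polynomial ring shows that all of them yield the same value.\<close>

lemma ratfun_value_frac_emb:
  assumes "ratfun_value 1 lam (frac_emb c) v"
  shows "v = poly c (lam 1)"
proof -
  obtain p q where pq: "frac_emb c = Fraction_Field.Fract p q" "mpoly_eval lam q \<noteq> 0"
    "v = mpoly_eval lam p / mpoly_eval lam q" using assms unfolding ratfun_value_def by blast
  have "q \<noteq> 0" using pq(2) rhom_0[OF rhom_mpoly_eval] by auto
  then have "to_fract p = to_fract (q * emb 1 c)"
    using pq(1) by (simp add: frac_emb_def Fract_conv_to_fract field_simps)
  then have "p = q * emb 1 c" by (simp only: to_fract_eq_iff)
  then show ?thesis using pq(2,3) by (simp add: rhom_mult[OF rhom_mpoly_eval] mpoly_eval_emb)
qed

lemma irreducible_if_ring_irreducible_emb: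
  fixes g :: "'k::field poly"
  assumes "ring_irreducible\<^bsub>mpoly_ring UNIV 1\<^esub> (emb 1 g)"
  shows "irreducible g"
proof -
  note irr = ring_irreducible_mpoly_ringD[OF assms]
  have unit: "w dvd 1 \<longleftrightarrow> emb 1 w \<in> Units (mpoly_ring UNIV 1)" if "w \<noteq> 0" for w :: "'k poly"
  proof
    assume "w dvd 1"
    then obtain c where c: "w = [:c:]" by (metis degree_eq_zeroE degree_unit)
    then show "emb 1 w \<in> Units (mpoly_ring UNIV 1)" using that by (simp add: emb_const Cst_in_Units)
  next
    assume "emb 1 w \<in> Units (mpoly_ring UNIV 1)"
    then obtain c where "emb 1 w = Cst c" "c \<noteq> 0" by (rule Units_mpoly_ringD)
    then have "w = [:c:]" using univariate_emb univariate_Cst by metis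
    then show "w dvd 1" using \<open>c \<noteq> 0\<close> by (simp add: is_unit_const_poly_iff dvd_field_iff)
  qed
  have car: "emb 1 w \<in> carrier (mpoly_ring UNIV 1)" for w :: "'k poly"
    using mvars_emb[of 1 w] by (simp add: carrier_mpoly_ring)
  show ?thesis
  proof (rule irreducibleI)
    show g0: "g \<noteq> 0" using irr(1) rhom_0[OF rhom_emb] by auto
    show "\<not> g dvd 1" using irr(2) unit[OF g0] by simp
    fix u v assume uv: "g = u * v"
    then have "u \<noteq> 0" "v \<noteq> 0" using g0 by auto
    moreover have "emb 1 u \<in> Units (mpoly_ring UNIV 1) \<or> emb 1 v \<in> Units (mpoly_ring UNIV 1)"
      by (rule irr(3)) (simp_all add: car[unfolded One_nat_def] uv rhom_mult[OF rhom_emb])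
    ultimately show "u dvd 1 \<or> v dvd 1" using unit by blast
  qed
qed

lemma sep_hilbI:
  fixes A :: "'k::field set"
  assumes ii: "\<And>H :: (nat \<Rightarrow> 'k) set. separable_hilbert_subset 1 H \<Longrightarrow> \<exists>lam\<in>H. lam 1 \<in> A"
  shows "sep_hilb A"
  unfolding sep_hilb_def
proof (intro allI impI)
  fix Gs :: "'k poly poly set" and gp :: "'k poly"
  assume fin: "finite Gs" and Gs: "\<forall>G\<in>Gs. irr_frac G \<and> pderiv G \<noteq> 0" and gp: "gp \<noteq> 0"
  \<comment> \<open>Hilbert data demand a nonempty set of polynomials; adding \<open>y\<close>
    itself covers the case of empty \<open>Gs\<close>.\<close>
  let ?X = "[:0, 1:] :: 'k poly poly"
  have X: "irr_frac ?X \<and> pderiv ?X \<noteq> 0"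
  proof
    show "irr_frac ?X"
      unfolding irr_frac_def
    proof (intro conjI allI impI)
      fix a and U V :: "'k poly poly" assume "a \<noteq> 0" and eq: "smult a ?X = U * V"
      then have "U \<noteq> 0" "V \<noteq> 0" by auto
      then have "degree U + degree V = 1" using arg_cong[OF eq, of degree] \<open>a \<noteq> 0\<close> by (simp add: degree_mult_eq)
      then show "degree U = 0 \<or> degree V = 0" by linarith
    qed simp
  qed (simp add: pderiv_pCons)
  let ?e = "\<lambda>G. emb 1 (map_poly frac_emb G)"
  define H where "H = hilbert_set 1 1 (?e ` insert ?X Gs) (emb 1 gp)"
  have gp': "emb 1 gp \<noteq> 0" using gp univariate_emb[of gp] rhom_0[OF rhom_univariate] by metis
  have good: "irr_frac G \<and> pderiv G \<noteq> 0" if "G \<in> insert ?X Gs" for G using that X Gs by blast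
  have "hilbert_data 1 1 (?e ` insert ?X Gs) (emb 1 gp)"
    unfolding hilbert_data_def
  proof (intro conjI ballI)
    fix f assume "f \<in> ?e ` insert ?X Gs"
    then obtain G where G: "G \<in> insert ?X Gs" "f = ?e G" by blast
    show "f \<in> carrier (mpoly_ring (ratfuns 1) 1)" unfolding G(2) by (rule emb_frac_emb_carrier)
    show "ring_irreducible\<^bsub>mpoly_ring (ratfuns 1) 1\<^esub> f"
      unfolding G(2) by (rule ring_irreducible_emb) (use good[OF G(1)] in blast)
  next
    show "emb 1 gp \<in> carrier (mpoly_ring UNIV 1)" using mvars_emb[of 1 gp] by (simp add: carrier_mpoly_ring)
  qed (use fin gp' in auto)
  moreover have "\<forall>f\<in>?e ` insert ?X Gs. separable_in_x f" using separable_emb good by blast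
  ultimately have "separable_hilbert_subset 1 H" unfolding separable_hilbert_subset_def H_def by blast
  then obtain lam where lam: "lam \<in> H" "lam 1 \<in> A" using ii by blast
  show "\<exists>l\<in>A. poly gp l \<noteq> 0 \<and> (\<forall>G\<in>Gs. irreducible (map_poly (\<lambda>c. poly c l) G))"
  proof (intro bexI[OF _ lam(2)] conjI ballI)
    show "poly gp (lam 1) \<noteq> 0" using lam(1) by (simp add: H_def hilbert_set_def mpoly_eval_emb)
    fix G assume "G \<in> Gs"
    then obtain h where h: "specializes_to 1 lam (?e G) h" "ring_irreducible\<^bsub>mpoly_ring UNIV 1\<^esub> h"
      using lam(1) unfolding H_def hilbert_set_def by blast
    have "h = emb 1 (map_poly (\<lambda>c. poly c (lam 1)) G)"
    proof (rule poly_mapping_eqI)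
      fix m
      have "ratfun_value 1 lam (Poly_Mapping.lookup (map_coeffs frac_emb (emb 1 G)) m) (Poly_Mapping.lookup h m)"
        using h(1) unfolding specializes_to_def map_coeffs_emb[OF rhom_frac_emb] by blast
      then have "Poly_Mapping.lookup h m = poly (Poly_Mapping.lookup (emb 1 G) m) (lam 1)"
        unfolding lookup_map_coeffs[OF rhom_frac_emb] by (rule ratfun_value_frac_emb)
      also have "\<dots> = Poly_Mapping.lookup (map_coeffs (\<lambda>c. poly c (lam 1)) (emb 1 G)) m"
        by (rule lookup_map_coeffs[OF rhom_poly, symmetric])
      finally show "Poly_Mapping.lookup h m = Poly_Mapping.lookup (emb 1 (map_poly (\<lambda>c. poly c (lam 1)) G)) m"
        unfolding map_coeffs_emb[OF rhom_poly] .
    qed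
    then show "irreducible (map_poly (\<lambda>c. poly c (lam 1)) G)"
      using h(2) irreducible_if_ring_irreducible_emb by blast
  qed
qed

section \<open>Equivalence of the three conditions\<close>

lemma separable_hilbert_subset_imp_hilbert_subset:
  "separable_hilbert_subset r H \<Longrightarrow> hilbert_subset r H"
  unfolding separable_hilbert_subset_def hilbert_subset_def by blast

theorem proposition4p2:
  assumes imperfect: "CHAR('a::idom fract) > 0 \<Longrightarrow>
     range (\<lambda>x :: 'a fract. x ^ CHAR('a fract)) \<noteq> UNIV"
  shows
    "(hilbertian_ring TYPE('a) \<longleftrightarrow>
        (\<forall>H :: (nat \<Rightarrow> 'a fract) set. separable_hilbert_subset 1 H \<longrightarrow>
           (\<exists>lam\<in>H. lam 1 \<in> range to_frac)))
     \<and>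
     ((\<forall>H :: (nat \<Rightarrow> 'a fract) set. separable_hilbert_subset 1 H \<longrightarrow>
           (\<exists>lam\<in>H. lam 1 \<in> range to_frac)) \<longleftrightarrow>
      (\<forall>r\<ge>1. \<forall>(l0 :: 'a) (a :: nat \<Rightarrow> 'a). l0 \<noteq> 0 \<longrightarrow>
         (\<forall>H :: (nat \<Rightarrow> 'a fract) set. hilbert_subset r H \<longrightarrow>
            (\<exists>lam\<in>H. \<exists>l :: nat \<Rightarrow> 'a.
               \<forall>i\<in>{1..r}. lam i = to_frac (l i) \<and> l i \<noteq> 0 \<and>
                 (l0 * (\<Prod>j\<in>{1..<i}. l j)) dvd (l i - a i)))))"
    (is "(?i \<longleftrightarrow> ?ii) \<and> (?ii \<longleftrightarrow> ?iii)")
proof -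
  have "?ii" if "?i"
  proof (intro allI impI)
    fix H :: "(nat \<Rightarrow> 'a fract) set" assume "separable_hilbert_subset 1 H"
    then have "\<exists>lam\<in>H. \<forall>i\<in>{1..1}. lam i \<in> range to_frac"
      using that unfolding hilbertian_ring_def by blast
    then show "\<exists>lam\<in>H. lam 1 \<in> range to_frac" by simp
  qed
  moreover have "?iii" if "?ii"
  proof (intro allI impI)
    fix r :: nat and l0 :: 'a and a :: "nat \<Rightarrow> 'a" and H :: "(nat \<Rightarrow> 'a fract) set"
    assume l0: "l0 \<noteq> 0" and H: "hilbert_subset r H"
    have "sep_hilb (range (to_fract :: 'a \<Rightarrow> 'a fract))"
    proof (rule sep_hilbI)
      fix H :: "(nat \<Rightarrow> 'a fract) set" assume "separable_hilbert_subset 1 H"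
      with \<open>?ii\<close> have "\<exists>lam\<in>H. lam 1 \<in> range to_frac" by blast
      then show "\<exists>lam\<in>H. lam 1 \<in> range to_fract" unfolding Fract_1_eq .
    qed
    from hilbert_subset_congruence[OF this imperfect l0 H, of a]
    show "\<exists>lam\<in>H. \<exists>l :: nat \<Rightarrow> 'a. \<forall>i\<in>{1..r}. lam i = to_frac (l i) \<and> l i \<noteq> 0 \<and>
        (l0 * (\<Prod>j\<in>{1..<i}. l j)) dvd (l i - a i)"
      unfolding to_fract_def by blast
  qed
  moreover have "?i" if "?iii"
    unfolding hilbertian_ring_def
  proof (intro allI impI)
    fix r :: nat and H :: "(nat \<Rightarrow> 'a fract) set"
    assume "1 \<le> r" "separable_hilbert_subset r H"
    \<comment> \<open>Any congruences would do for (i); residues \<open>0\<close> and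
      \<open>l0 = 1\<close> are inserted.\<close>
    moreover define a :: "nat \<Rightarrow> 'a" where "a = (\<lambda>_. 0)"
    ultimately have "\<exists>lam\<in>H. \<exists>l. \<forall>i\<in>{1..r}. lam i = to_frac (l i) \<and> l i \<noteq> 0 \<and>
        (1 * (\<Prod>j\<in>{1..<i}. l j)) dvd (l i - a i)"
      by (intro that[rule_format] separable_hilbert_subset_imp_hilbert_subset) auto
    then show "\<exists>lam\<in>H. \<forall>i\<in>{1..r}. lam i \<in> range to_frac" by blast
  qed
  ultimately show ?thesis by blast
qed

end
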